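(* Let the balanced-weights assumption hold with constants $c_0>0$, $c_1\ge1$. Consider an instance generated by an IMLSBM in $\mathcal P_n(\rho,\{p_\ell\},\{q_\ell\},\beta)$ with $\rho\in[0,1/2)$, $L\le C_0n^c$ ($c\ge0$, $C_0>0$ constants) and $$\frac{\bar p}{\bar p-\bar q}\le c'\cdot\frac{2(1-2\rho)^2}{\beta-\beta^{-1}}+2(\rho-\rho^2)$$ for a constant $c'\in[0,1)$ (the condition is void if $\beta=1$), where $\bar p=\sum_\ell\omega_\ell p_\ell$, $\bar q=\sum_\ell\omega_\ell q_\ell$. Fix $r\ge1$, $\varepsilon>0$, and a trimming parameter $\gamma>e^{c_1}$. Then there are constants $c_2=c_2(c_1,\gamma)>1$ and $C=C(c,C_0,c',c_0,c_1,\gamma,r)$ such that with probability at least $1-11n^{-r}-c_2^{-n}$ the output $\tilde{\mathbf z}^\star$ of Algorithm 1 satisfies $$\mathcal L(\tilde{\mathbf z}^\star,\mathbf z^\star)\le\frac{C(2+\varepsilon)(\Delta_1+\Delta_2+\Delta_3)}{n^2(1-2\rho)^4(\bar p-\bar q)^2},$$ where $\Delta_1=[\bar p-2\rho(1-\rho)(\bar p-\bar q)]^2$, $\Delta_2=n\sum_\ell\omega_\ell^2p_\ell$, and $\Delta_3=\max_\ell\{\omega_\ell^2(p_\ell-q_\ell)^2\}(L^2\rho^2+n^2L\rho+n\log n)+\rho^2(1-\rho)^2(\bar p-\bar q)^2$.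
   Context: Inhomogeneous multilayer SBM (IMLSBM). Fix integers $n,L\ge1$, a global label vector $\mathbf z^\star\in\{\pm1\}^n$, $\rho\in[0,1/2]$, and $0<q_\ell<p_\ell<1$ for $\ell\in[L]$. Individual label vectors $\mathbf z^{(\ell)}_i=\mathbf z^\star_i\xi_{\ell i}$ with $\xi_{\ell i}$ i.i.d., $P(\xi_{\ell i}=1)=1-\rho$, $P(\xi_{\ell i}=-1)=\rho$. Given the labels, the symmetric adjacency matrices $A^{(\ell)}\in\{0,1\}^{n\times n}$ have zero diagonal and independent entries $A^{(\ell)}_{ij}=A^{(\ell)}_{ji}$ ($i<j$), Bern$(p_\ell)$ if $\mathbf z^{(\ell)}_i=\mathbf z^{(\ell)}_j$ and Bern$(q_\ell)$ otherwise. $\mathcal P_n(\rho,\{p_\ell\},\{q_\ell\},\beta)$ ($\beta\ge1$): such models with $n/(2\beta)\le\#\{i:\mathbf z^\star_i=\pm1\}\le n\beta/2$. Loss $\mathcal L(\hat{\mathbf z},\mathbf z)=n^{-1}\min\{d_H(\hat{\mathbf z},\mathbf z),d_H(-\hat{\mathbf z},\mathbf z)\}$. Probabilities are over label sampling and edges. Balanced-weights assumption: the weights satisfy $\omega_\ell>0$, $\sum_\ell\omega_\ell=1$, $\max_\ell\omega_\ell\cdot\sum_\ell\omega_\ell p_\ell\le c_0\sum_\ell\omega_\ell^2p_\ell$ and $\max_\ell\omega_\ell\cdot\sum_\ell p_\ell\le c_1\sum_\ell\omega_\ell q_\ell$. Algorithm 1 (inputs $\{A^{(\ell)}\}$, weights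 $\omega$, $\{p_\ell\}$, $\gamma>1$, $\varepsilon>0$): let $\bar A=\sum_\ell\omega_\ell A^{(\ell)}$; let $I=\{i\in[n]:\sum_j\bar A_{ij}>\gamma n\sum_\ell\omega_\ell p_\ell\}$; let $\tau(\bar A)$ be $\bar A$ with all entries in rows or columns indexed by $I$ set to $0$; let $U\in\mathbb R^{n\times2}$ have orthonormal columns that are eigenvectors of $\tau(\bar A)$ for its two leading eigenvalues (largest in absolute value); let $(\hat Z,\hat X)$ be any pair with $\hat Z\in\{0,1\}^{n\times 2}$ having each row a standard basis vector of $\mathbb R^2$ and $\hat X\in\mathbb R^{2\times2}$, such that $\|\hat Z\hat X-U\|_F^2\le(1+\varepsilon)\min_{Z,X}\|ZX-U\|_F^2$ (minimum over all such $Z$ and all $X\in\mathbb R^{2\times2}$); output $\tilde{\mathbf z}^\star_i=1$ if $\hat Z_{i1}=1$ and $\tilde{\mathbf z}^\star_i=-1$ otherwise. *)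

theory Defs
  imports "HOL-Probability.Probability"
begin

text \<open>Inhomogeneous multilayer SBM (IMLSBM). Nodes are 0..<n, layers are 0..<L.
  Label vectors are functions nat => int with values in {-1,1} on 0..<n.
  A multilayer adjacency structure is A :: nat => nat => nat => bool,
  A l i j meaning that edge {i,j} is present in layer l.\<close>

definition label_pmf :: "nat \<Rightarrow> nat \<Rightarrow> real \<Rightarrow> (nat \<times> nat \<Rightarrow> bool) pmf" where
  "label_pmf n L \<rho> = Pi_pmf ({0..<L} \<times> {0..<n}) False (\<lambda>_. bernoulli_pmf \<rho>)"

definition layer_label :: "(nat \<Rightarrow> int) \<Rightarrow> (nat \<times> nat \<Rightarrow> bool) \<Rightarrow> nat \<Rightarrow> nat \<Rightarrow> int" where
  "layer_label zs xi l i = (if xi (l, i) then - zs i else zs i)"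

definition edge_pmf :: "nat \<Rightarrow> nat \<Rightarrow> (nat \<Rightarrow> real) \<Rightarrow> (nat \<Rightarrow> real) \<Rightarrow> (nat \<Rightarrow> int)
    \<Rightarrow> (nat \<times> nat \<Rightarrow> bool) \<Rightarrow> (nat \<times> nat \<times> nat \<Rightarrow> bool) pmf" where
  "edge_pmf n L p q zs xi = Pi_pmf {(l, i, j). l < L \<and> i < j \<and> j < n} False
     (\<lambda>(l, i, j). bernoulli_pmf
        (if layer_label zs xi l i = layer_label zs xi l j then p l else q l))"

definition sym_adj :: "(nat \<times> nat \<times> nat \<Rightarrow> bool) \<Rightarrow> nat \<Rightarrow> nat \<Rightarrow> nat \<Rightarrow> bool" where
  "sym_adj E l i j = (if i < j then E (l, i, j) else if j < i then E (l, j, i) else False)"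

definition imlsbm_pmf :: "nat \<Rightarrow> nat \<Rightarrow> (nat \<Rightarrow> int) \<Rightarrow> real \<Rightarrow> (nat \<Rightarrow> real) \<Rightarrow> (nat \<Rightarrow> real)
    \<Rightarrow> (nat \<Rightarrow> nat \<Rightarrow> nat \<Rightarrow> bool) pmf" where
  "imlsbm_pmf n L zs \<rho> p q =
     bind_pmf (label_pmf n L \<rho>) (\<lambda>xi. map_pmf sym_adj (edge_pmf n L p q zs xi))"

definition in_model_class :: "nat \<Rightarrow> nat \<Rightarrow> (nat \<Rightarrow> int) \<Rightarrow> real \<Rightarrow> (nat \<Rightarrow> real) \<Rightarrow> (nat \<Rightarrow> real) \<Rightarrow> real \<Rightarrow> bool" where
  "in_model_class n L zs \<rho> p q \<beta> \<longleftrightarrow>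
     1 \<le> n \<and> 1 \<le> L \<and> 0 \<le> \<rho> \<and> \<rho> \<le> 1/2 \<and> 1 \<le> \<beta> \<and>
     (\<forall>i<n. zs i = 1 \<or> zs i = -1) \<and>
     (\<forall>l<L. 0 < q l \<and> q l < p l \<and> p l < 1) \<and>
     (\<forall>s\<in>{1, -1::int}. real n / (2 * \<beta>) \<le> real (card {i. i < n \<and> zs i = s})
                       \<and> real (card {i. i < n \<and> zs i = s}) \<le> real n * \<beta> / 2)"

definition balanced_weights :: "nat \<Rightarrow> (nat \<Rightarrow> real) \<Rightarrow> (nat \<Rightarrow> real) \<Rightarrow> (nat \<Rightarrow> real) \<Rightarrow> real \<Rightarrow> real \<Rightarrow> bool" where
  "balanced_weights L \<omega> p q c0 c1 \<longleftrightarrow>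
     (\<forall>l<L. 0 < \<omega> l) \<and> (\<Sum>l<L. \<omega> l) = 1 \<and>
     Max (\<omega> ` {..<L}) * (\<Sum>l<L. \<omega> l * p l) \<le> c0 * (\<Sum>l<L. (\<omega> l)\<^sup>2 * p l) \<and>
     Max (\<omega> ` {..<L}) * (\<Sum>l<L. p l) \<le> c1 * (\<Sum>l<L. \<omega> l * q l)"

definition Abar :: "nat \<Rightarrow> (nat \<Rightarrow> real) \<Rightarrow> (nat \<Rightarrow> nat \<Rightarrow> nat \<Rightarrow> bool) \<Rightarrow> nat \<Rightarrow> nat \<Rightarrow> real" where
  "Abar L \<omega> A i j = (\<Sum>l<L. \<omega> l * (if A l i j then 1 else 0))"

definition trim_set :: "nat \<Rightarrow> real \<Rightarrow> real \<Rightarrow> (nat \<Rightarrow> nat \<Rightarrow> real) \<Rightarrow> nat set" where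
  "trim_set n \<gamma> pbar M = {i. i < n \<and> (\<Sum>j<n. M i j) > \<gamma> * real n * pbar}"

definition trim :: "nat \<Rightarrow> real \<Rightarrow> real \<Rightarrow> (nat \<Rightarrow> nat \<Rightarrow> real) \<Rightarrow> nat \<Rightarrow> nat \<Rightarrow> real" where
  "trim n \<gamma> pbar M i j =
     (if i \<in> trim_set n \<gamma> pbar M \<or> j \<in> trim_set n \<gamma> pbar M then 0 else M i j)"

text \<open>u1, u2 (vectors on 0..<n) are orthonormal eigenvectors of the symmetric n x n
  matrix M for its two leading eigenvalues (largest in absolute value): every
  eigenvalue of M on the orthogonal complement of span{u1,u2} is at most
  min(|lambda1|,|lambda2|) in absolute value.\<close>
definition leading_eigvecs :: "nat \<Rightarrow> (nat \<Rightarrow> nat \<Rightarrow> real) \<Rightarrow> (nat \<Rightarrow> real) \<Rightarrow> (nat \<Rightarrow> real) \<Rightarrow> bool" where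
  "leading_eigvecs n M u1 u2 \<longleftrightarrow>
     (\<Sum>i<n. u1 i * u1 i) = 1 \<and> (\<Sum>i<n. u2 i * u2 i) = 1 \<and> (\<Sum>i<n. u1 i * u2 i) = 0 \<and>
     (\<exists>lam1 lam2.
        (\<forall>i<n. (\<Sum>j<n. M i j * u1 j) = lam1 * u1 i) \<and>
        (\<forall>i<n. (\<Sum>j<n. M i j * u2 j) = lam2 * u2 i) \<and>
        (\<forall>v \<mu>. (\<exists>i<n. v i \<noteq> 0) \<and> (\<forall>i<n. (\<Sum>j<n. M i j * v j) = \<mu> * v i) \<and>
               (\<Sum>i<n. v i * u1 i) = 0 \<and> (\<Sum>i<n. v i * u2 i) = 0
           \<longrightarrow> \<bar>\<mu>\<bar> \<le> \<bar>lam1\<bar> \<and> \<bar>\<mu>\<bar> \<le> \<bar>lam2\<bar>))"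

text \<open>Squared Frobenius norm ||Z X - U||_F^2 where U = [u1 u2], the membership matrix
  Z has row i equal to e_1 iff g i, and X has rows a (first) and b (second).\<close>
definition kmeans_obj :: "nat \<Rightarrow> (nat \<Rightarrow> real) \<Rightarrow> (nat \<Rightarrow> real) \<Rightarrow> (nat \<Rightarrow> bool)
    \<Rightarrow> real \<times> real \<Rightarrow> real \<times> real \<Rightarrow> real" where
  "kmeans_obj n u1 u2 g a b =
     (\<Sum>i<n. (if g i then (fst a - u1 i)\<^sup>2 + (snd a - u2 i)\<^sup>2
                     else (fst b - u1 i)\<^sup>2 + (snd b - u2 i)\<^sup>2))"

definition alg1_outputs :: "nat \<Rightarrow> nat \<Rightarrow> (nat \<Rightarrow> nat \<Rightarrow> nat \<Rightarrow> bool) \<Rightarrow> (nat \<Rightarrow> real) \<Rightarrow> (nat \<Rightarrow> real)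
    \<Rightarrow> real \<Rightarrow> real \<Rightarrow> (nat \<Rightarrow> int) set" where
  "alg1_outputs n L A \<omega> p \<gamma> \<epsilon> =
     {zt. \<exists>u1 u2 g a b.
        leading_eigvecs n (trim n \<gamma> (\<Sum>l<L. \<omega> l * p l) (Abar L \<omega> A)) u1 u2 \<and>
        (\<forall>g' a' b'. kmeans_obj n u1 u2 g a b \<le> (1 + \<epsilon>) * kmeans_obj n u1 u2 g' a' b') \<and>
        zt = (\<lambda>i. if g i then 1 else -1)}"

definition hamming :: "nat \<Rightarrow> (nat \<Rightarrow> int) \<Rightarrow> (nat \<Rightarrow> int) \<Rightarrow> nat" where
  "hamming n x y = card {i. i < n \<and> x i \<noteq> y i}"

definition loss :: "nat \<Rightarrow> (nat \<Rightarrow> int) \<Rightarrow> (nat \<Rightarrow> int) \<Rightarrow> real" where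
  "loss n zh z = real (min (hamming n zh z) (hamming n (\<lambda>i. - zh i) z)) / real n"

end

theory Submission
  imports Defs "HOL-Library.Discrete_Functions"
begin

text \<open>
  Let \<open>P\<close> be the two-block matrix with entries \<open>a\<close> inside and \<open>b\<close> between the true clusters: the mean of
  \<open>Abar\<close> over labels and edges, with the diagonal filled in. If the trimmed \<open>Abar\<close> is within \<open>\<delta>\<close> of \<open>P\<close>
  in operator norm, then the leading eigenvectors are within \<open>O(\<delta> / (n (a - b)))\<close> of the block vectors,
  and a pigeonhole argument on the k-means cost bounds the loss by \<open>O((2 + \<epsilon>) \<delta>\<^sup>2 / (n (a - b))\<^sup>2)\<close>. The
  condition on \<open>\<beta>\<close> forces \<open>\<beta> \<le> 3\<close>, so both clusters have at least \<open>n / 6\<close> nodes.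

  The error \<open>\<delta>\<close> has three parts. The diagonal contributes \<open>a = sqrt \<Delta>1\<close>. Given the labels, the edges
  are independent; with \<open>w = max \<omega>\<close> and \<open>d = n (\<Sum> \<omega> p) / w\<close>, the upper triangle of \<open>Abar / w\<close> is
  treated by the Feige--Ofek argument (rounding to an integer grid, Bernstein for light pairs,
  discrepancy and trimmed degrees for heavy pairs), which gives \<open>O(w sqrt d) = O(sqrt (c0 \<Delta>2))\<close>. The
  fluctuation of the labels is bounded in Frobenius norm by \<open>O(sqrt \<Delta>3)\<close>. For bounded \<open>n\<close> or bounded
  \<open>d\<close> the claimed bound exceeds 1 because of \<open>\<Delta>1\<close> or \<open>\<Delta>2\<close>.
\<close>

section \<open>Perturbation of the leading eigenvectors\<close>

text \<open>The obstacle is the sparse regime. A matrix Bernstein inequality would put a factor log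
  n in front of \<Delta>2, and untrimmed vertices of atypically large degree would dominate the
  spectrum; hence the separate treatment of light and heavy pairs. Dividing by the largest weight w
  brings all layer weights into [0,1], and convexity of exp then lets a layer of weight \<alpha>
  count as the fraction \<alpha> of a layer of weight 1: only d enters the edge bounds, whatever the
  number of layers. Only the upper triangle is treated because its entries are independent; the
  transpose is added at the end. For the labels a Frobenius bound is enough, since \<Delta>3 already
  has the size of the variance summed over n^2 entries; the difficulty there is the tail of sums of
  squares of linear forms in rare flips, met by truncation. Eigenvectors and k-means solutions are
  not unique, so the perturbation part is deterministic and covers every admissible output.\<close>

definition ip :: "nat \<Rightarrow> (nat \<Rightarrow> real) \<Rightarrow> (nat \<Rightarrow> real) \<Rightarrow> real" where
  "ip n x y = (\<Sum>i<n. x i * y i)"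

definition mv :: "nat \<Rightarrow> (nat \<Rightarrow> nat \<Rightarrow> real) \<Rightarrow> (nat \<Rightarrow> real) \<Rightarrow> nat \<Rightarrow> real" where
  "mv n M x i = (\<Sum>j<n. M i j * x j)"

text \<open>The spectral norm is bounded through the bilinear form because the grid argument rounds
  the two test vectors one after the other; sums and transposes are then immediate.\<close>

definition op_bound :: "nat \<Rightarrow> (nat \<Rightarrow> nat \<Rightarrow> real) \<Rightarrow> real \<Rightarrow> bool" where
  "op_bound n M \<delta> \<longleftrightarrow> 0 \<le> \<delta> \<and>
     (\<forall>x y. ip n x (mv n M y) \<le> \<delta> * L2_set x {..<n} * L2_set y {..<n})"

lemma ip_commute: "ip n x y = ip n y x"
  by (simp add: ip_def mult.commute)

lemma ip_add_left: "ip n (\<lambda>i. x i + y i) z = ip n x z + ip n y z"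
  by (simp add: ip_def algebra_simps sum.distrib)

lemma ip_add_right: "ip n z (\<lambda>i. x i + y i) = ip n z x + ip n z y"
  by (simp add: ip_def algebra_simps sum.distrib)

lemma ip_diff_left: "ip n (\<lambda>i. x i - y i) z = ip n x z - ip n y z"
  by (simp add: ip_def algebra_simps sum_subtractf)

lemma ip_diff_right: "ip n z (\<lambda>i. x i - y i) = ip n z x - ip n z y"
  by (simp add: ip_def algebra_simps sum_subtractf)

lemma ip_scale_left: "ip n (\<lambda>i. c * x i) z = c * ip n x z"
  by (simp add: ip_def sum_distrib_left mult.assoc)

lemma ip_scale_right: "ip n z (\<lambda>i. c * x i) = c * ip n z x"
  by (simp add: ip_def sum_distrib_left algebra_simps)

lemmas ip_linear = ip_add_left ip_add_right ip_diff_left ip_diff_right ip_scale_left ip_scale_right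

lemma ip_cong: "(\<And>i. i < n \<Longrightarrow> x i = x' i) \<Longrightarrow> (\<And>i. i < n \<Longrightarrow> y i = y' i) \<Longrightarrow> ip n x y = ip n x' y'"
  by (simp add: ip_def)

lemma mv_cong: "(\<And>i. i < n \<Longrightarrow> x i = x' i) \<Longrightarrow> mv n M x = mv n M x'"
  by (simp add: mv_def fun_eq_iff)

lemma ip_self_nonneg: "0 \<le> ip n x x"
  by (simp add: ip_def sum_nonneg)

lemma ip_self_eq_0: "ip n x x = 0 \<longleftrightarrow> (\<forall>i<n. x i = 0)"
  by (auto simp: ip_def sum_nonneg_eq_0_iff)

lemma L2_set_ip: "L2_set x {..<n} = sqrt (ip n x x)"
  by (simp add: L2_set_def ip_def power2_eq_square)

lemma L2_set_ip_sq: "(L2_set x {..<n})\<^sup>2 = ip n x x"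
  by (simp add: L2_set_ip ip_self_nonneg)

lemma ip_le_L2: "\<bar>ip n x y\<bar> \<le> L2_set x {..<n} * L2_set y {..<n}"
proof -
  have "\<bar>ip n x y\<bar> \<le> (\<Sum>i<n. \<bar>x i\<bar> * \<bar>y i\<bar>)"
    unfolding ip_def by (rule order_trans[OF sum_abs]) (simp add: abs_mult)
  then show ?thesis using L2_set_mult_ineq[of x y "{..<n}"] by linarith
qed

lemma mv_add: "mv n M (\<lambda>i. x i + y i) = (\<lambda>i. mv n M x i + mv n M y i)"
  by (simp add: mv_def fun_eq_iff algebra_simps sum.distrib)

lemma mv_diff: "mv n M (\<lambda>i. x i - y i) = (\<lambda>i. mv n M x i - mv n M y i)"
  by (simp add: mv_def fun_eq_iff algebra_simps sum_subtractf)

lemma mv_scale: "mv n M (\<lambda>i. c * x i) = (\<lambda>i. c * mv n M x i)"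
  by (simp add: mv_def fun_eq_iff algebra_simps sum_distrib_left)

lemma mv_diff_mat: "mv n (\<lambda>i j. M i j - N i j) x = (\<lambda>i. mv n M x i - mv n N x i)"
  by (simp add: mv_def fun_eq_iff algebra_simps sum_subtractf)

lemma ip_mv_sym:
  assumes "\<And>i j. i < n \<Longrightarrow> j < n \<Longrightarrow> M i j = M j i"
  shows "ip n (mv n M x) y = ip n x (mv n M y)"
proof -
  have "ip n (mv n M x) y = (\<Sum>i<n. \<Sum>j<n. M i j * x j * y i)"
    by (simp add: ip_def mv_def sum_distrib_right)
  also have "\<dots> = (\<Sum>j<n. \<Sum>i<n. M i j * x j * y i)" by (rule sum.swap)
  also have "\<dots> = (\<Sum>j<n. \<Sum>i<n. x j * (M j i * y i))"
    using assms by (intro sum.cong refl) (simp add: mult_ac)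
  finally show ?thesis by (simp add: ip_def mv_def sum_distrib_left)
qed

lemma op_bound_add:
  assumes "op_bound n M \<delta>" "op_bound n N \<epsilon>"
  shows "op_bound n (\<lambda>i j. M i j + N i j) (\<delta> + \<epsilon>)"
proof -
  have e: "mv n (\<lambda>i j. M i j + N i j) y = (\<lambda>i. mv n M y i + mv n N y i)" for y
    by (simp add: mv_def fun_eq_iff algebra_simps sum.distrib)
  have "ip n x (mv n (\<lambda>i j. M i j + N i j) y) \<le> (\<delta> + \<epsilon>) * L2_set x {..<n} * L2_set y {..<n}" for x y
    using assms[unfolded op_bound_def] unfolding e ip_add_right
    by (smt (verit, best) distrib_right)
  then show ?thesis using assms unfolding op_bound_def by auto
qed

text \<open>Test the bilinear form with M x itself and cancel one norm.\<close>

lemma op_bound_mv: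
  assumes "op_bound n M \<delta>"
  shows "L2_set (mv n M x) {..<n} \<le> \<delta> * L2_set x {..<n}"
proof -
  have "(L2_set (mv n M x) {..<n})\<^sup>2 \<le> \<delta> * L2_set (mv n M x) {..<n} * L2_set x {..<n}"
    using assms unfolding op_bound_def L2_set_ip_sq by blast
  then have "L2_set (mv n M x) {..<n} * L2_set (mv n M x) {..<n}
      \<le> L2_set (mv n M x) {..<n} * (\<delta> * L2_set x {..<n})"
    by (simp add: power2_eq_square mult_ac)
  moreover have "0 \<le> \<delta> * L2_set x {..<n}"
    using assms unfolding op_bound_def by (simp add: L2_set_nonneg)
  ultimately show ?thesis
    by (metis L2_set_nonneg mult_le_cancel_left_pos order_le_less)
qed

lemma op_bound_cong:
  assumes "op_bound n M \<delta>" "\<And>i j. i < n \<Longrightarrow> j < n \<Longrightarrow> M i j = N i j"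
  shows "op_bound n N \<delta>"
proof -
  have "ip n x (mv n N y) = ip n x (mv n M y)" for x y
    using assms(2) by (intro ip_cong) (simp_all add: mv_def)
  then show ?thesis using assms(1) unfolding op_bound_def by simp
qed

text \<open>The first-order condition at a maximum, without calculus: a nonzero \<open>a\<close>
  would make t = a / K violate the inequality once K exceeds \<open>c\<close>.\<close>

lemma linear_le_quadratic_zero:
  fixes a c :: real
  assumes "\<And>t. t * a \<le> t\<^sup>2 * c"
  shows "a = 0"
proof (rule ccontr)
  assume "a \<noteq> 0"
  define K where "K = \<bar>c\<bar> + 1"
  have K: "K > 0" "c < K" by (auto simp: K_def)
  have "(a / K) * a \<le> (a / K)\<^sup>2 * c" by (rule assms)
  also have "\<dots> < (a / K)\<^sup>2 * K" using K \<open>a \<noteq> 0\<close> by (intro mult_strict_left_mono) auto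
  also have "\<dots> = (a / K) * a" using K by (simp add: power2_eq_square field_simps)
  finally show False by simp
qed

text \<open>The cross product of the coefficient rows solves both equations; if it vanishes, the
  rows are linearly dependent and one equation suffices.\<close>

lemma two_equations_nontrivial_solution:
  fixes a1 a2 a3 b1 b2 b3 :: real
  shows "\<exists>x y z. (x, y, z) \<noteq> (0, 0, 0) \<and> a1 * x + a2 * y + a3 * z = 0 \<and> b1 * x + b2 * y + b3 * z = 0"
proof -
  have one: "\<exists>x y z. (x, y, z) \<noteq> (0, 0, 0) \<and> c1 * x + c2 * y + c3 * z = 0" for c1 c2 c3 :: real
  proof (cases "c1 = 0 \<and> c2 = 0")
    case True then show ?thesis by (intro exI[of _ 1] exI[of _ 0]) auto
  next
    case False then show ?thesis by (intro exI[of _ c2] exI[of _ "- c1"] exI[of _ 0]) auto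
  qed
  define X where "X = a2 * b3 - a3 * b2"
  define Y where "Y = a3 * b1 - a1 * b3"
  define Z where "Z = a1 * b2 - a2 * b1"
  show ?thesis
  proof (cases "X = 0 \<and> Y = 0 \<and> Z = 0")
    case False
    then show ?thesis
      by (intro exI[of _ X] exI[of _ Y] exI[of _ Z]) (auto simp: X_def Y_def Z_def algebra_simps)
  next
    case True
    show ?thesis
    proof (cases "a1 = 0 \<and> a2 = 0 \<and> a3 = 0")
      case True then show ?thesis using one[of b1 b2 b3] by auto
    next
      case False
      obtain x y z where xyz: "(x, y, z) \<noteq> (0, 0, 0)" "a1 * x + a2 * y + a3 * z = 0"
        using one by blast
      have e: "a2 * b3 = a3 * b2" "a3 * b1 = a1 * b3" "a1 * b2 = a2 * b1"
        using True by (auto simp: X_def Y_def Z_def)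
      have k: "a * (b1 * x + b2 * y + b3 * z) = b * (a1 * x + a2 * y + a3 * z)"
        if "a * b1 = b * a1" "a * b2 = b * a2" "a * b3 = b * a3" for a b
        using that by (metis (no_types, opaque_lifting) distrib_left mult.assoc)
      have "a1 * (b1 * x + b2 * y + b3 * z) = 0" "a2 * (b1 * x + b2 * y + b3 * z) = 0"
        "a3 * (b1 * x + b2 * y + b3 * z) = 0"
        using k[of a1 b1] k[of a2 b2] k[of a3 b3] e xyz(2) by (auto simp: mult.commute)
      then have "b1 * x + b2 * y + b3 * z = 0" using False by auto
      then show ?thesis using xyz by blast
    qed
  qed
qed

text \<open>Vectors are functions on all naturals, so the coordinates from \<open>n\<close> on are
  pinned to 0; the set is then closed inside a product of compact intervals.\<close>

lemma compact_sphere_orthogonal: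
  "compact {x::nat \<Rightarrow> real. (\<forall>i\<ge>n. x i = 0) \<and> ip n x x = 1 \<and> ip n x u1 = 0 \<and> ip n x u2 = 0}"
    (is "compact ?S")
proof -
  define K :: "nat \<Rightarrow> real set" where "K i = (if i < n then {-1..1} else {0})" for i
  have "compactin (product_topology (\<lambda>_. euclidean) UNIV) (PiE UNIV K)"
    by (subst compactin_PiE) (auto simp: K_def)
  then have cK: "compact (PiE UNIV K)"
    by (simp add: euclidean_product_topology)
  have c: "continuous_on UNIV (\<lambda>x::nat \<Rightarrow> real. x i)" for i
    by (rule continuous_on_product_coordinates)
  have "closed ({x::nat \<Rightarrow> real. ip n x x = 1} \<inter> {x. ip n x u1 = 0} \<inter> {x. ip n x u2 = 0})"
    unfolding ip_def by (intro closed_Int closed_Collect_eq continuous_intros c)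
  from compact_Int_closed[OF cK this] have "compact (PiE UNIV K \<inter> ({x. ip n x x = 1} \<inter> {x. ip n x u1 = 0} \<inter> {x. ip n x u2 = 0}))"
    .
  also have "PiE UNIV K \<inter> ({x. ip n x x = 1} \<inter> {x. ip n x u1 = 0} \<inter> {x. ip n x u2 = 0}) = ?S"
  proof -
    have "x i \<in> {-1..1}" if "ip n x x = 1" "i < n" for x i
    proof -
      have "(x i)\<^sup>2 \<le> ip n x x" unfolding ip_def power2_eq_square
        using that(2) by (intro member_le_sum) auto
      then show ?thesis using that(1) by (simp add: abs_square_le_1 abs_le_iff)
    qed
    then show ?thesis by (auto simp: K_def PiE_def Pi_def) 
  qed
  finally show ?thesis .
qed

text \<open>The maximiser of \<open>\<parallel>M x\<parallel>\<close> over the unit sphere of the invariant complement satisfies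
  \<open>M (M v) = \<tau>\<^sup>2 v\<close>, so either \<open>M v + \<tau> v\<close> vanishes or it is an eigenvector for \<open>\<tau>\<close>.\<close>

lemma max_eigenvector_orthogonal:
  assumes sym: "\<And>i j. i < n \<Longrightarrow> j < n \<Longrightarrow> M i j = M j i"
    and e1: "\<And>i. i < n \<Longrightarrow> mv n M u1 i = l1 * u1 i"
    and e2: "\<And>i. i < n \<Longrightarrow> mv n M u2 i = l2 * u2 i"
    and y: "ip n y u1 = 0" "ip n y u2 = 0" "\<exists>i<n. y i \<noteq> 0"
  shows "\<exists>v \<mu>. (\<exists>i<n. v i \<noteq> 0) \<and> (\<forall>i<n. mv n M v i = \<mu> * v i) \<and> ip n v u1 = 0 \<and> ip n v u2 = 0 \<and>
    (\<forall>x. ip n x u1 = 0 \<longrightarrow> ip n x u2 = 0 \<longrightarrow> ip n (mv n M x) (mv n M x) \<le> \<mu>\<^sup>2 * ip n x x)"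
proof -
  define S where "S = {x::nat \<Rightarrow> real. (\<forall>i\<ge>n. x i = 0) \<and> ip n x x = 1 \<and> ip n x u1 = 0 \<and> ip n x u2 = 0}"
  define f where "f x = ip n (mv n M x) (mv n M x)" for x
  \<comment> \<open>Normalise and cut off beyond \<open>n\<close>, so that the maximum over the
    compact set \<open>S\<close> controls the whole complement.\<close>
  have norm_S: "\<exists>z\<in>S. f x = f z * ip n x x" if "ip n x u1 = 0" "ip n x u2 = 0" "ip n x x \<noteq> 0" for x
  proof -
    define c where "c = sqrt (ip n x x)"
    have c: "c\<^sup>2 = ip n x x" "c \<noteq> 0" using that ip_self_nonneg[of n x] by (auto simp: c_def)
    define z where "z = (\<lambda>i. if i < n then (1/c) * x i else 0)"
    have zz: "ip n z w = (1/c) * ip n x w" for w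
      unfolding ip_scale_left[symmetric] by (rule ip_cong) (simp_all add: z_def)
    have zz2: "ip n z z = (1/c) * ((1/c) * ip n x x)"
      unfolding zz by (simp add: ip_commute[of n x z] zz)
    have "ip n z z = 1" using c unfolding zz2 c(1)[symmetric] by (simp add: power2_eq_square)
    moreover have "z i = 0" if "i \<ge> n" for i using that by (simp add: z_def)
    ultimately have "z \<in> S" using that by (simp add: S_def zz)
    moreover have "mv n M z = (\<lambda>i. (1/c) * mv n M x i)"
      unfolding mv_scale[symmetric] by (rule mv_cong) (simp add: z_def)
    then have "f z = (1/c) * ((1/c) * f x)" unfolding f_def by (simp only: ip_scale_left ip_scale_right)
    then have "f x = f z * ip n x x" using c(2) that(3) unfolding c(1)[symmetric] by (simp add: power2_eq_square)
    ultimately show ?thesis by blast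
  qed
  have "ip n y y \<noteq> 0" using y(3) by (simp add: ip_self_eq_0)
  then have ne: "S \<noteq> {}" using norm_S y by blast
  have "continuous_on S f"
    unfolding f_def ip_def mv_def
    by (intro continuous_intros continuous_on_subset[OF continuous_on_product_coordinates]) auto
  then obtain v where v: "v \<in> S" and vmax: "\<And>x. x \<in> S \<Longrightarrow> f x \<le> f v"
    using continuous_attains_sup[of S f] compact_sphere_orthogonal[of n u1 u2] ne unfolding S_def by blast
  have vS: "ip n v v = 1" "ip n v u1 = 0" "ip n v u2 = 0" using v by (auto simp: S_def)
  define T where "T = f v"
  have T0: "T \<ge> 0" by (simp add: T_def f_def ip_self_nonneg)
  have fle: "f x \<le> T * ip n x x" if xp: "ip n x u1 = 0" "ip n x u2 = 0" for x
  proof (cases "ip n x x = 0")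
    case True
    then have "mv n M x = (\<lambda>i. 0)" by (auto simp: mv_def ip_self_eq_0)
    then show ?thesis using True by (simp add: f_def ip_def)
  next
    case False
    then obtain z where "z \<in> S" "f x = f z * ip n x x" using norm_S[OF xp] by blast
    then show ?thesis using vmax[of z] ip_self_nonneg[of n x] by (simp add: T_def mult_right_mono)
  qed
  have Mperp: "ip n (mv n M x) u1 = 0" "ip n (mv n M x) u2 = 0"
    if "ip n x u1 = 0" "ip n x u2 = 0" for x
  proof -
    have "ip n (mv n M x) u1 = ip n x (\<lambda>i. l1 * u1 i)" "ip n (mv n M x) u2 = ip n x (\<lambda>i. l2 * u2 i)"
      by (simp_all add: ip_mv_sym[OF sym] e1 e2 cong: ip_cong)
    then show "ip n (mv n M x) u1 = 0" "ip n (mv n M x) u2 = 0" using that by (simp_all add: ip_scale_right)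
  qed
  have first_order: "ip n (mv n M v) (mv n M h) = T * ip n v h" if h: "ip n h u1 = 0" "ip n h u2 = 0" for h
  proof -
    have "t * (2 * (ip n (mv n M v) (mv n M h) - T * ip n v h)) \<le> t\<^sup>2 * (T * ip n h h - f h)" for t
    proof -
      have "f (\<lambda>i. v i + t * h i) \<le> T * ip n (\<lambda>i. v i + t * h i) (\<lambda>i. v i + t * h i)"
        using h vS by (intro fle) (simp_all add: ip_linear)
      moreover have "f (\<lambda>i. v i + t * h i) = T + 2 * t * ip n (mv n M v) (mv n M h) + t\<^sup>2 * f h"
        unfolding f_def T_def mv_add mv_scale ip_linear
        by (simp add: ip_commute[of n "mv n M h" "mv n M v"] algebra_simps power2_eq_square)
      moreover have "ip n (\<lambda>i. v i + t * h i) (\<lambda>i. v i + t * h i) = 1 + 2 * t * ip n v h + t\<^sup>2 * ip n h h"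
        unfolding ip_linear using vS by (simp add: ip_commute[of n h v] algebra_simps power2_eq_square)
      ultimately show ?thesis by (simp add: algebra_simps)
    qed
    then have "2 * (ip n (mv n M v) (mv n M h) - T * ip n v h) = 0" by (rule linear_le_quadratic_zero)
    then show ?thesis by simp
  qed
  \<comment> \<open>The defect of \<open>M (M v) = T v\<close> lies in the complement itself, so it
    can serve as its own test direction and has norm 0.\<close>
  define h where "h = (\<lambda>i. mv n M (mv n M v) i - T * v i)"
  have hperp: "ip n h u1 = 0" "ip n h u2 = 0"
    using Mperp[OF Mperp[OF vS(2,3)]] vS by (simp_all add: h_def ip_linear)
  have "ip n h h = ip n (mv n M (mv n M v)) h - T * ip n v h"
    by (subst (1) h_def) (simp add: ip_linear)
  also have "\<dots> = 0" using first_order[OF hperp] by (simp add: ip_mv_sym[OF sym])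
  finally have MM: "mv n M (mv n M v) i = T * v i" if "i < n" for i
    using that by (auto simp: ip_self_eq_0 h_def)
  define s where "s = sqrt T"
  have s: "s\<^sup>2 = T" using T0 by (simp add: s_def)
  define w where "w = (\<lambda>i. mv n M v i + s * v i)"
  have vne: "\<exists>i<n. v i \<noteq> 0" using vS(1) ip_self_eq_0[of n v] by auto
  show ?thesis
  proof (cases "\<forall>i<n. w i = 0")
    case True
    then have "\<forall>i<n. mv n M v i = (- s) * v i" by (auto simp: w_def)
    then show ?thesis using vS vne fle s unfolding f_def by (intro exI[of _ v] exI[of _ "- s"]) auto
  next
    case False
    have "\<forall>i<n. mv n M w i = s * w i"
      using MM s unfolding w_def mv_add mv_scale by (auto simp: algebra_simps power2_eq_square)
    moreover have "ip n w u1 = 0" "ip n w u2 = 0" using Mperp[OF vS(2,3)] vS by (simp_all add: w_def ip_linear)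
    ultimately show ?thesis using False fle s unfolding f_def by (intro exI[of _ w] exI[of _ s]) auto
  qed
qed


section \<open>Residuals of the cluster vectors off the leading eigenspace\<close>

definition resid :: "nat \<Rightarrow> (nat \<Rightarrow> real) \<Rightarrow> (nat \<Rightarrow> real) \<Rightarrow> (nat \<Rightarrow> real) \<Rightarrow> nat \<Rightarrow> real" where
  "resid n u1 u2 x i = x i - ip n x u1 * u1 i - ip n x u2 * u2 i"

lemma resid_alt: "resid n u1 u2 x = (\<lambda>i. x i - ip n x u1 * u1 i - ip n x u2 * u2 i)"
  by (simp add: resid_def fun_eq_iff)

locale orthonormal_pair =
  fixes n :: nat and u1 u2 :: "nat \<Rightarrow> real"
  assumes u11: "ip n u1 u1 = 1" and u22: "ip n u2 u2 = 1" and u12: "ip n u1 u2 = 0"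
begin

lemma u21: "ip n u2 u1 = 0" using u12 by (simp add: ip_commute)

lemma resid_perp: "ip n (resid n u1 u2 x) u1 = 0" "ip n (resid n u1 u2 x) u2 = 0"
  unfolding resid_alt ip_linear using u11 u22 u12 u21 by simp_all

lemma ip_resid: "ip n (resid n u1 u2 x) (resid n u1 u2 y)
    = ip n x y - ip n x u1 * ip n y u1 - ip n x u2 * ip n y u2"
proof -
  have "ip n (resid n u1 u2 x) (resid n u1 u2 y) = ip n (resid n u1 u2 x) y"
    by (subst (2) resid_alt) (simp add: ip_linear resid_perp)
  also have "\<dots> = ip n x y - ip n x u1 * ip n y u1 - ip n x u2 * ip n y u2"
    unfolding resid_alt ip_linear by (simp add: ip_commute)
  finally show ?thesis .
qed

lemma resid_norm_le: "L2_set (resid n u1 u2 x) {..<n} \<le> L2_set x {..<n}"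
  unfolding L2_set_ip by (rule real_sqrt_le_mono) (simp add: ip_resid)

end

lemma resid_add: "resid n u1 u2 (\<lambda>i. x i + y i) = (\<lambda>i. resid n u1 u2 x i + resid n u1 u2 y i)"
  by (simp add: resid_def fun_eq_iff ip_linear algebra_simps)

text \<open>A min-max argument of Weyl type. Let \<mu> be the extreme eigenvalue on the complement,
  with eigenvector v. Since \<open>u1\<close>, \<open>u2\<close> are leading, M stretches every
  vector of span{u1, u2, v} by at least |\<mu>|. This space has dimension 3, hence contains a
  nonzero z orthogonal to \<open>s1\<close> and \<open>s2\<close>; there P vanishes and M z = (M -
  P) z, so |\<mu>| is at most \<delta>.\<close>

lemma leading_eigvecs_small_complement:
  assumes sym: "\<And>i j. i < n \<Longrightarrow> j < n \<Longrightarrow> M i j = M j i"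
    and lead: "leading_eigvecs n M u1 u2"
    and opb: "op_bound n (\<lambda>i j. M i j - P i j) \<delta>"
    and rank2: "\<And>x. ip n x s1 = 0 \<Longrightarrow> ip n x s2 = 0 \<Longrightarrow> \<forall>i<n. mv n P x i = 0"
    and y: "ip n y u1 = 0" "ip n y u2 = 0"
  shows "L2_set (mv n M y) {..<n} \<le> \<delta> * L2_set y {..<n}"
proof (cases "\<exists>i<n. y i \<noteq> 0")
  case False
  then have "mv n M y = (\<lambda>i. 0)" by (auto simp: mv_def)
  then show ?thesis using opb by (simp add: op_bound_def L2_set_def sum_nonneg)
next
  case True
  obtain l1 l2 where e1: "\<And>i. i < n \<Longrightarrow> mv n M u1 i = l1 * u1 i"
    and e2: "\<And>i. i < n \<Longrightarrow> mv n M u2 i = l2 * u2 i"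
    and led: "\<And>v \<mu>. (\<exists>i<n. v i \<noteq> 0) \<Longrightarrow> (\<forall>i<n. mv n M v i = \<mu> * v i) \<Longrightarrow> ip n v u1 = 0 \<Longrightarrow> ip n v u2 = 0
      \<Longrightarrow> \<bar>\<mu>\<bar> \<le> \<bar>l1\<bar> \<and> \<bar>\<mu>\<bar> \<le> \<bar>l2\<bar>"
    using lead unfolding leading_eigvecs_def mv_def ip_def by blast
  interpret orthonormal_pair n u1 u2
    using lead by unfold_locales (auto simp: leading_eigvecs_def ip_def)
  obtain v \<mu> where v: "\<exists>i<n. v i \<noteq> 0" "\<forall>i<n. mv n M v i = \<mu> * v i" "ip n v u1 = 0" "ip n v u2 = 0"
    and mx: "\<And>x. ip n x u1 = 0 \<Longrightarrow> ip n x u2 = 0 \<Longrightarrow> ip n (mv n M x) (mv n M x) \<le> \<mu>\<^sup>2 * ip n x x"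
    using max_eigenvector_orthogonal[OF sym e1 e2 y True] by blast
  have le: "\<mu>\<^sup>2 \<le> l1\<^sup>2" "\<mu>\<^sup>2 \<le> l2\<^sup>2" using led[OF v] by (auto simp: abs_le_square_iff)
  obtain a b c where abc: "(a, b, c) \<noteq> (0, 0, 0)"
    "ip n u1 s1 * a + ip n u2 s1 * b + ip n v s1 * c = 0" "ip n u1 s2 * a + ip n u2 s2 * b + ip n v s2 * c = 0"
    using two_equations_nontrivial_solution by metis
  define z where "z = (\<lambda>i. a * u1 i + b * u2 i + c * v i)"
  have Pz: "\<forall>i<n. mv n P z i = 0"
    using abc by (intro rank2) (simp_all add: z_def ip_linear mult.commute)
  have vu: "ip n u1 v = 0" "ip n u2 v = 0" using v by (simp_all add: ip_commute)
  have vv: "ip n v v > 0" using v(1) ip_self_nonneg[of n v] ip_self_eq_0[of n v] by fastforce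
  have comb: "ip n (\<lambda>i. a * u1 i + b * u2 i + c * v i) (\<lambda>i. a * u1 i + b * u2 i + c * v i)
      = a\<^sup>2 + b\<^sup>2 + c\<^sup>2 * ip n v v" for a b c
    unfolding ip_linear using u11 u22 u12 u21 v vu by (simp add: power2_eq_square)
  have zz: "ip n z z = a\<^sup>2 + b\<^sup>2 + c\<^sup>2 * ip n v v" unfolding z_def by (rule comb)
  have zpos: "ip n z z > 0"
  proof -
    have "a\<^sup>2 > 0 \<or> b\<^sup>2 > 0 \<or> c\<^sup>2 * ip n v v > 0" using abc(1) vv by auto
    moreover have "c\<^sup>2 * ip n v v \<ge> 0" using vv by simp
    ultimately show ?thesis unfolding zz by (smt (verit) zero_le_power2)
  qed
  have "ip n (mv n M z) (mv n M z) = (l1 * a)\<^sup>2 + (l2 * b)\<^sup>2 + (\<mu> * c)\<^sup>2 * ip n v v"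
    unfolding comb[symmetric] by (rule ip_cong; simp add: z_def mv_add mv_scale e1 e2 v)
  moreover have "(l1 * a)\<^sup>2 \<ge> \<mu>\<^sup>2 * a\<^sup>2" "(l2 * b)\<^sup>2 \<ge> \<mu>\<^sup>2 * b\<^sup>2"
    using le by (simp_all add: power_mult_distrib mult_right_mono)
  ultimately have "ip n (mv n M z) (mv n M z) \<ge> \<mu>\<^sup>2 * ip n z z"
    unfolding zz by (simp add: power_mult_distrib algebra_simps)
  moreover have "ip n (mv n M z) (mv n M z) \<le> \<delta>\<^sup>2 * ip n z z"
  proof -
    have "L2_set (mv n M z) {..<n} = L2_set (mv n (\<lambda>i j. M i j - P i j) z) {..<n}"
      by (rule L2_set_cong) (simp_all add: mv_diff_mat Pz)
    then have "L2_set (mv n M z) {..<n} \<le> \<delta> * L2_set z {..<n}" using op_bound_mv[OF opb, of z] by simp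
    then have "(L2_set (mv n M z) {..<n})\<^sup>2 \<le> (\<delta> * L2_set z {..<n})\<^sup>2" by (simp add: power_mono L2_set_nonneg)
    then show ?thesis by (simp add: L2_set_ip_sq power_mult_distrib)
  qed
  ultimately have "\<mu>\<^sup>2 * ip n z z \<le> \<delta>\<^sup>2 * ip n z z" by simp
  then have "\<mu>\<^sup>2 \<le> \<delta>\<^sup>2" using zpos by simp
  then have "ip n (mv n M y) (mv n M y) \<le> \<delta>\<^sup>2 * ip n y y"
    using mx[OF y] ip_self_nonneg[of n y] by (meson mult_right_mono order_trans)
  then have "L2_set (mv n M y) {..<n} \<le> sqrt (\<delta>\<^sup>2 * ip n y y)" unfolding L2_set_ip by (rule real_sqrt_le_mono)
  then show ?thesis using opb by (simp add: L2_set_ip real_sqrt_mult op_bound_def)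
qed

definition block_mat :: "nat set \<Rightarrow> real \<Rightarrow> real \<Rightarrow> nat \<Rightarrow> nat \<Rightarrow> real" where
  "block_mat S a b i j = (if (i \<in> S) = (j \<in> S) then a else b)"

lemma mv_block_mat:
  assumes "S1 \<union> S2 = {..<n}" "S1 \<inter> S2 = {}" "i < n"
  shows "mv n (block_mat S1 a b) x i =
    (if i \<in> S1 then a * ip n x (indicator S1) + b * ip n x (indicator S2)
     else b * ip n x (indicator S1) + a * ip n x (indicator S2))"
proof -
  have "block_mat S1 a b i j * x j = (if i \<in> S1 then a else b) * (x j * indicator S1 j)
      + (if i \<in> S1 then b else a) * (x j * indicator S2 j)" if "j < n" for j
    using that assms by (cases "j \<in> S1") (auto simp: block_mat_def indicator_def)
  then have "mv n (block_mat S1 a b) x i = (\<Sum>j<n. (if i \<in> S1 then a else b) * (x j * indicator S1 j)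
      + (if i \<in> S1 then b else a) * (x j * indicator S2 j))"
    unfolding mv_def by (intro sum.cong) auto
  also have "\<dots> = (if i \<in> S1 then a else b) * ip n x (indicator S1) + (if i \<in> S1 then b else a) * ip n x (indicator S2)"
    by (simp only: sum.distrib ip_def sum_distrib_left)
  finally show ?thesis by simp
qed

lemma ip_indicator:
  assumes "S \<subseteq> {..<n}" "T \<subseteq> {..<n}"
  shows "ip n (indicator S) (indicator T) = real (card (S \<inter> T))"
proof -
  have "ip n (indicator S) (indicator T) = (\<Sum>i<n. indicator (S \<inter> T) i)"
    unfolding ip_def by (rule sum.cong) (auto simp: indicator_def)
  also have "\<dots> = real (card (S \<inter> T))"
    using assms by (simp add: indicator_def Int_def[symmetric] Int_absorb1 sum.If_cases le_infI1)
  finally show ?thesis .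
qed

text \<open>Instead of a Davis--Kahan bound: the indicator of a cluster is \<open>P w\<close> for an explicit \<open>w\<close>, and
  its residual is \<open>M (Q w) + Q (P - M) w\<close>, where the projection \<open>Q\<close> commutes with \<open>M\<close>.\<close>

lemma resid_cluster_indicator:
  assumes sym: "\<And>i j. i < n \<Longrightarrow> j < n \<Longrightarrow> M i j = M j i"
    and lead: "leading_eigvecs n M u1 u2"
    and part: "S1 \<union> S2 = {..<n}" "S1 \<inter> S2 = {}"
    and opb: "op_bound n (\<lambda>i j. M i j - block_mat S1 a b i j) \<delta>"
    and ab: "0 \<le> b" "b < a"
    and size: "real n / 6 \<le> card S1" "real n / 6 \<le> card S2" "0 < n"
  shows "ip n (resid n u1 u2 (indicator S1)) (resid n u1 u2 (indicator S1))
     \<le> 288 * \<delta>\<^sup>2 / (real n * (a - b))\<^sup>2 * card S1"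
proof -
  let ?P = "block_mat S1 a b"
  let ?R = "resid n u1 u2"
  interpret orthonormal_pair n u1 u2
    using lead by unfold_locales (auto simp: leading_eigvecs_def ip_def)
  obtain l1 l2 where e1: "\<And>i. i < n \<Longrightarrow> mv n M u1 i = l1 * u1 i"
    and e2: "\<And>i. i < n \<Longrightarrow> mv n M u2 i = l2 * u2 i"
    using lead unfolding leading_eigvecs_def mv_def by blast
  have d0: "\<delta> \<ge> 0" using opb by (simp add: op_bound_def)
  define m1 where "m1 = real (card S1)"
  define m2 where "m2 = real (card S2)"
  have m: "m1 \<ge> real n / 6" "m2 \<ge> real n / 6" "m1 > 0" "m2 > 0"
    using size by (auto simp: m1_def m2_def)
  define E where "E = a\<^sup>2 - b\<^sup>2"
  have E: "E = (a - b) * (a + b)" by (simp add: E_def algebra_simps power2_eq_square)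
  have Epos: "E > 0" unfolding E using ab by simp
  \<comment> \<open>Solution of a \<alpha> m1 + b \<gamma> m2 = 1 and b \<alpha> m1 + a \<gamma> m2
    = 0, which makes P w the indicator of \<open>S1\<close>; \<open>E\<close> is the determinant a^2
    - b^2.\<close>
  define \<alpha> where "\<alpha> = a / (m1 * E)"
  define \<gamma> where "\<gamma> = - b / (m2 * E)"
  define w where "w = (\<lambda>i. \<alpha> * indicator S1 i + \<gamma> * indicator S2 i :: real)"
  have sub: "S1 \<subseteq> {..<n}" "S2 \<subseteq> {..<n}" using part by auto
  have II: "ip n (indicator S1) (indicator S1) = m1" "ip n (indicator S2) (indicator S2) = m2"
    "ip n (indicator S1) (indicator S2) = 0" "ip n (indicator S2) (indicator S1) = 0"
    using part by (simp_all add: ip_indicator sub m1_def m2_def Int_commute)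
  have w1: "ip n w (indicator S1) = \<alpha> * m1" "ip n w (indicator S2) = \<gamma> * m2"
    by (simp_all add: w_def ip_linear II)
  have Pw: "mv n ?P w i = indicator S1 i" if "i < n" for i
  proof -
    have "a * (\<alpha> * m1) + b * (\<gamma> * m2) = (a\<^sup>2 - b\<^sup>2) / E"
      using m Epos by (simp add: \<alpha>_def \<gamma>_def power2_eq_square diff_divide_distrib)
    moreover have "b * (\<alpha> * m1) + a * (\<gamma> * m2) = 0"
      using m Epos by (simp add: \<alpha>_def \<gamma>_def)
    ultimately show ?thesis using that Epos
      by (simp add: mv_block_mat[OF part] w1 E_def[symmetric])
  qed
  have ww: "ip n w w = \<alpha>\<^sup>2 * m1 + \<gamma>\<^sup>2 * m2"
    by (subst (2) w_def) (simp add: ip_linear w1 power2_eq_square)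
  \<comment> \<open>Each of the two terms of |w|^2 contributes 36 because both clusters have at
    least n / 6 nodes; the factor (2 \<delta>)^2 below turns 72 into 288.\<close>
  have wle: "ip n w w \<le> 72 / (real n * (a - b))\<^sup>2 * m1"
  proof -
    have ab1: "a\<^sup>2 / E\<^sup>2 \<le> 1 / (a - b)\<^sup>2" "b\<^sup>2 / E\<^sup>2 \<le> 1 / (a - b)\<^sup>2"
    proof -
      have "a\<^sup>2 \<le> (a + b)\<^sup>2" "b\<^sup>2 \<le> (a + b)\<^sup>2" using ab by (auto intro: power_mono)
      then show "a\<^sup>2 / E\<^sup>2 \<le> 1 / (a - b)\<^sup>2" "b\<^sup>2 / E\<^sup>2 \<le> 1 / (a - b)\<^sup>2"
        unfolding E power_mult_distrib using ab by (simp_all add: divide_simps)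
    qed
    have "\<alpha>\<^sup>2 * m1 = (a\<^sup>2 / E\<^sup>2) * (1 / m1)" using m by (simp add: \<alpha>_def power2_eq_square)
    also have "\<dots> \<le> 1 / (a - b)\<^sup>2 * (1 / m1)" using m by (intro mult_right_mono ab1) auto
    finally have A: "\<alpha>\<^sup>2 * m1 \<le> 1 / (a - b)\<^sup>2 * (1 / m1)" .
    have "\<gamma>\<^sup>2 * m2 = (b\<^sup>2 / E\<^sup>2) * (1 / m2)" using m by (simp add: \<gamma>_def power2_eq_square)
    also have "\<dots> \<le> 1 / (a - b)\<^sup>2 * (1 / m2)" using m by (intro mult_right_mono ab1) auto
    finally have B: "\<gamma>\<^sup>2 * m2 \<le> 1 / (a - b)\<^sup>2 * (1 / m2)" .
    have r: "1 / m \<le> 36 / (real n)\<^sup>2 * m1" if "m \<ge> real n / 6" for m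
    proof -
      have "(real n / 6) * (real n / 6) \<le> m * m1" using that m by (intro mult_mono) auto
      moreover have "m > 0" using that size by auto
      ultimately show ?thesis using size by (simp add: divide_simps power2_eq_square mult_ac)
    qed
    have "1 / (a - b)\<^sup>2 * (1 / m1) + 1 / (a - b)\<^sup>2 * (1 / m2)
        \<le> 1 / (a - b)\<^sup>2 * (36 / (real n)\<^sup>2 * m1) + 1 / (a - b)\<^sup>2 * (36 / (real n)\<^sup>2 * m1)"
      using r m by (intro add_mono mult_left_mono) auto
    also have "\<dots> = 72 / (real n * (a - b))\<^sup>2 * m1" by (simp add: power_mult_distrib)
    finally show ?thesis using A B ww by linarith
  qed
  define e where "e = mv n (\<lambda>i j. M i j - ?P i j) w"
  have dec: "?R (indicator S1) i = mv n M (?R w) i + ?R (\<lambda>i. - e i) i" if "i < n" for i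
  proof -
    have "ip n (indicator S1) u = ip n (\<lambda>i. mv n M w i + (- e i)) u" for u
      by (rule ip_cong) (simp_all add: e_def mv_diff_mat Pw)
    moreover have "indicator S1 i = mv n M w i + (- e i)" using that by (simp add: e_def mv_diff_mat Pw)
    ultimately have "?R (indicator S1) i = ?R (\<lambda>i. mv n M w i + (- e i)) i" by (simp add: resid_def)
    also have "\<dots> = ?R (mv n M w) i + ?R (\<lambda>i. - e i) i" by (simp only: resid_add)
    also have "?R (mv n M w) i = mv n M (?R w) i"
    proof -
      have "ip n w (mv n M u1) = ip n w (\<lambda>i. l1 * u1 i)" by (rule ip_cong) (simp_all add: e1)
      then have "ip n (mv n M w) u1 = l1 * ip n w u1"
        using ip_mv_sym[OF sym] by (simp add: ip_scale_right)
      moreover have "ip n w (mv n M u2) = ip n w (\<lambda>i. l2 * u2 i)" by (rule ip_cong) (simp_all add: e2)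
      then have "ip n (mv n M w) u2 = l2 * ip n w u2"
        using ip_mv_sym[OF sym] by (simp add: ip_scale_right)
      ultimately show ?thesis using that by (simp add: resid_alt mv_diff mv_scale e1 e2)
    qed
    finally show ?thesis .
  qed
  have rank2: "\<forall>i<n. mv n ?P x i = 0" if "ip n x (indicator S1) = 0" "ip n x (indicator S2) = 0" for x
    using that by (simp add: mv_block_mat[OF part])
  have "L2_set (?R (indicator S1)) {..<n} = L2_set (\<lambda>i. mv n M (?R w) i + ?R (\<lambda>i. - e i) i) {..<n}"
    by (rule L2_set_cong) (simp_all add: dec)
  also have "\<dots> \<le> L2_set (mv n M (?R w)) {..<n} + L2_set (?R (\<lambda>i. - e i)) {..<n}"
    by (rule L2_set_triangle_ineq)
  also have "L2_set (mv n M (?R w)) {..<n} \<le> \<delta> * L2_set (?R w) {..<n}"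
    by (rule leading_eigvecs_small_complement[OF sym lead opb rank2 resid_perp])
  also have "\<delta> * L2_set (?R w) {..<n} \<le> \<delta> * L2_set w {..<n}"
    using d0 by (intro mult_left_mono resid_norm_le)
  also have "L2_set (?R (\<lambda>i. - e i)) {..<n} \<le> L2_set (\<lambda>i. - e i) {..<n}" by (rule resid_norm_le)
  also have "L2_set (\<lambda>i. - e i) {..<n} = L2_set e {..<n}" by (simp add: L2_set_def)
  also have "L2_set e {..<n} \<le> \<delta> * L2_set w {..<n}" unfolding e_def by (rule op_bound_mv[OF opb])
  finally have "L2_set (?R (indicator S1)) {..<n} \<le> 2 * \<delta> * L2_set w {..<n}" by simp
  then have "(L2_set (?R (indicator S1)) {..<n})\<^sup>2 \<le> (2 * \<delta> * L2_set w {..<n})\<^sup>2"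
    by (simp add: power_mono L2_set_nonneg)
  then have "ip n (?R (indicator S1)) (?R (indicator S1)) \<le> 4 * \<delta>\<^sup>2 * ip n w w"
    by (simp add: L2_set_ip_sq power_mult_distrib)
  also have "\<dots> \<le> 4 * \<delta>\<^sup>2 * (72 / (real n * (a - b))\<^sup>2 * m1)" by (intro mult_left_mono wle) simp
  finally show ?thesis by (simp add: m1_def)
qed


section \<open>From eigenvector error to clustering error by approximate k-means\<close>

lemma sum_split_clusters:
  fixes f :: "nat \<Rightarrow> real"
  assumes "S1 \<union> S2 = {..<n}" "S1 \<inter> S2 = {}"
  shows "(\<Sum>i<n. f i) = (\<Sum>i\<in>S1. f i) + (\<Sum>i\<in>S2. f i)"
proof -
  have "finite S1" "finite S2" using assms(1) by (metis finite_Un finite_lessThan)+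
  then show ?thesis using assms by (metis sum.union_disjoint)
qed

lemma sum_sq_dev_mean:
  fixes f :: "nat \<Rightarrow> real"
  assumes "m = real (card S)" "m > 0"
  shows "(\<Sum>i\<in>S. ((\<Sum>j\<in>S. f j) / m - f i)\<^sup>2) = (\<Sum>i\<in>S. (f i)\<^sup>2) - (\<Sum>j\<in>S. f j)\<^sup>2 / m"
proof -
  define c where "c = (\<Sum>j\<in>S. f j) / m"
  have "(\<Sum>i\<in>S. (c - f i)\<^sup>2) = (\<Sum>i\<in>S. c\<^sup>2 - 2 * c * f i + (f i)\<^sup>2)"
    by (simp add: power2_diff algebra_simps)
  also have "\<dots> = m * c\<^sup>2 - 2 * c * (\<Sum>j\<in>S. f j) + (\<Sum>i\<in>S. (f i)\<^sup>2)"
    by (simp add: sum.distrib sum_subtractf assms(1) sum_distrib_left)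
  also have "\<dots> = (\<Sum>i\<in>S. (f i)\<^sup>2) - (\<Sum>j\<in>S. f j)\<^sup>2 / m"
    using assms(2) by (simp add: c_def power2_eq_square)
  finally show ?thesis by (simp add: c_def)
qed

lemma sq_dist_half_sum: "(a - b)\<^sup>2 \<le> 2 * (x - a)\<^sup>2 + 2 * (x - b)\<^sup>2" for a b x :: real
proof -
  have "2 * (x - a)\<^sup>2 + 2 * (x - b)\<^sup>2 - (a - b)\<^sup>2 = (2 * x - a - b)\<^sup>2"
    by (simp add: power2_eq_square algebra_simps)
  then show ?thesis by (metis diff_ge_0_iff_ge zero_le_power2)
qed

text \<open>(A1, A2) / m1 and (B1, B2) / m2 are the mean rows of U over the two clusters. Small
  residuals say that they are nearly orthogonal with squared lengths near 1 / m1 and 1 / m2, so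
  their squared distance is at least (1 - 2 \<eta>) (1 / m1 + 1 / m2); the harmonic mean gives the
  rest.\<close>

lemma cluster_centers_separated:
  fixes m1 m2 \<eta> :: real
  assumes pos: "m1 > 0" "m2 > 0" and \<eta>: "0 \<le> \<eta>" "\<eta> \<le> 1/4"
    and r1: "m1 - A1\<^sup>2 - A2\<^sup>2 \<le> \<eta> * m1" and r2: "m2 - B1\<^sup>2 - B2\<^sup>2 \<le> \<eta> * m2"
    and cr: "(A1 * B1 + A2 * B2)\<^sup>2 \<le> (\<eta> * m1) * (\<eta> * m2)"
  shows "2 / (m1 + m2) \<le> (A1 / m1 - B1 / m2)\<^sup>2 + (A2 / m1 - B2 / m2)\<^sup>2"
proof -
  have c: "\<bar>A1 * B1 + A2 * B2\<bar> \<le> \<eta> * sqrt (m1 * m2)"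
  proof -
    have "\<bar>A1 * B1 + A2 * B2\<bar> \<le> sqrt (\<eta>\<^sup>2 * (m1 * m2))"
      using cr by (intro real_le_rsqrt) (simp add: power2_eq_square mult_ac)
    also have "\<dots> = \<eta> * sqrt (m1 * m2)" using \<eta> by (simp add: real_sqrt_mult)
    finally show ?thesis .
  qed
  define D where "D = 1 / m1 + 1 / m2"
  have amgm: "2 * sqrt (m1 * m2) / (m1 * m2) \<le> D"
  proof -
    have "2 * sqrt (m1 * m2) \<le> m1 + m2" using arith_geo_mean_sqrt[of m1 m2] pos by simp
    then have "2 * sqrt (m1 * m2) / (m1 * m2) \<le> (m1 + m2) / (m1 * m2)" using pos by (intro divide_right_mono) auto
    also have "\<dots> = D" using pos by (simp add: D_def field_simps)
    finally show ?thesis .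
  qed
  have hm: "4 / (m1 + m2) \<le> D"
  proof -
    have "4 * (m1 * m2) \<le> (m1 + m2) * (m1 + m2)"
      using zero_le_power2[of "m1 - m2"] by (simp add: power2_eq_square algebra_simps)
    then show ?thesis using pos by (simp add: D_def divide_simps algebra_simps)
  qed
  have "(A1 / m1 - B1 / m2)\<^sup>2 + (A2 / m1 - B2 / m2)\<^sup>2
     = (A1\<^sup>2 + A2\<^sup>2) / m1\<^sup>2 + (B1\<^sup>2 + B2\<^sup>2) / m2\<^sup>2 - 2 * (A1 * B1 + A2 * B2) / (m1 * m2)"
    using pos by (simp add: power2_eq_square field_simps)
  moreover have "(A1\<^sup>2 + A2\<^sup>2) / m1\<^sup>2 \<ge> (1 - \<eta>) * (1 / m1)"
  proof -
    have "(1 - \<eta>) * m1 / m1\<^sup>2 \<le> (A1\<^sup>2 + A2\<^sup>2) / m1\<^sup>2" using r1 by (intro divide_right_mono) (auto simp: algebra_simps)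
    then show ?thesis using pos by (simp add: power2_eq_square)
  qed
  moreover have "(B1\<^sup>2 + B2\<^sup>2) / m2\<^sup>2 \<ge> (1 - \<eta>) * (1 / m2)"
  proof -
    have "(1 - \<eta>) * m2 / m2\<^sup>2 \<le> (B1\<^sup>2 + B2\<^sup>2) / m2\<^sup>2" using r2 by (intro divide_right_mono) (auto simp: algebra_simps)
    then show ?thesis using pos by (simp add: power2_eq_square)
  qed
  moreover have "2 * (A1 * B1 + A2 * B2) / (m1 * m2) \<le> \<eta> * D"
  proof -
    have "2 * (A1 * B1 + A2 * B2) / (m1 * m2) \<le> 2 * (\<eta> * sqrt (m1 * m2)) / (m1 * m2)"
      using c pos by (intro divide_right_mono) auto
    also have "\<dots> = \<eta> * (2 * sqrt (m1 * m2) / (m1 * m2))" by simp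
    also have "\<dots> \<le> \<eta> * D" using amgm \<eta> by (intro mult_left_mono) auto
    finally show ?thesis .
  qed
  moreover have "(1 - 2 * \<eta>) * D = (1 - \<eta>) * (1 / m1) + (1 - \<eta>) * (1 / m2) - \<eta> * D"
    unfolding D_def by algebra
  ultimately have "(A1 / m1 - B1 / m2)\<^sup>2 + (A2 / m1 - B2 / m2)\<^sup>2 \<ge> (1 - 2 * \<eta>) * D"
    by linarith
  moreover have "(1 - 2 * \<eta>) * D \<ge> (1/2) * D" using \<eta> hm pos by (intro mult_right_mono) (auto simp: D_def)
  ultimately show ?thesis using hm by linarith
qed

lemma loss_le_1:
  assumes "0 < n" shows "loss n x y \<le> 1"
proof -
  have "hamming n x y \<le> n" unfolding hamming_def
    by (rule order_trans[OF card_mono[of "{..<n}"]]) auto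
  then have "real (min (hamming n x y) k) \<le> real n" for k by simp
  then show ?thesis using assms by (simp add: loss_def divide_le_eq_1)
qed

text \<open>\<open>e s t\<close> is the cost of assigning a node of true cluster \<open>t\<close> to the estimated cluster \<open>s\<close>; each
  \<open>s\<close> is far from one of the two true centres.\<close>

lemma loss_le_assignment_cost:
  fixes e :: "bool \<Rightarrow> bool \<Rightarrow> real"
  assumes n: "0 < n" and z: "\<forall>i<n. z i = 1 \<or> z i = -1"
    and size: "real n / 6 \<le> card {i. i < n \<and> z i = 1}" "real n / 6 \<le> card {i. i < n \<and> z i = -1}"
    and e0: "\<And>s t. 0 \<le> e s t" and sep: "\<And>s. 1 / real n \<le> e s True + e s False"
  shows "loss n (\<lambda>i. if g i then 1 else - 1) z \<le> 12 * (\<Sum>i<n. e (g i) (z i = 1))"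
proof -
  define T where "T = (\<Sum>i<n. e (g i) (z i = 1))"
  let ?zt = "\<lambda>i. if g i then 1 else - 1 :: int"
  \<comment> \<open>Half of the separation 1 / n: each estimated cluster has cost at least
    \<open>k\<close> against one of the two true clusters.\<close>
  define k where "k = 1 / (2 * real n)"
  have k: "e s True \<ge> k \<or> e s False \<ge> k" for s using sep[of s] by (auto simp: k_def field_simps)
  have cnt: "real (card B) * k \<le> T" if "B \<subseteq> {..<n}" "\<And>i. i \<in> B \<Longrightarrow> e (g i) (z i = 1) \<ge> k" for B
  proof -
    have "real (card B) * k = (\<Sum>i\<in>B. k)" by simp
    also have "\<dots> \<le> (\<Sum>i\<in>B. e (g i) (z i = 1))" using that by (intro sum_mono) auto
    also have "\<dots> \<le> T" unfolding T_def using that e0 by (intro sum_mono2) auto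
    finally show ?thesis .
  qed
  have T0: "T \<ge> 0" unfolding T_def using e0 by (intro sum_nonneg) auto
  have fromham: "loss n ?zt z \<le> 12 * T" if "real h * k \<le> T" "h = hamming n ?zt z \<or> h = hamming n (\<lambda>i. - ?zt i) z" for h
  proof -
    have "loss n ?zt z \<le> real h / real n"
      unfolding loss_def using that(2) n by (intro divide_right_mono) auto
    also have "\<dots> = 2 * (real h * k)" using n by (simp add: k_def)
    also have "\<dots> \<le> 12 * T" using that(1) T0 by linarith
    finally show ?thesis .
  qed
  have fromone: "loss n ?zt z \<le> 12 * T" if "real n / 6 * k \<le> T"
  proof -
    have "real n / 6 * k = 1 / 12" using n by (simp add: k_def)
    then show ?thesis using that loss_le_1[OF n, of ?zt z] by linarith
  qed
  have kpos: "k > 0" using n by (simp add: k_def)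
  \<comment> \<open>If the two estimated clusters are far from different true clusters, every node
    misclassified up to a global sign pays \<open>k\<close>. If both are far from the same one, all
    of its at least n / 6 nodes pay, the total is at least 1 / 12, and the trivial bound on the loss
    suffices.\<close>
  consider "e True False \<ge> k" "e False True \<ge> k" | "e True True \<ge> k" "e False False \<ge> k"
    | "e True True \<ge> k" "e False True \<ge> k" | "e True False \<ge> k" "e False False \<ge> k"
    using k[of True] k[of False] by blast
  then have "loss n ?zt z \<le> 12 * T"
  proof cases
    case 1
    have "real (hamming n ?zt z) * k \<le> T"
      unfolding hamming_def by (rule cnt) (use 1 z in \<open>auto split: if_splits\<close>)
    then show ?thesis by (rule fromham) simp
  next
    case 2
    have "real (hamming n (\<lambda>i. - ?zt i) z) * k \<le> T"
      unfolding hamming_def by (rule cnt) (use 2 z in \<open>auto split: if_splits\<close>)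
    then show ?thesis by (rule fromham) simp
  next
    case 3
    have "real (card {i. i < n \<and> z i = 1}) * k \<le> T"
    proof (rule cnt)
      fix i assume "i \<in> {i. i < n \<and> z i = 1}"
      then show "k \<le> e (g i) (z i = 1)" using 3 by (cases "g i") auto
    qed auto
    then show ?thesis using size(1) kpos by (intro fromone) (meson mult_right_mono order_less_imp_le order_trans)
  next
    case 4
    have "real (card {i. i < n \<and> z i = -1}) * k \<le> T"
    proof (rule cnt)
      fix i assume "i \<in> {i. i < n \<and> z i = -1}"
      then show "k \<le> e (g i) (z i = 1)" using 4 by (cases "g i") auto
    qed auto
    then show ?thesis using size(2) kpos by (intro fromone) (meson mult_right_mono order_less_imp_le order_trans)
  qed
  then show ?thesis by (simp add: T_def)
qed

text \<open>The true partition with its cluster means is an admissible competitor, and its cost is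
  the sum of the two relative residuals. The constant 48 is 12 from counting, times 2 from the
  triangle inequality, times 2 from the competitor's cost 2 \<eta>; the factor 2 + \<epsilon> adds
  the output's share 1 + \<epsilon> to the competitor's own.\<close>

lemma kmeans_loss_bound:
  fixes \<eta> \<epsilon> :: real
  assumes n: "0 < n" and z: "\<forall>i<n. z i = 1 \<or> z i = -1"
    and orth: "ip n u1 u1 = 1" "ip n u2 u2 = 1" "ip n u1 u2 = 0"
    and S: "S1 = {i. i < n \<and> z i = 1}" "S2 = {i. i < n \<and> z i = -1}"
    and size: "real n / 6 \<le> card S1" "real n / 6 \<le> card S2"
    and res1: "ip n (resid n u1 u2 (indicator S1)) (resid n u1 u2 (indicator S1)) \<le> \<eta> * card S1"
    and res2: "ip n (resid n u1 u2 (indicator S2)) (resid n u1 u2 (indicator S2)) \<le> \<eta> * card S2"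
    and \<eta>: "0 \<le> \<eta>" and \<epsilon>: "0 < \<epsilon>"
    and km: "\<forall>g' a' b'. kmeans_obj n u1 u2 g a b \<le> (1 + \<epsilon>) * kmeans_obj n u1 u2 g' a' b'"
  shows "loss n (\<lambda>i. if g i then 1 else - 1) z \<le> 48 * (2 + \<epsilon>) * \<eta>"
proof (cases "\<eta> \<le> 1/4")
  \<comment> \<open>Here the right-hand side is at least 24, above any loss.\<close>
  case False
  then have "48 * (2 + \<epsilon>) * \<eta> \<ge> 48 * 2 * (1/4)" using \<epsilon> by (intro mult_mono) auto
  then show ?thesis using loss_le_1[OF n, of "\<lambda>i. if g i then 1 else - 1" z] by linarith
next
  case True
  interpret orthonormal_pair n u1 u2 using orth by unfold_locales
  let ?R = "resid n u1 u2"
  have part: "S1 \<union> S2 = {..<n}" "S1 \<inter> S2 = {}" using z by (auto simp: S)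
  have fin: "finite S1" "finite S2" by (simp_all add: S)
  define m1 where "m1 = real (card S1)"
  define m2 where "m2 = real (card S2)"
  have m: "m1 > 0" "m2 > 0" using size n by (auto simp: m1_def m2_def)
  have m12: "m1 + m2 = real n"
    using card_Un_disjoint[OF fin part(2)] part(1) by (simp add: m1_def m2_def)
  have ips: "ip n (indicator T) u = (\<Sum>i\<in>T. u i)" if "T \<subseteq> {..<n}" for T and u :: "nat \<Rightarrow> real"
    using that by (simp add: ip_def indicator_times_eq_if Int_absorb1 sum.If_cases)
  have sub: "S1 \<subseteq> {..<n}" "S2 \<subseteq> {..<n}" using part by auto
  define A1 A2 B1 B2 where "A1 = (\<Sum>i\<in>S1. u1 i)" and "A2 = (\<Sum>i\<in>S1. u2 i)"
    and "B1 = (\<Sum>i\<in>S2. u1 i)" and "B2 = (\<Sum>i\<in>S2. u2 i)"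
  note AB = A1_def A2_def B1_def B2_def
  have r1: "ip n (?R (indicator S1)) (?R (indicator S1)) = m1 - A1\<^sup>2 - A2\<^sup>2"
    unfolding ip_resid ip_indicator[OF sub(1) sub(1)] by (simp add: ips sub AB m1_def power2_eq_square)
  have r2: "ip n (?R (indicator S2)) (?R (indicator S2)) = m2 - B1\<^sup>2 - B2\<^sup>2"
    unfolding ip_resid ip_indicator[OF sub(2) sub(2)] by (simp add: ips sub AB m2_def power2_eq_square)
  have r12: "ip n (?R (indicator S1)) (?R (indicator S2)) = - (A1 * B1 + A2 * B2)"
    unfolding ip_resid ip_indicator[OF sub] using part by (simp add: ips sub AB)
  have R1: "m1 - A1\<^sup>2 - A2\<^sup>2 \<le> \<eta> * m1" using res1 unfolding r1 by (simp add: m1_def)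
  have R2: "m2 - B1\<^sup>2 - B2\<^sup>2 \<le> \<eta> * m2" using res2 unfolding r2 by (simp add: m2_def)
  have cr: "(A1 * B1 + A2 * B2)\<^sup>2 \<le> (\<eta> * m1) * (\<eta> * m2)"
  proof -
    have "(A1 * B1 + A2 * B2)\<^sup>2 = \<bar>ip n (?R (indicator S1)) (?R (indicator S2))\<bar>\<^sup>2"
      by (simp only: r12 power2_abs power2_minus)
    also have "\<dots> \<le> (L2_set (?R (indicator S1)) {..<n} * L2_set (?R (indicator S2)) {..<n})\<^sup>2"
      by (intro power_mono ip_le_L2) auto
    also have "\<dots> = (m1 - A1\<^sup>2 - A2\<^sup>2) * (m2 - B1\<^sup>2 - B2\<^sup>2)"
      by (simp add: power_mult_distrib L2_set_ip_sq r1 r2)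
    also have "\<dots> \<le> (\<eta> * m1) * (\<eta> * m2)"
      using R1 R2 \<eta> m r2 ip_self_nonneg[of n "?R (indicator S2)"] by (intro mult_mono) auto
    finally show ?thesis .
  qed
  have sep: "2 / real n \<le> (A1 / m1 - B1 / m2)\<^sup>2 + (A2 / m1 - B2 / m2)\<^sup>2"
    using cluster_centers_separated[OF m \<eta> True R1 R2 cr] by (simp add: m12)
  define c where "c t = (if t then (A1 / m1, A2 / m1) else (B1 / m2, B2 / m2))" for t
  define x where "x s = (if s then a else b)" for s
  define gs where "gs i = (z i = 1)" for i
  \<comment> \<open>The columns of U have total squared length 2, so the cost at the cluster means
    is 2 minus the squared projections of the two normalised indicators.\<close>
  have obj: "kmeans_obj n u1 u2 gs (A1 / m1, A2 / m1) (B1 / m2, B2 / m2) \<le> 2 * \<eta>"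
  proof -
    have "kmeans_obj n u1 u2 gs (A1 / m1, A2 / m1) (B1 / m2, B2 / m2)
        = (\<Sum>i\<in>S1. (A1 / m1 - u1 i)\<^sup>2 + (A2 / m1 - u2 i)\<^sup>2) + (\<Sum>i\<in>S2. (B1 / m2 - u1 i)\<^sup>2 + (B2 / m2 - u2 i)\<^sup>2)"
      unfolding kmeans_obj_def sum_split_clusters[OF part]
      by (intro arg_cong2[of _ _ _ _ "(+)"] sum.cong) (auto simp: gs_def S)
    also have "\<dots> = (\<Sum>i\<in>S1. (u1 i)\<^sup>2) + (\<Sum>i\<in>S2. (u1 i)\<^sup>2) + (\<Sum>i\<in>S1. (u2 i)\<^sup>2) + (\<Sum>i\<in>S2. (u2 i)\<^sup>2)
        - A1\<^sup>2 / m1 - A2\<^sup>2 / m1 - B1\<^sup>2 / m2 - B2\<^sup>2 / m2"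
      using sum_sq_dev_mean[OF m1_def m(1)] sum_sq_dev_mean[OF m2_def m(2)]
      by (simp add: sum.distrib AB)
    also have "(\<Sum>i\<in>S1. (u1 i)\<^sup>2) + (\<Sum>i\<in>S2. (u1 i)\<^sup>2) = 1"
      using u11 sum_split_clusters[OF part, of "\<lambda>i. (u1 i)\<^sup>2"] by (simp add: ip_def power2_eq_square)
    finally have "kmeans_obj n u1 u2 gs (A1 / m1, A2 / m1) (B1 / m2, B2 / m2)
      = (m1 - A1\<^sup>2 - A2\<^sup>2) / m1 + (m2 - B1\<^sup>2 - B2\<^sup>2) / m2"
      using u22 sum_split_clusters[OF part, of "\<lambda>i. (u2 i)\<^sup>2"] m
      by (simp add: ip_def power2_eq_square diff_divide_distrib)
    also have "\<dots> \<le> \<eta> * m1 / m1 + \<eta> * m2 / m2" using R1 R2 m by (intro add_mono divide_right_mono) auto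
    finally show ?thesis using m by simp
  qed
  have kobj: "kmeans_obj n u1 u2 h y y' = (\<Sum>i<n. (fst (if h i then y else y') - u1 i)\<^sup>2 + (snd (if h i then y else y') - u2 i)\<^sup>2)" for h y y'
    unfolding kmeans_obj_def by (intro sum.cong) auto
  define e where "e s t = (fst (x s) - fst (c t))\<^sup>2 + (snd (x s) - snd (c t))\<^sup>2" for s t
  have tri: "(p - q)\<^sup>2 \<le> 2 * (p - r)\<^sup>2 + 2 * (q - r)\<^sup>2" for p q r :: real
    using sq_dist_half_sum[of p q r] by (simp add: power2_commute)
  have "(\<Sum>i<n. e (g i) (z i = 1)) \<le> (\<Sum>i<n. 2 * ((fst (x (g i)) - u1 i)\<^sup>2 + (snd (x (g i)) - u2 i)\<^sup>2)
      + 2 * ((fst (c (gs i)) - u1 i)\<^sup>2 + (snd (c (gs i)) - u2 i)\<^sup>2))"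
  proof (rule sum_mono)
    fix i
    show "e (g i) (z i = 1) \<le> 2 * ((fst (x (g i)) - u1 i)\<^sup>2 + (snd (x (g i)) - u2 i)\<^sup>2)
      + 2 * ((fst (c (gs i)) - u1 i)\<^sup>2 + (snd (c (gs i)) - u2 i)\<^sup>2)"
      using tri[of "fst (x (g i))" "fst (c (gs i))" "u1 i"] tri[of "snd (x (g i))" "snd (c (gs i))" "u2 i"]
      unfolding e_def gs_def distrib_left by linarith
  qed
  also have "\<dots> = 2 * kmeans_obj n u1 u2 g a b + 2 * kmeans_obj n u1 u2 gs (A1 / m1, A2 / m1) (B1 / m2, B2 / m2)"
    unfolding kobj x_def c_def by (simp add: sum.distrib sum_distrib_left)
  also have "\<dots> \<le> 2 * (2 + \<epsilon>) * kmeans_obj n u1 u2 gs (A1 / m1, A2 / m1) (B1 / m2, B2 / m2)"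
    using km[rule_format, of gs "(A1 / m1, A2 / m1)" "(B1 / m2, B2 / m2)"] by (simp add: algebra_simps)
  also have "\<dots> \<le> 2 * (2 + \<epsilon>) * (2 * \<eta>)" using obj \<epsilon> by (intro mult_left_mono) auto
  also have "\<dots> = 4 * (2 + \<epsilon>) * \<eta>" by simp
  finally have cost: "(\<Sum>i<n. e (g i) (z i = 1)) \<le> 4 * (2 + \<epsilon>) * \<eta>" .
  have "loss n (\<lambda>i. if g i then 1 else - 1) z \<le> 12 * (\<Sum>i<n. e (g i) (z i = 1))"
  proof (rule loss_le_assignment_cost[OF n z])
    show "real n / 6 \<le> card {i. i < n \<and> z i = 1}" "real n / 6 \<le> card {i. i < n \<and> z i = -1}"
      using size by (simp_all add: S)
    show "0 \<le> e s t" for s t by (simp add: e_def)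
    show "1 / real n \<le> e s True + e s False" for s
      using sep sq_dist_half_sum[of "A1 / m1" "B1 / m2" "fst (x s)"] sq_dist_half_sum[of "A2 / m1" "B2 / m2" "snd (x s)"]
      unfolding e_def c_def by simp
  qed
  then show ?thesis using cost by linarith
qed

lemma loss_le_op_bound:
  assumes n: "0 < n" and z: "\<forall>i<n. z i = 1 \<or> z i = -1"
    and size: "real n / 6 \<le> card {i. i < n \<and> z i = 1}" "real n / 6 \<le> card {i. i < n \<and> z i = -1}"
    and sym: "\<And>i j. i < n \<Longrightarrow> j < n \<Longrightarrow> M i j = M j i"
    and lead: "leading_eigvecs n M u1 u2"
    and opb: "op_bound n (\<lambda>i j. M i j - (if z i = z j then a else b)) \<delta>"
    and ab: "0 \<le> b" "b < a" and \<epsilon>: "0 < \<epsilon>"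
    and km: "\<forall>g' a' b'. kmeans_obj n u1 u2 g xa xb \<le> (1 + \<epsilon>) * kmeans_obj n u1 u2 g' a' b'"
  shows "loss n (\<lambda>i. if g i then 1 else - 1) z \<le> 13824 * (2 + \<epsilon>) * \<delta>\<^sup>2 / (real n * (a - b))\<^sup>2"
proof -
  define S1 where "S1 = {i. i < n \<and> z i = 1}"
  define S2 where "S2 = {i. i < n \<and> z i = -1}"
  have part: "S1 \<union> S2 = {..<n}" "S1 \<inter> S2 = {}" "S2 \<union> S1 = {..<n}" "S2 \<inter> S1 = {}"
    using z by (auto simp: S1_def S2_def)
  have zz: "z i = 1 \<or> z i = -1" if "i < n" for i using z that by blast
  have o1: "op_bound n (\<lambda>i j. M i j - block_mat S1 a b i j) \<delta>"
  proof (rule op_bound_cong[OF opb])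
    fix i j assume "i < n" "j < n"
    then show "M i j - (if z i = z j then a else b) = M i j - block_mat S1 a b i j"
      using zz[of i] zz[of j] by (auto simp: block_mat_def S1_def)
  qed
  have o2: "op_bound n (\<lambda>i j. M i j - block_mat S2 a b i j) \<delta>"
  proof (rule op_bound_cong[OF opb])
    fix i j assume "i < n" "j < n"
    then show "M i j - (if z i = z j then a else b) = M i j - block_mat S2 a b i j"
      using zz[of i] zz[of j] by (auto simp: block_mat_def S2_def)
  qed
  have sz: "real n / 6 \<le> card S1" "real n / 6 \<le> card S2" using size by (simp_all add: S1_def S2_def)
  \<comment> \<open>The residual estimate applies to either cluster after exchanging their roles; 48
    * 288 = 13824.\<close>
  have "loss n (\<lambda>i. if g i then 1 else - 1) z \<le> 48 * (2 + \<epsilon>) * (288 * \<delta>\<^sup>2 / (real n * (a - b))\<^sup>2)"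
  proof (rule kmeans_loss_bound[OF n z _ _ _ S1_def S2_def sz _ _ _ \<epsilon> km])
    show "ip n u1 u1 = 1" "ip n u2 u2 = 1" "ip n u1 u2 = 0"
      using lead by (auto simp: leading_eigvecs_def ip_def)
    show "ip n (resid n u1 u2 (indicator S1)) (resid n u1 u2 (indicator S1)) \<le> 288 * \<delta>\<^sup>2 / (real n * (a - b))\<^sup>2 * card S1"
      by (rule resid_cluster_indicator[OF sym lead part(1,2) o1 ab sz n])
    show "ip n (resid n u1 u2 (indicator S2)) (resid n u1 u2 (indicator S2)) \<le> 288 * \<delta>\<^sup>2 / (real n * (a - b))\<^sup>2 * card S2"
      by (rule resid_cluster_indicator[OF sym lead part(3,4) o2 ab sz(2,1) n])
  qed simp
  also have "\<dots> = 13824 * (2 + \<epsilon>) * \<delta>\<^sup>2 / (real n * (a - b))\<^sup>2" by simp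
  finally show ?thesis .
qed

section \<open>Sums of independent Bernoulli variables\<close>

definition bsum :: "'a set \<Rightarrow> ('a \<Rightarrow> real) \<Rightarrow> ('a \<Rightarrow> bool) \<Rightarrow> real" where
  "bsum A c f = (\<Sum>e\<in>A. c e * of_bool (f e))"

abbreviation bern :: "'a set \<Rightarrow> ('a \<Rightarrow> real) \<Rightarrow> ('a \<Rightarrow> bool) pmf" where
  "bern A \<pi> \<equiv> Pi_pmf A False (\<lambda>e. bernoulli_pmf (\<pi> e))"

lemma finite_set_Pi_bool: "finite A \<Longrightarrow> finite (set_pmf (Pi_pmf A d (p :: 'a \<Rightarrow> bool pmf)))"
  by (simp add: set_Pi_pmf finite_PiE_dflt)

lemma integrable_Pi_bool: "finite A \<Longrightarrow>
    integrable (measure_pmf (Pi_pmf A d (p :: 'a \<Rightarrow> bool pmf))) (f :: _ \<Rightarrow> real)"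
  by (intro integrable_measure_pmf_finite finite_set_Pi_bool)

lemma expectation_Pi_bool_mono:
  fixes f g :: "('a \<Rightarrow> bool) \<Rightarrow> real"
  assumes "finite A" "\<And>x. f x \<le> g x"
  shows "measure_pmf.expectation (Pi_pmf A d p) f \<le> measure_pmf.expectation (Pi_pmf A d p) g"
  using assms by (intro integral_mono integrable_Pi_bool) auto

lemma prob_le_expectation:
  fixes Y :: "('a \<Rightarrow> bool) \<Rightarrow> real"
  assumes "finite A" "\<And>x. 0 \<le> Y x" "\<And>x. x \<in> S \<Longrightarrow> 1 \<le> Y x"
  shows "measure_pmf.prob (Pi_pmf A d p) S \<le> measure_pmf.expectation (Pi_pmf A d p) Y"
proof -
  have "measure_pmf.prob (Pi_pmf A d p) S = measure_pmf.expectation (Pi_pmf A d p) (indicator S)" by simp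
  also have "\<dots> \<le> measure_pmf.expectation (Pi_pmf A d p) Y"
    using assms by (intro expectation_Pi_bool_mono) (auto simp: indicator_def)
  finally show ?thesis .
qed

text \<open>Poisson bound: 1 + x is at most exp x in each factor. The size of \<open>c\<close> is
  unrestricted, since heavy pairs and rare flips call for large exponents.\<close>

lemma mgf_bern:
  assumes A: "finite A" and \<pi>: "\<And>e. e \<in> A \<Longrightarrow> 0 \<le> \<pi> e \<and> \<pi> e \<le> 1"
  shows "measure_pmf.expectation (bern A \<pi>) (\<lambda>f. exp (bsum A c f))
    \<le> exp (\<Sum>e\<in>A. \<pi> e * (exp (c e) - 1))"
proof -
  have "measure_pmf.expectation (bern A \<pi>) (\<lambda>f. exp (bsum A c f))
      = measure_pmf.expectation (bern A \<pi>) (\<lambda>f. \<Prod>e\<in>A. exp (c e * of_bool (f e)))"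
    by (simp only: bsum_def exp_sum[OF A])
  also have "\<dots> = (\<Prod>e\<in>A. measure_pmf.expectation (bernoulli_pmf (\<pi> e)) (\<lambda>b. exp (c e * of_bool b)))"
    using A by (intro expectation_prod_Pi_pmf) (auto intro!: integrable_measure_pmf_finite)
  also have "\<dots> \<le> (\<Prod>e\<in>A. exp (\<pi> e * (exp (c e) - 1)))"
  proof (rule prod_mono)
    fix e assume e: "e \<in> A"
    have "measure_pmf.expectation (bernoulli_pmf (\<pi> e)) (\<lambda>b. exp (c e * of_bool b)) = 1 + \<pi> e * (exp (c e) - 1)"
      using \<pi>[OF e] by (simp add: algebra_simps)
    moreover have "0 \<le> measure_pmf.expectation (bernoulli_pmf (\<pi> e)) (\<lambda>b. exp (c e * of_bool b))"
      by (intro Bochner_Integration.integral_nonneg) auto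
    ultimately show "0 \<le> measure_pmf.expectation (bernoulli_pmf (\<pi> e)) (\<lambda>b. exp (c e * of_bool b)) \<and>
        measure_pmf.expectation (bernoulli_pmf (\<pi> e)) (\<lambda>b. exp (c e * of_bool b)) \<le> exp (\<pi> e * (exp (c e) - 1))"
      using exp_ge_add_one_self[of "\<pi> e * (exp (c e) - 1)"] by simp
  qed
  also have "\<dots> = exp (\<Sum>e\<in>A. \<pi> e * (exp (c e) - 1))" using A by (simp add: exp_sum)
  finally show ?thesis .
qed

text \<open>The Chernoff parameter is absorbed into the coefficients \<open>c\<close>; each
  application picks its own scaling, and \<open>K\<close> bounds the logarithm of the moment
  generating function.\<close>

lemma chernoff_bern:
  assumes "finite A" and "\<And>e. e \<in> A \<Longrightarrow> 0 \<le> \<pi> e \<and> \<pi> e \<le> 1"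
    and "(\<Sum>e\<in>A. \<pi> e * (exp (c e) - 1)) \<le> K"
  shows "measure_pmf.prob (bern A \<pi>) {f. t \<le> bsum A c f} \<le> exp (K - t)"
proof -
  have "measure_pmf.prob (bern A \<pi>) {f. t \<le> bsum A c f}
      \<le> measure_pmf.expectation (bern A \<pi>) (\<lambda>f. exp (- t) * exp (bsum A c f))"
    using assms(1) by (intro prob_le_expectation) (auto simp flip: exp_add)
  also have "\<dots> = exp (- t) * measure_pmf.expectation (bern A \<pi>) (\<lambda>f. exp (bsum A c f))" by simp
  also have "\<dots> \<le> exp (- t) * exp (\<Sum>e\<in>A. \<pi> e * (exp (c e) - 1))"
    using assms by (intro mult_left_mono mgf_bern) auto
  also have "\<dots> = exp ((\<Sum>e\<in>A. \<pi> e * (exp (c e) - 1)) - t)" by (simp flip: exp_add)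
  also have "\<dots> \<le> exp (K - t)" using assms(3) by simp
  finally show ?thesis .
qed

lemma exp_le_quadratic:
  fixes x :: real
  assumes "\<bar>x\<bar> \<le> 1"
  shows "exp x \<le> 1 + x + x\<^sup>2"
proof (cases "x \<ge> 0")
  case True then show ?thesis using assms exp_bound[of x] by simp
next
  case False
  define y where "y = - x"
  have y: "0 < y" "y \<le> 1" using False assms by (auto simp: y_def)
  \<comment> \<open>The product is 1 + y^3; replacing 1 + y by exp y only increases it.\<close>
  have "1 \<le> (1 - y + y\<^sup>2) * (1 + y)"
  proof -
    have "(1 - y + y\<^sup>2) * (1 + y) = 1 + y ^ 3" by (simp add: power2_eq_square power3_eq_cube algebra_simps)
    then show ?thesis using y by simp
  qed
  also have "\<dots> \<le> (1 - y + y\<^sup>2) * exp y"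
  proof (rule mult_left_mono)
    show "1 + y \<le> exp y" by (rule exp_ge_add_one_self)
    show "0 \<le> 1 - y + y\<^sup>2" using y by (simp add: power2_eq_square)
  qed
  finally have "exp (- y) \<le> 1 - y + y\<^sup>2" by (simp add: exp_minus divide_simps)
  then show ?thesis by (simp add: y_def)
qed

lemma mgf_bern_centered:
  assumes A: "finite A" and \<pi>: "\<And>e. e \<in> A \<Longrightarrow> 0 \<le> \<pi> e \<and> \<pi> e \<le> 1"
    and c: "\<And>e. e \<in> A \<Longrightarrow> \<bar>c e\<bar> \<le> 1"
  shows "measure_pmf.expectation (bern A \<pi>) (\<lambda>f. exp (bsum A c f - (\<Sum>e\<in>A. c e * \<pi> e)))
    \<le> exp (\<Sum>e\<in>A. \<pi> e * (c e)\<^sup>2)"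
proof -
  let ?m = "\<Sum>e\<in>A. c e * \<pi> e"
  have "(\<Sum>e\<in>A. \<pi> e * (exp (c e) - 1)) \<le> (\<Sum>e\<in>A. \<pi> e * (c e + (c e)\<^sup>2))"
  proof (intro sum_mono mult_left_mono)
    fix e assume "e \<in> A"
    show "exp (c e) - 1 \<le> c e + (c e)\<^sup>2" using exp_le_quadratic[OF c[OF \<open>e \<in> A\<close>]] by simp
  qed (use \<pi> in auto)
  also have "\<dots> = ?m + (\<Sum>e\<in>A. \<pi> e * (c e)\<^sup>2)" by (simp add: sum.distrib algebra_simps)
  finally have le: "(\<Sum>e\<in>A. \<pi> e * (exp (c e) - 1)) \<le> ?m + (\<Sum>e\<in>A. \<pi> e * (c e)\<^sup>2)" .
  have "measure_pmf.expectation (bern A \<pi>) (\<lambda>f. exp (bsum A c f - ?m))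
     = exp (- ?m) * measure_pmf.expectation (bern A \<pi>) (\<lambda>f. exp (bsum A c f))"
    by (simp add: exp_diff exp_minus field_simps)
  also have "\<dots> \<le> exp (- ?m) * exp (?m + (\<Sum>e\<in>A. \<pi> e * (c e)\<^sup>2))"
  proof (rule mult_left_mono)
    have "measure_pmf.expectation (bern A \<pi>) (\<lambda>f. exp (bsum A c f)) \<le> exp (\<Sum>e\<in>A. \<pi> e * (exp (c e) - 1))"
      by (rule mgf_bern[OF A \<pi>])
    also have "\<dots> \<le> exp (?m + (\<Sum>e\<in>A. \<pi> e * (c e)\<^sup>2))" using le by simp
    finally show "measure_pmf.expectation (bern A \<pi>) (\<lambda>f. exp (bsum A c f)) \<le> exp (?m + (\<Sum>e\<in>A. \<pi> e * (c e)\<^sup>2))" .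
  qed simp
  also have "\<dots> = exp (\<Sum>e\<in>A. \<pi> e * (c e)\<^sup>2)" by (simp flip: exp_add)
  finally show ?thesis .
qed

lemma bernstein_bern:
  assumes A: "finite A" and \<pi>: "\<And>e. e \<in> A \<Longrightarrow> 0 \<le> \<pi> e \<and> \<pi> e \<le> 1"
    and c: "\<And>e. e \<in> A \<Longrightarrow> \<bar>c e\<bar> \<le> 1" and K: "(\<Sum>e\<in>A. \<pi> e * (c e)\<^sup>2) \<le> K"
  shows "measure_pmf.prob (bern A \<pi>) {f. t \<le> bsum A c f - (\<Sum>e\<in>A. c e * \<pi> e)} \<le> exp (K - t)"
proof -
  let ?S = "\<lambda>f. bsum A c f - (\<Sum>e\<in>A. c e * \<pi> e)"
  have "measure_pmf.prob (bern A \<pi>) {f. t \<le> ?S f} \<le> measure_pmf.expectation (bern A \<pi>) (\<lambda>f. exp (- t) * exp (?S f))"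
    using A by (intro prob_le_expectation) (auto simp flip: exp_add)
  also have "\<dots> = exp (- t) * measure_pmf.expectation (bern A \<pi>) (\<lambda>f. exp (?S f))" by simp
  also have "\<dots> \<le> exp (- t) * exp (\<Sum>e\<in>A. \<pi> e * (c e)\<^sup>2)"
    using mgf_bern_centered[OF A \<pi> c] by (intro mult_left_mono) auto
  also have "\<dots> \<le> exp (K - t)" using K by (simp flip: exp_add)
  finally show ?thesis .
qed

text \<open>Splitting the product measure at \<open>B\<close> and Tonelli; nonnegativity allows the
  computation with extended nonnegative integrals, where no integrability has to be tracked.\<close>

lemma expectation_Pi_bool_indep:
  fixes F G :: "('a \<Rightarrow> bool) \<Rightarrow> real"
  assumes A: "finite A" and BA: "B \<subseteq> A"
    and F: "\<And>f g. (\<And>e. e \<in> B \<Longrightarrow> f e = g e) \<Longrightarrow> F f = F g"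
    and G: "\<And>f g. (\<And>e. e \<notin> B \<Longrightarrow> f e = g e) \<Longrightarrow> G f = G g"
    and F0: "\<And>f. 0 \<le> F f" and G0: "\<And>f. 0 \<le> G f"
  shows "measure_pmf.expectation (Pi_pmf A d p) (\<lambda>f. F f * G f)
    = measure_pmf.expectation (Pi_pmf A d p) F * measure_pmf.expectation (Pi_pmf A d p) G"
proof -
  let ?P = "Pi_pmf A d p" and ?Q = "Pi_pmf B d p" and ?R = "Pi_pmf (A - B) d p"
  let ?m = "\<lambda>f g x. if x \<in> B then f x else g x"
  have fin: "finite B" "finite (A - B)" using A BA finite_subset by auto
  have AB: "A = B \<union> (A - B)" using BA by blast
  have dec: "?P = map_pmf (\<lambda>(f, g). ?m f g) (pair_pmf ?Q ?R)"
    by (subst AB, subst Pi_pmf_union) (use fin in \<open>auto simp: case_prod_unfold\<close>)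
  have nn: "(\<integral>\<^sup>+f. H f \<partial>?P) = (\<integral>\<^sup>+f. \<integral>\<^sup>+g. H (?m f g) \<partial>?R \<partial>?Q)" for H
    by (simp add: dec nn_integral_pair_pmf')
  have eF: "F (?m f g) = F f" for f g by (rule F) simp
  have eG: "G (?m f g) = G g" for f g by (rule G) simp
  have "(\<integral>\<^sup>+f. ennreal (F f * G f) \<partial>?P) = (\<integral>\<^sup>+f. \<integral>\<^sup>+g. ennreal (F f) * ennreal (G g) \<partial>?R \<partial>?Q)"
    by (simp add: nn eF eG F0 G0 ennreal_mult)
  also have "\<dots> = (\<integral>\<^sup>+f. ennreal (F f) \<partial>?Q) * (\<integral>\<^sup>+g. ennreal (G g) \<partial>?R)"
    by (simp add: nn_integral_cmult nn_integral_multc)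
  also have "(\<integral>\<^sup>+f. ennreal (F f) \<partial>?Q) = (\<integral>\<^sup>+f. ennreal (F f) \<partial>?P)"
    by (simp add: nn eF)
  also have "(\<integral>\<^sup>+f. ennreal (G f) \<partial>?R) = (\<integral>\<^sup>+f. ennreal (G f) \<partial>?P)"
    by (simp add: nn eG)
  finally have "(\<integral>\<^sup>+f. ennreal (F f * G f) \<partial>?P) = (\<integral>\<^sup>+f. ennreal (F f) \<partial>?P) * (\<integral>\<^sup>+f. ennreal (G f) \<partial>?P)" .
  then show ?thesis
    using F0 G0 by (simp add: nn_integral_eq_integral integrable_Pi_bool[OF A] Bochner_Integration.integral_nonneg ennreal_mult[symmetric])
qed

text \<open>Peel off one block at a time; by disjointness the product over the others does not see
  its coordinates.\<close>

lemma expectation_Pi_bool_prod: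
  fixes F :: "'j \<Rightarrow> ('a \<Rightarrow> bool) \<Rightarrow> real"
  assumes A: "finite A" and J: "finite J" and B: "\<And>j. j \<in> J \<Longrightarrow> B j \<subseteq> A" and disj: "disjoint_family_on B J"
    and F: "\<And>j f g. j \<in> J \<Longrightarrow> (\<And>e. e \<in> B j \<Longrightarrow> f e = g e) \<Longrightarrow> F j f = F j g"
    and F0: "\<And>j f. 0 \<le> F j f"
  shows "measure_pmf.expectation (Pi_pmf A d p) (\<lambda>f. \<Prod>j\<in>J. F j f)
    = (\<Prod>j\<in>J. measure_pmf.expectation (Pi_pmf A d p) (F j))"
  using J B disj F
proof (induction J rule: finite_induct)
  case (insert j J)
  have "measure_pmf.expectation (Pi_pmf A d p) (\<lambda>f. F j f * (\<Prod>j\<in>J. F j f))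
    = measure_pmf.expectation (Pi_pmf A d p) (F j) * measure_pmf.expectation (Pi_pmf A d p) (\<lambda>f. \<Prod>j\<in>J. F j f)"
  proof (rule expectation_Pi_bool_indep[OF A, of "B j"])
    fix f g :: "'a \<Rightarrow> bool" assume fg: "\<And>e. e \<notin> B j \<Longrightarrow> f e = g e"
    have "F k f = F k g" if k: "k \<in> J" for k
    proof (rule insert.prems(3))
      fix e assume "e \<in> B k"
      moreover have "B j \<inter> B k = {}"
        using insert.prems(2) insert.hyps(2) k by (auto simp: disjoint_family_on_def)
      ultimately show "f e = g e" by (intro fg) auto
    qed (use k in auto)
    then show "(\<Prod>j\<in>J. F j f) = (\<Prod>j\<in>J. F j g)" by (intro prod.cong) auto
  next
    show "B j \<subseteq> A" by (rule insert.prems(1)) simp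
    show "F j f = F j g" if "\<And>e. e \<in> B j \<Longrightarrow> f e = g e" for f g by (rule insert.prems(3)[OF _ that]) auto
    show "0 \<le> F j f" for f by (rule F0)
    show "0 \<le> (\<Prod>j\<in>J. F j f)" for f by (intro prod_nonneg F0)
  qed
  moreover have "measure_pmf.expectation (Pi_pmf A d p) (\<lambda>f. \<Prod>j\<in>J. F j f)
    = (\<Prod>j\<in>J. measure_pmf.expectation (Pi_pmf A d p) (F j))"
  proof (rule insert.IH)
    show "B k \<subseteq> A" if "k \<in> J" for k using that by (intro insert.prems(1)) simp
    show "disjoint_family_on B J" using insert.prems(2) by (auto simp: disjoint_family_on_def)
    show "F k f = F k g" if "k \<in> J" "\<And>e. e \<in> B k \<Longrightarrow> f e = g e" for k f g
      by (rule insert.prems(3)[OF _ that(2)]) (use that in auto)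
  qed
  ultimately show ?case using insert.hyps by simp
qed simp

lemma prob_union_bound:
  assumes "finite I" "\<And>i. i \<in> I \<Longrightarrow> measure_pmf.prob M (B i) \<le> b i"
  shows "measure_pmf.prob M (\<Union>i\<in>I. B i) \<le> (\<Sum>i\<in>I. b i)"
  by (rule order_trans[OF measure_pmf.finite_measure_subadditive_finite sum_mono]) (use assms in auto)

text \<open>Two-stage sampling: \<open>Y\<close> collects the exceptional first-stage outcomes,
  where the conditional probability is bounded trivially, and \<open>b\<close> is uniform
  elsewhere.\<close>

lemma prob_bind_le:
  assumes "\<And>x. x \<in> set_pmf M \<Longrightarrow> measure_pmf.prob (N x) X \<le> b + indicator Y x" "0 \<le> b"
  shows "measure_pmf.prob (bind_pmf M N) X \<le> b + measure_pmf.prob M Y"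
proof -
  have "emeasure (bind_pmf M N) X = (\<integral>\<^sup>+x. emeasure (N x) X \<partial>M)" by simp
  also have "\<dots> \<le> (\<integral>\<^sup>+x. ennreal b + indicator Y x \<partial>M)"
  proof (intro nn_integral_mono_AE AE_pmfI)
    fix x assume "x \<in> set_pmf M"
    then have "ennreal (measure_pmf.prob (N x) X) \<le> ennreal (b + indicator Y x)" by (intro ennreal_leI assms)
    also have "\<dots> = ennreal b + indicator Y x" using assms(2) by (simp add: ennreal_indicator)
    finally show "emeasure (N x) X \<le> ennreal b + indicator Y x" by (simp add: measure_pmf.emeasure_eq_measure)
  qed
  also have "\<dots> = ennreal b + emeasure M Y"
    by (simp add: nn_integral_add)
  also have "\<dots> = ennreal (b + measure_pmf.prob M Y)"
    using assms(2) by (simp add: measure_pmf.emeasure_eq_measure ennreal_plus)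
  finally show ?thesis
    using assms(2) unfolding measure_pmf.emeasure_eq_measure by (subst (asm) ennreal_le_iff) auto
qed

lemma prob_Pi_bool_condition:
  assumes A: "finite A" "finite B" "A \<inter> B = {}"
    and le: "\<And>f. measure_pmf.prob (Pi_pmf B d p) {g. (\<lambda>x. if x \<in> A then f x else g x) \<in> X} \<le> b"
  shows "measure_pmf.prob (Pi_pmf (A \<union> B) d p) X \<le> b"
proof -
  let ?h = "\<lambda>(f, g) x. if x \<in> A then f x else g x"
  have b0: "b \<ge> 0" by (rule order_trans[OF measure_nonneg le])
  have "Pi_pmf (A \<union> B) d p = bind_pmf (Pi_pmf A d p) (\<lambda>f. map_pmf (\<lambda>g x. if x \<in> A then f x else g x) (Pi_pmf B d p))"
    by (subst Pi_pmf_union[OF A]) (simp add: pair_pmf_def map_bind_pmf, simp add: map_pmf_def)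
  moreover have "measure_pmf.prob \<dots> X \<le> b + measure_pmf.prob (Pi_pmf A d p) {}"
    using le b0 by (intro prob_bind_le) (auto simp: vimage_def)
  ultimately show ?thesis by simp
qed

section \<open>Spectral norm of the trimmed weighted graph\<close>

subsection \<open>Heavy pairs\<close>

text \<open>The logarithm of (e n / s)^s, the usual upper estimate for the binomial
  coefficient.\<close>

definition entropy_bound :: "nat \<Rightarrow> nat \<Rightarrow> real" where
  "entropy_bound n s = real s * (1 + ln (real n / real s))"

text \<open>The Chernoff exponent for a block on which x y is about 2^N. The floor 1 keeps it usable
  as a divisor where x y barely exceeds Q.\<close>

definition tilt :: "real \<Rightarrow> nat \<Rightarrow> real" where
  "tilt Q N = max 1 (ln (2 ^ N / Q))"

text \<open>The guard on positivity matters: \<open>floor_log 0 = 0\<close> would put vanishing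
  coordinates into level 0.\<close>

definition level :: "nat \<Rightarrow> (nat \<Rightarrow> nat) \<Rightarrow> nat \<Rightarrow> nat set" where
  "level n x a = {i. i < n \<and> 0 < x i \<and> floor_log (x i) = a}"

lemma level_bounds:
  assumes "i \<in> level n x a"
  shows "2 ^ a \<le> real (x i)" "real (x i) \<le> 2 * 2 ^ a"
proof -
  have "2 ^ a \<le> x i" "x i < 2 * 2 ^ a"
    using assms floor_log_exp2_le[of "x i"] floor_log_exp2_gt[of "x i"] by (auto simp: level_def)
  then have "real (2 ^ a) \<le> real (x i)" "real (x i) \<le> real (2 * 2 ^ a)" by (simp_all only: of_nat_le_iff)
  then show "2 ^ a \<le> real (x i)" "real (x i) \<le> 2 * 2 ^ a" by simp_all
qed

lemma power_four: "(4::real) ^ b = 2 ^ b * 2 ^ b"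
  by (simp flip: power_mult_distrib)

text \<open>A geometric series of ratio sqrt 2 is controlled by the first term beyond it, which here
  is at most sqrt 2.\<close>

lemma geometric_sqrt_sum:
  fixes Y :: real
  assumes "Y > 0" "finite I" "\<And>a. a \<in> I \<Longrightarrow> 2 ^ a < Y"
  shows "(\<Sum>a\<in>I. sqrt (2 ^ a / Y)) \<le> 4"
proof (cases "I = {}")
  case False
  define K where "K = Suc (Max I)"
  have "2 ^ Max I < Y" using assms False by simp
  then have K: "2 ^ K / Y \<le> 2" using assms by (simp add: K_def divide_simps)
  \<comment> \<open>5/2 is the solution of x + 1 = (7/5) x, with 7/5 as a lower bound for sqrt
    2.\<close>
  have pre: "(\<Sum>a<k. sqrt (2 ^ a / Y)) \<le> (5/2) * sqrt (2 ^ k / Y)" for k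
  proof (induction k)
    case (Suc k)
    have "(7/5)\<^sup>2 \<le> (2::real)" by (simp add: power2_eq_square)
    then have s2: "7/5 \<le> sqrt 2" by (rule real_le_rsqrt)
    have "sqrt (2 ^ Suc k / Y) = sqrt 2 * sqrt (2 ^ k / Y)" by (simp flip: real_sqrt_mult)
    moreover have "7/5 * sqrt (2 ^ k / Y) \<le> sqrt 2 * sqrt (2 ^ k / Y)"
      using s2 assms by (intro mult_right_mono) auto
    ultimately show ?case using Suc by simp
  qed (use assms in simp)
  have "(\<Sum>a\<in>I. sqrt (2 ^ a / Y)) \<le> (\<Sum>a<K. sqrt (2 ^ a / Y))"
    using assms by (intro sum_mono2) (auto simp: K_def less_Suc_eq_le)
  also have "\<dots> \<le> (5/2) * sqrt (2 ^ K / Y)" by (rule pre)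
  also have "\<dots> \<le> (5/2) * sqrt 2" using K by simp
  also have "\<dots> \<le> (5/2) * (3/2)" by (intro mult_left_mono real_le_lsqrt) (auto simp: power2_eq_square)
  finally show ?thesis by simp
qed simp

lemma ln4_bounds: "1 \<le> ln (4::real)" "ln (4::real) \<le> 2"
proof -
  have "exp (1::real) \<le> 4" using exp_le by simp
  then show "1 \<le> ln (4::real)" by (simp add: ln_ge_iff)
  have "ln (4::real) = 2 * ln 2" using ln_realpow[of "2::real" 2] by simp
  then show "ln (4::real) \<le> 2" using ln_le_minus_one[of "2::real"] by simp
qed

lemma mult_ln_inverse_le:
  fixes x :: real
  assumes "0 < x"
  shows "x * ln (1 / x) \<le> 2 * sqrt x"
proof -
  have "ln (1 / x) = 2 * ln (sqrt (1 / x))" using assms by (simp add: ln_sqrt)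
  also have "\<dots> \<le> 2 * sqrt (1 / x)" using assms ln_le_minus_one[of "sqrt (1 / x)"] by simp
  finally have "x * ln (1 / x) \<le> x * (2 * sqrt (1 / x))" using assms by (intro mult_left_mono) auto
  also have "\<dots> = 2 * (x / sqrt x)" by (simp add: real_sqrt_divide)
  also have "\<dots> = 2 * sqrt x" using assms by (simp only: real_div_sqrt less_imp_le)
  finally show ?thesis .
qed

text \<open>Write \<beta> for the share 4^b s / n, so that ln (n / s) = b ln 4 + ln (1 / \<beta>).
  If \<beta> is at least 4^(-b), the second logarithm is dominated by the first; otherwise \<beta>
  ln (1 / \<beta>) is at most 2 sqrt \<beta>, hence at most 2 / 2^b. The summand 1 / 2^b is thus a
  summable price for levels of tiny mass.\<close>

lemma entropy_level_bound:
  fixes s n b :: nat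
  assumes "0 < n" "0 < s"
  shows "4 ^ b * entropy_bound n s / real n \<le> 4 * (1 + real b) * (4 ^ b * real s / real n + 1 / 2 ^ b)"
proof -
  define \<beta> where "\<beta> = 4 ^ b * real s / real n"
  have bp: "\<beta> > 0" using assms by (simp add: \<beta>_def)
  have r: "real n / real s = 4 ^ b * (1 / \<beta>)" using assms by (simp add: \<beta>_def)
  have L: "ln (real n / real s) = real b * ln 4 + ln (1 / \<beta>)"
    unfolding r using bp by (subst ln_mult) (simp_all add: ln_realpow)
  have b4: "real b * ln 4 \<le> real b * 2" using ln4_bounds by (intro mult_left_mono) auto
  have E: "4 ^ b * entropy_bound n s / real n = \<beta> * (1 + real b * ln 4 + ln (1 / \<beta>))"
    unfolding entropy_bound_def L by (simp add: \<beta>_def)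
  have "\<beta> * (1 + real b * ln 4 + ln (1 / \<beta>)) \<le> 4 * (1 + real b) * (\<beta> + 1 / 2 ^ b)"
  proof (cases "1 / 4 ^ b \<le> \<beta>")
    case True
    then have "1 / \<beta> \<le> 4 ^ b" using bp by (simp add: divide_simps mult.commute)
    then have "ln (1 / \<beta>) \<le> real b * ln 4" using bp by (simp add: ln_realpow[symmetric])
    then have "\<beta> * (1 + real b * ln 4 + ln (1 / \<beta>)) \<le> \<beta> * (4 * (1 + real b))"
      using b4 bp by (intro mult_left_mono) auto
    also have "\<dots> \<le> 4 * (1 + real b) * (\<beta> + 1 / 2 ^ b)" by (simp add: algebra_simps)
    finally show ?thesis .
  next
    case False
    have s: "sqrt (1 / 4 ^ b) = 1 / (2::real) ^ b"
      by (simp add: power_four real_sqrt_divide)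
    have "\<beta> * ln (1 / \<beta>) \<le> 2 * (1 / 2 ^ b)"
      using mult_ln_inverse_le[OF bp] False s real_sqrt_le_mono[of \<beta> "1 / 4 ^ b"] by linarith
    moreover have "\<beta> * (1 + real b * ln 4) \<le> (1 / 2 ^ b) * (1 + 2 * real b)"
    proof (rule mult_mono)
      have "(1::real) / 4 ^ b \<le> 1 / 2 ^ b" by (intro divide_left_mono power_mono) auto
      then show "\<beta> \<le> 1 / 2 ^ b" using False by linarith
      show "1 + real b * ln 4 \<le> 1 + 2 * real b" using b4 by simp
      show "0 \<le> 1 + real b * ln 4" using ln4_bounds by simp
    qed simp
    ultimately have "\<beta> * (1 + real b * ln 4 + ln (1 / \<beta>)) \<le> (1 / 2 ^ b) * (3 + 2 * real b)"
      by (simp add: algebra_simps)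
    also have "\<dots> \<le> (1 / 2 ^ b) * (4 * (1 + real b))" by (intro mult_left_mono) auto
    also have "\<dots> \<le> 4 * (1 + real b) * (\<beta> + 1 / 2 ^ b)" using bp by (simp add: algebra_simps)
    finally show ?thesis .
  qed
  then show ?thesis unfolding E by (simp add: \<beta>_def)
qed

text \<open>With A = 2^a / (Q 2^b) = exp (- y) the tilt is max 1 (b ln 4 - y). Either y is small and
  the tilt is of order 1 + b, which cancels the entropy factor, or y is of order b and half of the
  decay of A pays for it. The other half, sqrt A, is kept for the sum over a.\<close>

lemma tilt_compensates_level:
  fixes a b :: nat and Q :: real
  assumes Q: "Q > 0" and lt: "2 ^ a < Q * 2 ^ b"
  shows "2 ^ a / 2 ^ b * (1 + real b) / tilt Q (a + b) \<le> 4 * Q * sqrt (2 ^ a / (Q * 2 ^ b))"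
proof -
  define A where "A = 2 ^ a / (Q * 2 ^ b)"
  have A: "0 < A" "A < 1" using Q lt by (auto simp: A_def)
  define y where "y = - ln A"
  have y: "y > 0" using A by (simp add: y_def)
  have "ln (2 ^ (a + b) / Q) = ln (A * 4 ^ b)"
  proof -
    have "2 ^ (a + b) / Q = A * 4 ^ b" using Q by (simp add: A_def power_add power_four)
    then show ?thesis by simp
  qed
  also have "\<dots> = real b * ln 4 - y" using A by (simp add: ln_mult ln_realpow y_def)
  finally have t: "tilt Q (a + b) = max 1 (real b * ln 4 - y)" by (simp add: tilt_def)
  define V where "V = exp (y / 2) * tilt Q (a + b)"
  have t1: "tilt Q (a + b) \<ge> 1" by (simp add: tilt_def)
  have e1: "exp (y / 2) \<ge> 1 + y / 2" by (rule exp_ge_add_one_self)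
  have V1: "V \<ge> 1 + y / 2" unfolding V_def using e1 t1 y mult_mono[of "1 + y/2" "exp (y/2)" 1 "tilt Q (a+b)"] by simp
  have V2: "V \<ge> tilt Q (a + b)" unfolding V_def using e1 t1 y mult_right_mono[of 1 "exp (y/2)" "tilt Q (a+b)"] by simp
  have "real b \<le> real b * ln 4" using ln4_bounds mult_left_mono[of 1 "ln 4" "real b"] by simp
  then have "1 + real b \<le> 4 * V" using V1 V2 y unfolding t by linarith
  moreover have "sqrt A = exp (- y / 2)"
  proof (rule real_sqrt_unique)
    show "(exp (- y / 2))\<^sup>2 = A" using A by (simp add: y_def power2_eq_square flip: exp_add)
  qed simp
  ultimately have "sqrt A * (1 + real b) \<le> exp (- y / 2) * (4 * V)" by simp
  also have "\<dots> = 4 * tilt Q (a + b)" by (simp add: V_def exp_minus)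
  finally have "sqrt A * (1 + real b) / tilt Q (a + b) \<le> 4" using t1 by (simp add: divide_le_eq)
  then have "(Q * sqrt A) * (sqrt A * (1 + real b) / tilt Q (a + b)) \<le> (Q * sqrt A) * 4"
    using Q A by (intro mult_left_mono) auto
  moreover have "(Q * sqrt A) * (sqrt A * (1 + real b) / tilt Q (a + b)) = (Q * (sqrt A * sqrt A)) * (1 + real b) / tilt Q (a + b)"
    by simp
  moreover have "Q * (sqrt A * sqrt A) = 2 ^ a / 2 ^ b"
    using A(1) Q unfolding real_sqrt_mult_self by (simp add: A_def)
  ultimately have "2 ^ a / 2 ^ b * (1 + real b) / tilt Q (a + b) \<le> (Q * sqrt A) * 4" by (simp only:)
  then show ?thesis by (simp add: A_def mult_ac)
qed

lemma sum_level_weights: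
  assumes "(\<Sum>i<n. (real (x i))\<^sup>2) \<le> 4 * real n" "0 < n" "finite I"
  shows "(\<Sum>a\<in>I. 4 ^ a * real (card (level n x a)) / real n) \<le> 4"
proof -
  have fin: "finite (level n x a)" for a by (simp add: level_def)
  have "(\<Sum>a\<in>I. 4 ^ a * real (card (level n x a))) \<le> (\<Sum>a\<in>I. \<Sum>i\<in>level n x a. (real (x i))\<^sup>2)"
  proof (rule sum_mono)
    fix a
    have "4 ^ a * real (card (level n x a)) = (\<Sum>i\<in>level n x a. (2 ^ a)\<^sup>2)"
      by (simp add: power2_eq_square flip: power_mult_distrib)
    also have "\<dots> \<le> (\<Sum>i\<in>level n x a. (real (x i))\<^sup>2)"
      by (intro sum_mono power_mono level_bounds) auto
    finally show "4 ^ a * real (card (level n x a)) \<le> (\<Sum>i\<in>level n x a. (real (x i))\<^sup>2)" .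
  qed
  also have "\<dots> = (\<Sum>i\<in>(\<Union>a\<in>I. level n x a). (real (x i))\<^sup>2)"
    using assms fin by (intro sum.UNION_disjoint[symmetric]) (auto simp: level_def)
  also have "\<dots> \<le> (\<Sum>i<n. (real (x i))\<^sup>2)" by (rule sum_mono2) (auto simp: level_def)
  also have "\<dots> \<le> 4 * real n" by (rule assms)
  finally show ?thesis using assms by (simp add: sum_divide_distrib[symmetric] divide_le_eq)
qed

lemma sum_inverse_powers: "finite I \<Longrightarrow> (\<Sum>b\<in>I. 1 / (2::real) ^ b) \<le> 2"
proof -
  assume I: "finite I"
  have "(\<Sum>b\<in>I. 1 / (2::real) ^ b) = (\<Sum>b\<in>I. (1/2) ^ b)" by (simp add: power_divide)
  also have "\<dots> \<le> (\<Sum>b. (1/2) ^ b)" using I by (intro sum_le_suminf) (auto intro: summable_geometric)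
  also have "\<dots> = 2" by (simp add: suminf_geometric)
  finally show ?thesis .
qed

text \<open>After \<open>entropy_level_bound\<close> and \<open>tilt_compensates_level\<close> the
  sum over a is geometric, at most 4, and the shares sum over b to at most 4 + 2; hence 64 * 24 =
  1536. The pairs are reordered so that a runs inside.\<close>

lemma entropy_terms_sum:
  fixes Q R :: real and x :: "nat \<Rightarrow> nat"
  assumes n: "0 < n" and Q: "Q > 0" and R: "R \<ge> 0" and x: "(\<Sum>i<n. (real (x i))\<^sup>2) \<le> 4 * real n"
    and W: "finite W" "\<And>a b. (a, b) \<in> W \<Longrightarrow> 2 ^ a < Q * 2 ^ b \<and> level n x b \<noteq> {}"
  shows "(\<Sum>(a, b)\<in>W. 4 * 2 ^ (a + b) * (R * entropy_bound n (card (level n x b)) / tilt Q (a + b))) \<le> 1536 * R * real n * Q"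
proof -
  define \<beta> where "\<beta> b = 4 ^ b * real (card (level n x b)) / real n + 1 / 2 ^ b" for b
  have \<beta>0: "\<beta> b \<ge> 0" for b by (simp add: \<beta>_def)
  have trm: "4 * 2 ^ (a + b) * (R * entropy_bound n (card (level n x b)) / tilt Q (a + b))
      \<le> 64 * R * real n * Q * (\<beta> b * sqrt (2 ^ a / (Q * 2 ^ b)))" if ab: "(a, b) \<in> W" for a b
  proof -
    have t1: "tilt Q (a + b) \<ge> 1" by (simp add: tilt_def)
    have "card (level n x b) > 0" using W(2)[OF ab] by (simp add: card_gt_0_iff level_def)
    then have eb: "4 ^ b * entropy_bound n (card (level n x b)) / real n \<le> 4 * (1 + real b) * \<beta> b"
      unfolding \<beta>_def using n by (intro entropy_level_bound) auto
    have "(2::real) ^ (a + b) = 2 ^ a / 2 ^ b * 4 ^ b"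
      by (simp add: power_add power_four)
    then have "4 * 2 ^ (a + b) * (R * entropy_bound n (card (level n x b)) / tilt Q (a + b))
      = 4 * R * real n * (2 ^ a / 2 ^ b / tilt Q (a + b)) * (4 ^ b * entropy_bound n (card (level n x b)) / real n)"
      using n by simp
    also have "\<dots> \<le> 4 * R * real n * (2 ^ a / 2 ^ b / tilt Q (a + b)) * (4 * (1 + real b) * \<beta> b)"
      using R t1 by (intro mult_left_mono eb) auto
    also have "\<dots> = 16 * R * real n * \<beta> b * (2 ^ a / 2 ^ b * (1 + real b) / tilt Q (a + b))" by simp
    also have "\<dots> \<le> 16 * R * real n * \<beta> b * (4 * Q * sqrt (2 ^ a / (Q * 2 ^ b)))"
      using R \<beta>0 W(2)[OF ab] Q by (intro mult_left_mono tilt_compensates_level) auto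
    finally show ?thesis by (simp add: mult_ac)
  qed
  have "(\<Sum>(a, b)\<in>W. 4 * 2 ^ (a + b) * (R * entropy_bound n (card (level n x b)) / tilt Q (a + b)))
     \<le> (\<Sum>(a, b)\<in>W. 64 * R * real n * Q * (\<beta> b * sqrt (2 ^ a / (Q * 2 ^ b))))"
    using trm by (intro sum_mono) auto
  also have "\<dots> = 64 * R * real n * Q * (\<Sum>(a, b)\<in>W. \<beta> b * sqrt (2 ^ a / (Q * 2 ^ b)))"
    by (simp add: sum_distrib_left case_prod_unfold)
  also have "(\<Sum>(a, b)\<in>W. \<beta> b * sqrt (2 ^ a / (Q * 2 ^ b))) \<le> 24"
  proof -
    have fb: "finite (snd ` W)" and fa: "finite {a. (a, b) \<in> W}" for b
      using W(1) finite_subset[of "{a. (a, b) \<in> W}" "fst ` W"] by (auto simp: image_iff) force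
    have "bij_betw (\<lambda>(b, a). (a, b)) (Sigma (snd ` W) (\<lambda>b. {a. (a, b) \<in> W})) W"
      by (rule bij_betwI[where g = "\<lambda>(a, b). (b, a)"]) force+
    then have "(\<Sum>(a, b)\<in>W. \<beta> b * sqrt (2 ^ a / (Q * 2 ^ b)))
        = (\<Sum>(b, a)\<in>Sigma (snd ` W) (\<lambda>b. {a. (a, b) \<in> W}). \<beta> b * sqrt (2 ^ a / (Q * 2 ^ b)))"
      by (subst sum.reindex_bij_betw[symmetric]) (auto simp: case_prod_unfold)
    also have "\<dots> = (\<Sum>b\<in>snd ` W. \<Sum>a\<in>{a. (a, b) \<in> W}. \<beta> b * sqrt (2 ^ a / (Q * 2 ^ b)))"
      using fb fa by (subst sum.Sigma) auto
    also have "\<dots> \<le> (\<Sum>b\<in>snd ` W. \<beta> b * 4)"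
      unfolding sum_distrib_left[symmetric]
      using W fa Q by (intro sum_mono mult_left_mono geometric_sqrt_sum \<beta>0) auto
    also have "\<dots> = 4 * ((\<Sum>b\<in>snd ` W. 4 ^ b * real (card (level n x b)) / real n) + (\<Sum>b\<in>snd ` W. 1 / 2 ^ b))"
      by (simp only: \<beta>_def flip: sum.distrib) (simp add: sum_distrib_left mult.commute)
    also have "\<dots> \<le> 24" using sum_level_weights[OF x n fb] sum_inverse_powers[OF fb] by simp
    finally show ?thesis .
  qed
  then have "64 * R * real n * Q * (\<Sum>(a, b)\<in>W. \<beta> b * sqrt (2 ^ a / (Q * 2 ^ b))) \<le> 64 * R * real n * Q * 24"
    using R Q by (intro mult_left_mono) auto
  finally show ?thesis by simp
qed



text \<open>Deterministic: all partners of i satisfy y j \<le> 2 x i / Q, so row i contributes at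
  most 2 (x i)^2 / Q times its degree, and the degree bound together with the norm bound finishes.
  The factor 2 is lost to dyadic rounding.\<close>

lemma lopsided_pairs_bound:
  fixes X :: "nat \<Rightarrow> nat \<Rightarrow> real" and x y :: "nat \<Rightarrow> nat" and Q \<gamma> :: real
  assumes Q: "1 \<le> Q" and \<gamma>: "0 \<le> \<gamma>" and X0: "\<And>i j. 0 \<le> X i j"
    and x: "(\<Sum>i<n. (real (x i))\<^sup>2) \<le> 4 * real n"
    and degx: "\<And>i. i < n \<Longrightarrow> 0 < x i \<Longrightarrow> (\<Sum>j<n. X i j) \<le> \<gamma> * Q\<^sup>2"
  shows "(\<Sum>i<n. \<Sum>j<n. of_bool (0 < x i \<and> 0 < y j \<and> Q * 2 ^ floor_log (y j) \<le> 2 ^ floor_log (x i))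
            * (real (x i) * real (y j) * X i j)) \<le> 8 * \<gamma> * real n * Q"
proof -
  define h where "h i j = (0 < x i \<and> 0 < y j \<and> Q * 2 ^ floor_log (y j) \<le> 2 ^ floor_log (x i))" for i j
  have own: "i \<in> level n z (floor_log (z i))" if "i < n" "0 < z i" for i z using that by (simp add: level_def)
  have rat: "real (y j) \<le> 2 * real (x i) / Q" if "i < n" "j < n" "h i j" for i j
  proof -
    have "Q * real (y j) \<le> Q * (2 * 2 ^ floor_log (y j))"
      using Q level_bounds(2)[OF own[of j y]] that by (intro mult_left_mono) (auto simp: h_def)
    also have "\<dots> \<le> 2 * 2 ^ floor_log (x i)" using that by (simp add: h_def)
    also have "\<dots> \<le> 2 * real (x i)" using level_bounds(1)[OF own[of i x]] that by (simp add: h_def)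
    finally show ?thesis using Q by (simp add: le_divide_eq mult.commute)
  qed
  have "(\<Sum>i<n. \<Sum>j<n. of_bool (h i j) * (real (x i) * real (y j) * X i j)) \<le> (\<Sum>i<n. 2 * \<gamma> * Q * (real (x i))\<^sup>2)"
  proof (rule sum_mono)
    fix i assume i: "i \<in> {..<n}"
    show "(\<Sum>j<n. of_bool (h i j) * (real (x i) * real (y j) * X i j)) \<le> 2 * \<gamma> * Q * (real (x i))\<^sup>2"
    proof (cases "0 < x i")
      case True
      have "(\<Sum>j<n. of_bool (h i j) * (real (x i) * real (y j) * X i j)) \<le> (\<Sum>j<n. 2 * (real (x i))\<^sup>2 / Q * X i j)"
      proof (rule sum_mono)
        fix j assume j: "j \<in> {..<n}"
        show "of_bool (h i j) * (real (x i) * real (y j) * X i j) \<le> 2 * (real (x i))\<^sup>2 / Q * X i j"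
        proof (cases "h i j")
          case True
          then have "real (x i) * real (y j) * X i j \<le> real (x i) * (2 * real (x i) / Q) * X i j"
            using i j X0 by (intro mult_right_mono mult_left_mono rat) auto
          then show ?thesis using True by (simp add: power2_eq_square algebra_simps)
        qed (use Q X0 in simp)
      qed
      also have "\<dots> = 2 * (real (x i))\<^sup>2 / Q * (\<Sum>j<n. X i j)" by (simp only: sum_distrib_left)
      also have "\<dots> \<le> 2 * (real (x i))\<^sup>2 / Q * (\<gamma> * Q\<^sup>2)"
        using Q i True by (intro mult_left_mono degx) auto
      also have "\<dots> = 2 * \<gamma> * Q * (real (x i))\<^sup>2" using Q by (simp add: power2_eq_square)
      finally show ?thesis .
    qed (simp add: h_def)
  qed
  also have "\<dots> = (2 * \<gamma> * Q) * (\<Sum>i<n. (real (x i))\<^sup>2)" by (simp only: sum_distrib_left)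
  also have "\<dots> \<le> (2 * \<gamma> * Q) * (4 * real n)" using x \<gamma> Q by (intro mult_left_mono) auto
  also have "\<dots> = 8 * \<gamma> * real n * Q" by simp
  finally show ?thesis unfolding h_def .
qed

text \<open>Keeps N = a + b within 0..2n, so that the discrepancy event is a finite union. A larger
  level would give a square of at least 4^(n+1), more than the norm permits.\<close>

lemma floor_log_le:
  assumes "(\<Sum>i<n. (real (x i))\<^sup>2) \<le> 4 * real n" "i < n" "0 < x i"
  shows "floor_log (x i) \<le> n"
proof (rule ccontr)
  assume "\<not> floor_log (x i) \<le> n"
  then have "2 ^ Suc n \<le> (2::nat) ^ floor_log (x i)" by (intro power_increasing) auto
  also have "\<dots> \<le> x i" using assms by (intro floor_log_exp2_le) auto
  finally have "real (2 ^ Suc n) \<le> real (x i)" by (simp only: of_nat_le_iff)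
  then have "(2 ^ Suc n)\<^sup>2 \<le> (real (x i))\<^sup>2" by (intro power_mono) auto
  also have "\<dots> \<le> (\<Sum>i<n. (real (x i))\<^sup>2)" using assms(2) by (intro member_le_sum) auto
  also have "\<dots> \<le> 4 * real n" by (rule assms)
  finally have "4 ^ n \<le> real n" by (simp add: power2_eq_square power_four)
  moreover have "n < 4 ^ n" by (rule less_exp[THEN less_le_trans]) (simp add: power_mono)
  then have "real n < 4 ^ n" by (metis of_nat_less_iff of_nat_numeral of_nat_power)
  ultimately show False by linarith
qed

text \<open>Feige--Ofek: pairs with \<open>x i / y j\<close> outside \<open>[1/Q, Q]\<close> are controlled by the degrees; on the
  remaining dyadic blocks \<open>S \<times> T\<close> the tilt \<open>\<theta>\<close> in the discrepancy bound is chosen such that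
  \<open>exp \<theta>\<close> is about \<open>x i * y j / Q\<close>.\<close>

lemma heavy_pairs_bound:
  fixes X :: "nat \<Rightarrow> nat \<Rightarrow> real" and x y :: "nat \<Rightarrow> nat" and Q R \<gamma> :: real
  assumes n: "0 < n" and Q: "1 \<le> Q" and R: "0 \<le> R" and \<gamma>: "0 \<le> \<gamma>" and X0: "\<And>i j. 0 \<le> X i j"
    and x: "(\<Sum>i<n. (real (x i))\<^sup>2) \<le> 4 * real n" and y: "(\<Sum>i<n. (real (y i))\<^sup>2) \<le> 4 * real n"
    and degx: "\<And>i. i < n \<Longrightarrow> 0 < x i \<Longrightarrow> (\<Sum>j<n. X i j) \<le> \<gamma> * Q\<^sup>2"
    and degy: "\<And>j. j < n \<Longrightarrow> 0 < y j \<Longrightarrow> (\<Sum>i<n. X i j) \<le> \<gamma> * Q\<^sup>2"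
    and disc: "\<And>S T N. S \<subseteq> {..<n} \<Longrightarrow> T \<subseteq> {..<n} \<Longrightarrow> S \<noteq> {} \<Longrightarrow> T \<noteq> {} \<Longrightarrow> N \<le> 2 * n \<Longrightarrow>
       tilt Q N * (\<Sum>i\<in>S. \<Sum>j\<in>T. X i j)
         \<le> Q\<^sup>2 / real n * (real (card S) * real (card T)) * exp (tilt Q N)
            + R * (entropy_bound n (card S) + entropy_bound n (card T))"
  shows "(\<Sum>i<n. \<Sum>j<n. of_bool (0 < x i \<and> 0 < y j \<and> Q < 2 ^ (floor_log (x i) + floor_log (y j)))
            * (real (x i) * real (y j) * X i j)) \<le> (16 * \<gamma> + 192 + 3072 * R) * real n * Q"
proof -
  define t where "t i j = real (x i) * real (y j) * X i j" for i j
  have t0: "t i j \<ge> 0" for i j by (simp add: t_def X0)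
  define hA where "hA i j = (0 < x i \<and> 0 < y j \<and> Q * 2 ^ floor_log (y j) \<le> 2 ^ floor_log (x i))" for i j
  define hB where "hB i j = (0 < y j \<and> 0 < x i \<and> Q * 2 ^ floor_log (x i) \<le> 2 ^ floor_log (y j))" for i j
  define bal where "bal a b = (Q < 2 ^ (a + b) \<and> 2 ^ a < Q * 2 ^ b \<and> 2 ^ b < Q * 2 ^ a)" for a b :: nat
  define hC where "hC i j = (0 < x i \<and> 0 < y j \<and> bal (floor_log (x i)) (floor_log (y j)))" for i j
  have A: "(\<Sum>i<n. \<Sum>j<n. of_bool (hA i j) * t i j) \<le> 8 * \<gamma> * real n * Q"
    unfolding hA_def t_def by (rule lopsided_pairs_bound[OF Q \<gamma> X0 x degx])
  have B: "(\<Sum>i<n. \<Sum>j<n. of_bool (hB i j) * t i j) \<le> 8 * \<gamma> * real n * Q"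
  proof -
    have "(\<Sum>i<n. \<Sum>j<n. of_bool (hB i j) * t i j) = (\<Sum>j<n. \<Sum>i<n. of_bool (hB i j) * t i j)" by (rule sum.swap)
    also have "\<dots> = (\<Sum>j<n. \<Sum>i<n. of_bool (hB i j) * (real (y j) * real (x i) * X i j))"
      by (simp only: t_def mult.commute[of "real (x _)" "real (y _)"])
    also have "\<dots> \<le> 8 * \<gamma> * real n * Q"
      unfolding hB_def by (rule lopsided_pairs_bound[where X = "\<lambda>j i. X i j", OF Q \<gamma> X0 y degy])
    finally show ?thesis .
  qed
  define W where "W = {(a, b). a \<le> n \<and> b \<le> n \<and> bal a b \<and> level n x a \<noteq> {} \<and> level n y b \<noteq> {}}"
  have Wf: "finite W" by (rule finite_subset[of _ "{..n} \<times> {..n}"]) (auto simp: W_def)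
  define s where "s a = real (card (level n x a))" for a
  define u where "u b = real (card (level n y b))" for b
  have C: "(\<Sum>i<n. \<Sum>j<n. of_bool (hC i j) * t i j) \<le> (192 + 3072 * R) * real n * Q"
  proof -
    define P where "P = {(i, j). i < n \<and> j < n \<and> hC i j}"
    have Pf: "finite P" by (rule finite_subset[of _ "{..<n} \<times> {..<n}"]) (auto simp: P_def)
    have "(\<Sum>i<n. \<Sum>j<n. of_bool (hC i j) * t i j) = (\<Sum>(i, j)\<in>{..<n} \<times> {..<n}. of_bool (hC i j) * t i j)"
      by (rule sum.cartesian_product)
    also have "\<dots> = (\<Sum>(i, j)\<in>P. t i j)"
      by (rule sum.mono_neutral_cong_right) (auto simp: P_def)
    also have "\<dots> = (\<Sum>w\<in>W. \<Sum>(i, j)\<in>{p \<in> P. (floor_log (x (fst p)), floor_log (y (snd p))) = w}. t i j)"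
      using floor_log_le[OF x] floor_log_le[OF y]
      by (intro sum.group[symmetric] Pf Wf) (auto simp: P_def W_def hC_def level_def)
    also have "\<dots> \<le> (\<Sum>(a, b)\<in>W. 12 * Q * real n * ((4 ^ a * s a / real n) * (4 ^ b * u b / real n))
        + (4 * 2 ^ (a + b) * (R * entropy_bound n (card (level n x a)) / tilt Q (a + b))
        + 4 * 2 ^ (a + b) * (R * entropy_bound n (card (level n y b)) / tilt Q (a + b))))"
    proof (rule sum_mono, clarify)
      fix a b assume ab: "(a, b) \<in> W"
      define \<theta> where "\<theta> = tilt Q (a + b)"
      define e where "e = (\<Sum>i\<in>level n x a. \<Sum>j\<in>level n y b. X i j)"
      have \<theta>1: "\<theta> \<ge> 1" by (simp add: \<theta>_def tilt_def)
      have h: "Q < 2 ^ (a + b)" using ab by (simp add: W_def bal_def)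
      \<comment> \<open>The factor 3 covers the clipped case, where exp \<theta> = e while 2^(a+b) /
        Q is only known to be at least 1.\<close>
      have e\<theta>: "exp \<theta> \<le> 3 * (2 ^ (a + b) / Q)"
      proof -
        have g: "2 ^ (a + b) / Q \<ge> 1" using h Q by simp
        show ?thesis
        proof (cases "ln (2 ^ (a + b) / Q) \<le> 1")
          case True
          then have "exp \<theta> = exp 1" by (simp add: \<theta>_def tilt_def)
          then show ?thesis using exp_le g by linarith
        next
          case False
          then have "exp \<theta> = 2 ^ (a + b) / Q" using Q by (simp add: \<theta>_def tilt_def max_def)
          then show ?thesis using g by linarith
        qed
      qed
      have "\<theta> * e \<le> Q\<^sup>2 / real n * (s a * u b) * exp \<theta> + R * (entropy_bound n (card (level n x a)) + entropy_bound n (card (level n y b)))"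
        unfolding \<theta>_def e_def s_def u_def using ab by (intro disc) (auto simp: W_def level_def)
      then have "e \<le> (Q\<^sup>2 / real n * (s a * u b) * exp \<theta> + R * (entropy_bound n (card (level n x a)) + entropy_bound n (card (level n y b)))) / \<theta>"
        using \<theta>1 by (simp add: le_divide_eq mult.commute)
      also have "\<dots> = Q\<^sup>2 / real n * (s a * u b) * exp \<theta> / \<theta> + (R * entropy_bound n (card (level n x a)) / \<theta> + R * entropy_bound n (card (level n y b)) / \<theta>)"
        by (simp add: add_divide_distrib distrib_left)
      also have "Q\<^sup>2 / real n * (s a * u b) * exp \<theta> / \<theta> \<le> Q\<^sup>2 / real n * (s a * u b) * (3 * (2 ^ (a + b) / Q)) / 1"
        using e\<theta> \<theta>1 Q n by (intro frac_le mult_left_mono) (auto simp: s_def u_def)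
      finally have e: "e \<le> Q\<^sup>2 / real n * (s a * u b) * (3 * (2 ^ (a + b) / Q)) + (R * entropy_bound n (card (level n x a)) / \<theta> + R * entropy_bound n (card (level n y b)) / \<theta>)"
        by simp
      have "{p \<in> P. (floor_log (x (fst p)), floor_log (y (snd p))) = (a, b)} = level n x a \<times> level n y b"
        using ab by (auto simp: P_def hC_def level_def W_def)
      then have "(\<Sum>(i, j)\<in>{p \<in> P. (floor_log (x (fst p)), floor_log (y (snd p))) = (a, b)}. t i j)
          = (\<Sum>i\<in>level n x a. \<Sum>j\<in>level n y b. t i j)" by (simp add: sum.cartesian_product)
      also have "\<dots> \<le> (\<Sum>i\<in>level n x a. \<Sum>j\<in>level n y b. (4 * 2 ^ (a + b)) * X i j)"
      proof (intro sum_mono)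
        fix i j assume ij: "i \<in> level n x a" "j \<in> level n y b"
        have "real (x i) * real (y j) \<le> (2 * 2 ^ a) * (2 * 2 ^ b)"
          using level_bounds(2)[OF ij(1)] level_bounds(2)[OF ij(2)] by (intro mult_mono) auto
        then show "t i j \<le> (4 * 2 ^ (a + b)) * X i j"
          unfolding t_def by (intro mult_right_mono X0) (simp add: power_add)
      qed
      also have "\<dots> = 4 * 2 ^ (a + b) * e" by (simp only: e_def sum_distrib_left)
      also have "\<dots> \<le> 4 * 2 ^ (a + b) * (Q\<^sup>2 / real n * (s a * u b) * (3 * (2 ^ (a + b) / Q)) + (R * entropy_bound n (card (level n x a)) / \<theta> + R * entropy_bound n (card (level n y b)) / \<theta>))"
        using e by (intro mult_left_mono) auto
      also have "\<dots> = 4 * 2 ^ (a + b) * (Q\<^sup>2 / real n * (s a * u b) * (3 * (2 ^ (a + b) / Q))) + (4 * 2 ^ (a + b) * (R * entropy_bound n (card (level n x a)) / \<theta>) + 4 * 2 ^ (a + b) * (R * entropy_bound n (card (level n y b)) / \<theta>))"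
        by (simp only: distrib_left)
      also have "4 * 2 ^ (a + b) * (Q\<^sup>2 / real n * (s a * u b) * (3 * (2 ^ (a + b) / Q))) = 12 * Q * real n * ((4 ^ a * s a / real n) * (4 ^ b * u b / real n))"
        using Q n by (simp add: power_four power_add power2_eq_square)
      finally show "(\<Sum>(i, j)\<in>{p \<in> P. (floor_log (x (fst p)), floor_log (y (snd p))) = (a, b)}. t i j)
          \<le> 12 * Q * real n * ((4 ^ a * s a / real n) * (4 ^ b * u b / real n))
        + (4 * 2 ^ (a + b) * (R * entropy_bound n (card (level n x a)) / tilt Q (a + b))
        + 4 * 2 ^ (a + b) * (R * entropy_bound n (card (level n y b)) / tilt Q (a + b)))"
        unfolding \<theta>_def .
    qed
    \<comment> \<open>The mean part factorises into level shares and gives 12 * 4 * 4 = 192; the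
      entropy parts of rows and columns give 1536 each.\<close>
    also have "\<dots> = 12 * Q * real n * (\<Sum>(a, b)\<in>W. (4 ^ a * s a / real n) * (4 ^ b * u b / real n))
        + ((\<Sum>(a, b)\<in>W. 4 * 2 ^ (a + b) * (R * entropy_bound n (card (level n x a)) / tilt Q (a + b)))
        + (\<Sum>(a, b)\<in>W. 4 * 2 ^ (a + b) * (R * entropy_bound n (card (level n y b)) / tilt Q (a + b))))"
      by (simp only: sum.distrib case_prod_unfold sum_distrib_left)
    also have "12 * Q * real n * (\<Sum>(a, b)\<in>W. (4 ^ a * s a / real n) * (4 ^ b * u b / real n)) \<le> 12 * Q * real n * (4 * 4)"
    proof (intro mult_left_mono)
      have "(\<Sum>(a, b)\<in>W. (4 ^ a * s a / real n) * (4 ^ b * u b / real n))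
        \<le> (\<Sum>(a, b)\<in>{..n} \<times> {..n}. (4 ^ a * s a / real n) * (4 ^ b * u b / real n))"
        by (intro sum_mono2) (auto simp: W_def s_def u_def)
      also have "\<dots> = (\<Sum>a\<le>n. 4 ^ a * s a / real n) * (\<Sum>b\<le>n. 4 ^ b * u b / real n)"
        by (simp only: sum_product sum.cartesian_product)
      also have "\<dots> \<le> 4 * 4"
        unfolding s_def u_def
        by (intro mult_mono sum_level_weights x y n sum_nonneg) auto
      finally show "(\<Sum>(a, b)\<in>W. (4 ^ a * s a / real n) * (4 ^ b * u b / real n)) \<le> 4 * 4" .
    qed (use Q in auto)
    also have "(\<Sum>(a, b)\<in>W. 4 * 2 ^ (a + b) * (R * entropy_bound n (card (level n y b)) / tilt Q (a + b))) \<le> 1536 * R * real n * Q"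
      using Q by (intro entropy_terms_sum n R y Wf) (auto simp: W_def bal_def)
    \<comment> \<open>Balance is symmetric in a and b, so the estimate for the other side applies
      after exchanging them.\<close>
    also have "(\<Sum>(a, b)\<in>W. 4 * 2 ^ (a + b) * (R * entropy_bound n (card (level n x a)) / tilt Q (a + b))) \<le> 1536 * R * real n * Q"
    proof -
      have "(\<Sum>(a, b)\<in>W. 4 * 2 ^ (a + b) * (R * entropy_bound n (card (level n x a)) / tilt Q (a + b)))
        = (\<Sum>(b, a)\<in>prod.swap ` W. 4 * 2 ^ (b + a) * (R * entropy_bound n (card (level n x a)) / tilt Q (b + a)))"
        by (subst sum.reindex) (auto simp: case_prod_unfold add.commute)
      also have "\<dots> \<le> 1536 * R * real n * Q"
        using Q by (intro entropy_terms_sum n R x finite_imageI Wf) (auto simp: W_def bal_def)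
      finally show ?thesis .
    qed
    finally show ?thesis by (simp add: algebra_simps)
  qed
  \<comment> \<open>A heavy pair is lopsided in one direction, lopsided in the other, or balanced;
    overlaps are harmless since all terms are nonnegative.\<close>
  have "(\<Sum>i<n. \<Sum>j<n. of_bool (0 < x i \<and> 0 < y j \<and> Q < 2 ^ (floor_log (x i) + floor_log (y j))) * t i j)
    \<le> (\<Sum>i<n. \<Sum>j<n. of_bool (hA i j) * t i j + (of_bool (hB i j) * t i j + of_bool (hC i j) * t i j))"
  proof (intro sum_mono)
    fix i j
    show "of_bool (0 < x i \<and> 0 < y j \<and> Q < 2 ^ (floor_log (x i) + floor_log (y j))) * t i j
      \<le> of_bool (hA i j) * t i j + (of_bool (hB i j) * t i j + of_bool (hC i j) * t i j)"
      using t0[of i j] by (cases "hA i j"; cases "hB i j"; cases "hC i j") (auto simp: hA_def hB_def hC_def bal_def not_le)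
  qed
  also have "\<dots> \<le> (16 * \<gamma> + 192 + 3072 * R) * real n * Q"
    using A B C by (simp add: sum.distrib algebra_simps)
  finally show ?thesis by (simp only: t_def)
qed

section \<open>Convexity and entropy in unions over vertex sets\<close>

lemma exp_convex_combination:
  fixes \<alpha> x :: real
  assumes "0 \<le> \<alpha>" "\<alpha> \<le> 1"
  shows "exp (\<alpha> * x) - 1 \<le> \<alpha> * (exp x - 1)"
proof -
  have "convex_on UNIV (exp :: real \<Rightarrow> real)" by (rule exp_convex)
  from convex_onD[OF this assms, of 0 x] show ?thesis by (simp add: algebra_simps)
qed

text \<open>The difference is (s - 1 - ln s) + (s - 1) (ln n - ln s), both parts nonnegative. Even a
  singleton thus carries entropy above ln n, which turns exponents into powers of n.\<close>

lemma entropy_bound_ge: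
  assumes "1 \<le> s" "s \<le> n"
  shows "1 + ln (real n) \<le> entropy_bound n s"
proof -
  have "ln (real s) \<le> real s - 1" using assms by (intro ln_le_minus_one) simp
  moreover have "(real s - 1) * ln (real s) \<le> (real s - 1) * ln (real n)" using assms by (intro mult_left_mono) auto
  ultimately show ?thesis using assms by (simp add: entropy_bound_def ln_div algebra_simps)
qed

text \<open>Compare one term of the binomial expansion of (1 + z)^n at z = s / n with exp (n
  z).\<close>

lemma binomial_le_exp_entropy:
  assumes "1 \<le> s" "s \<le> n"
  shows "real (n choose s) \<le> exp (entropy_bound n s)"
proof -
  define z where "z = real s / real n"
  have z: "z > 0" using assms by (simp add: z_def)
  have "real (n choose s) * z ^ s \<le> (\<Sum>k\<le>n. real (n choose k) * z ^ k)"
    using assms z by (intro member_le_sum) auto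
  also have "\<dots> = (z + 1) ^ n" by (subst binomial_ring) simp
  also have "\<dots> \<le> exp z ^ n" using z by (intro power_mono) (auto simp: add.commute)
  also have "\<dots> = exp (real s)" using assms by (simp add: z_def flip: exp_of_nat_mult)
  finally have "real (n choose s) \<le> exp (real s) / z ^ s" using z by (simp add: le_divide_eq)
  also have "z ^ s = exp (real s * ln z)" using z by (simp add: exp_of_nat_mult)
  also have "exp (real s) / exp (real s * ln z) = exp (entropy_bound n s)"
    using assms by (simp add: entropy_bound_def z_def ln_div algebra_simps flip: exp_diff)
  finally show ?thesis .
qed

lemma sum_subsets_by_card:
  fixes F :: "nat \<Rightarrow> real"
  shows "(\<Sum>S\<in>Pow {..<n} - {{}}. F (card S)) = (\<Sum>s=1..n. real (n choose s) * F s)"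
proof -
  have "(\<Sum>S\<in>Pow {..<n} - {{}}. F (card S)) = (\<Sum>s\<in>{1..n}. \<Sum>S\<in>{S \<in> Pow {..<n} - {{}}. card S = s}. F (card S))"
  proof (rule sum.group[symmetric])
    show "card ` (Pow {..<n} - {{}}) \<subseteq> {1..n}"
    proof
      fix k assume "k \<in> card ` (Pow {..<n} - {{}})"
      then obtain S where S: "k = card S" "S \<subseteq> {..<n}" "S \<noteq> {}" by auto
      then have "finite S" using finite_subset by blast
      then show "k \<in> {1..n}" using S card_mono[of "{..<n}" S] card_gt_0_iff[of S] by auto
    qed
  qed auto
  also have "\<dots> = (\<Sum>s=1..n. real (n choose s) * F s)"
  proof (rule sum.cong)
    fix s assume s: "s \<in> {1..n}"
    have "{S \<in> Pow {..<n} - {{}}. card S = s} = {S. S \<subseteq> {..<n} \<and> card S = s}" using s by auto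
    then show "(\<Sum>S\<in>{S \<in> Pow {..<n} - {{}}. card S = s}. F (card S)) = real (n choose s) * F s"
      using n_subsets[of "{..<n}" s] by simp
  qed simp
  finally show ?thesis .
qed

text \<open>One of the \<open>R\<close> copies of the entropy pays for the number of sets of each
  size; the other R - 1 give n^(1 - R), and the n sizes cost one more factor n.\<close>

lemma sum_exp_neg_entropy:
  assumes "R \<ge> 1" "0 < n"
  shows "(\<Sum>S\<in>Pow {..<n} - {{}}. exp (- (R * entropy_bound n (card S)))) \<le> real n powr (2 - R)"
proof -
  have "(\<Sum>S\<in>Pow {..<n} - {{}}. exp (- (R * entropy_bound n (card S))))
     = (\<Sum>s=1..n. real (n choose s) * exp (- (R * entropy_bound n s)))"
    by (rule sum_subsets_by_card)
  also have "\<dots> \<le> (\<Sum>s=1..n. real n powr (1 - R))"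
  proof (rule sum_mono)
    fix s assume s: "s \<in> {1..n}"
    have "real (n choose s) * exp (- (R * entropy_bound n s)) \<le> exp (entropy_bound n s) * exp (- (R * entropy_bound n s))"
      using s by (intro mult_right_mono binomial_le_exp_entropy) auto
    also have "\<dots> = exp ((1 - R) * entropy_bound n s)" by (simp add: algebra_simps flip: exp_add)
    also have "\<dots> \<le> exp ((1 - R) * ln (real n))"
    proof -
      have "ln (real n) \<le> entropy_bound n s" using entropy_bound_ge[of s n] s by simp
      then show ?thesis using assms by (simp add: mult_left_mono_neg)
    qed
    also have "\<dots> = real n powr (1 - R)" using assms by (simp add: powr_def)
    finally show "real (n choose s) * exp (- (R * entropy_bound n s)) \<le> real n powr (1 - R)" .
  qed
  also have "\<dots> = real n powr 1 * real n powr (1 - R)" using assms by simp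
  also have "\<dots> = real n powr (2 - R)" unfolding powr_add[symmetric] by simp
  finally show ?thesis .
qed

subsection \<open>Integer grid\<close>

text \<open>Scaled by sqrt n, unit vectors round to integer vectors of squared norm at most 4 n.
  \<open>PiE\<close> makes the functions canonical outside the range, and the box makes the set
  visibly finite.\<close>

definition int_grid :: "nat \<Rightarrow> (nat \<Rightarrow> int) set" where
  "int_grid n = {k \<in> PiE {..<n} (\<lambda>_. {- 2 * int n..2 * int n}). (\<Sum>i<n. (real_of_int (k i))\<^sup>2) \<le> 4 * real n}"

lemma finite_int_grid: "finite (int_grid n)"
  by (rule finite_subset[of _ "PiE {..<n} (\<lambda>_. {- 2 * int n..2 * int n})"]) (auto simp: int_grid_def intro!: finite_PiE)

lemma sum_exp_neg_square: "(\<Sum>z\<in>{- int N..int N}. exp (- (real_of_int z)\<^sup>2)) \<le> exp 2"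
proof -
  have half: "exp (- (real_of_int z)\<^sup>2) \<le> (1/2) ^ nat \<bar>z\<bar>" for z :: int
  proof -
    have "\<bar>z\<bar> \<le> z\<^sup>2" by (simp add: abs_le_square_iff power2_eq_square)
      (metis abs_ge_zero abs_mult_self_eq mult_le_cancel_left1 mult_zero_left not_less zabs_less_one_iff zero_less_abs_iff int_one_le_iff_zero_less)
    then have "real_of_int \<bar>z\<bar> \<le> real_of_int (z\<^sup>2)" by (simp only: of_int_le_iff)
    then have "exp (- (real_of_int z)\<^sup>2) \<le> exp (- real (nat \<bar>z\<bar>))" by simp
    also have "\<dots> = (exp (-1)) ^ nat \<bar>z\<bar>" by (simp flip: exp_of_nat_mult)
    also have "\<dots> \<le> (1/2) ^ nat \<bar>z\<bar>"
    proof (rule power_mono)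
      have "(2::real) \<le> exp 1" using exp_ge_add_one_self[of "1::real"] by simp
      then show "exp (- 1) \<le> (1/2::real)" by (simp add: exp_minus divide_simps)
    qed simp
    finally show ?thesis .
  qed
  have geo: "(\<Sum>k\<le>N. (1/2) ^ k) \<le> (2::real)"
    using sum_inverse_powers[of "{..N}"] by (simp add: power_divide)
  \<comment> \<open>Covering the interval by two half-lines counts 0 twice, which the bound 4 can
    afford.\<close>
  have sub: "{- int N..int N} \<subseteq> int ` {..N} \<union> (\<lambda>k. - int k) ` {..N}"
  proof
    fix z assume "z \<in> {- int N..int N}"
    then show "z \<in> int ` {..N} \<union> (\<lambda>k. - int k) ` {..N}"
      by (cases "z \<ge> 0") (auto simp: image_iff intro!: bexI[of _ "nat \<bar>z\<bar>"])
  qed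
  have "(\<Sum>z\<in>{- int N..int N}. exp (- (real_of_int z)\<^sup>2)) \<le> (\<Sum>z\<in>{- int N..int N}. (1/2) ^ nat \<bar>z\<bar>)"
    by (intro sum_mono half)
  also have "\<dots> \<le> (\<Sum>z\<in>int ` {..N} \<union> (\<lambda>k. - int k) ` {..N}. (1/2) ^ nat \<bar>z\<bar>)"
    by (rule sum_mono2[OF _ sub]) auto
  also have "\<dots> \<le> (\<Sum>z\<in>int ` {..N}. (1/2) ^ nat \<bar>z\<bar>) + (\<Sum>z\<in>(\<lambda>k. - int k) ` {..N}. (1/2) ^ nat \<bar>z\<bar>)"
    by (subst sum_Un) (auto intro!: sum_nonneg)
  also have "\<dots> = (\<Sum>k\<le>N. (1/2) ^ k) + (\<Sum>k\<le>N. (1/2) ^ k)"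
    by (subst (1 2) sum.reindex) (auto simp: inj_on_def)
  also have "\<dots> \<le> 2 * 2" using geo by simp
  also have "\<dots> \<le> exp 1 * exp (1::real)"
    using exp_ge_add_one_self[of "1::real"] by (intro mult_mono) auto
  also have "\<dots> = exp 2" by (simp flip: exp_add)
  finally show ?thesis .
qed

text \<open>Every grid point has weight exp (4 n - |k|^2) at least 1, and the sum of these weights
  over the whole box factorises, each coordinate contributing at most e^2.\<close>

lemma card_int_grid: "real (card (int_grid n)) \<le> exp (6 * real n)"
proof -
  let ?P = "PiE {..<n} (\<lambda>_. {- int (2 * n)..int (2 * n)})"
  have fin: "finite ?P" by (intro finite_PiE) auto
  have "real (card (int_grid n)) = (\<Sum>k\<in>int_grid n. 1)" by simp
  also have "\<dots> \<le> (\<Sum>k\<in>int_grid n. exp (4 * real n) * exp (- (\<Sum>i<n. (real_of_int (k i))\<^sup>2)))"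
    by (intro sum_mono) (auto simp: int_grid_def simp flip: exp_add)
  also have "\<dots> \<le> (\<Sum>k\<in>?P. exp (4 * real n) * exp (- (\<Sum>i<n. (real_of_int (k i))\<^sup>2)))"
    by (intro sum_mono2 fin) (auto simp: int_grid_def)
  also have "\<dots> = exp (4 * real n) * (\<Sum>k\<in>?P. \<Prod>i<n. exp (- (real_of_int (k i))\<^sup>2))"
    by (simp add: sum_distrib_left exp_sum flip: sum_negf)
  also have "(\<Sum>k\<in>?P. \<Prod>i<n. exp (- (real_of_int (k i))\<^sup>2)) = (\<Prod>i<n. \<Sum>z\<in>{- int (2 * n)..int (2 * n)}. exp (- (real_of_int z)\<^sup>2))"
    by (rule prod_sum_PiE[symmetric]) auto
  also have "\<dots> \<le> (\<Prod>i<n. exp 2)"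
    by (rule prod_mono) (use sum_exp_neg_square[of "2 * n"] in \<open>auto intro!: sum_nonneg\<close>)
  also have "exp (4 * real n) * (\<Prod>i<n. exp 2) = exp (6 * real n)"
    by (simp flip: exp_of_nat_mult exp_add)
  finally show ?thesis by simp
qed

text \<open>Rounding up or down according to the sign of the coefficient \<open>c\<close> cannot
  decrease the linear form, so no loss from approximating by a net arises. That 0 stays 0 preserves
  supports.\<close>

lemma round_towards_sign:
  fixes x c :: real
  shows "\<exists>k::int. x * c \<le> real_of_int k * c \<and> (real_of_int k)\<^sup>2 \<le> 2 * x\<^sup>2 + 2 \<and> (x = 0 \<longrightarrow> k = 0)"
proof -
  have sq: "(real_of_int k)\<^sup>2 \<le> 2 * x\<^sup>2 + 2" if "\<bar>real_of_int k - x\<bar> \<le> 1" for k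
  proof -
    have "(real_of_int k - x)\<^sup>2 \<le> 1" using that by (simp add: abs_square_le_1)
    moreover have "(real_of_int k)\<^sup>2 \<le> 2 * x\<^sup>2 + 2 * (real_of_int k - x)\<^sup>2"
      using sq_dist_half_sum[of "real_of_int k" 0 x] by (simp add: power2_commute)
    ultimately show ?thesis by linarith
  qed
  show ?thesis
  proof (cases "c \<ge> 0")
    case True
    then have "x * c \<le> real_of_int \<lceil>x\<rceil> * c" by (intro mult_right_mono) auto
    moreover have "\<bar>real_of_int \<lceil>x\<rceil> - x\<bar> \<le> 1" by linarith
    ultimately show ?thesis using sq by (intro exI[of _ "\<lceil>x\<rceil>"]) auto
  next
    case False
    then have "x * c \<le> real_of_int \<lfloor>x\<rfloor> * c" by (intro mult_right_mono_neg) auto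
    moreover have "\<bar>real_of_int \<lfloor>x\<rfloor> - x\<bar> \<le> 1" by linarith
    ultimately show ?thesis using sq by (intro exI[of _ "\<lfloor>x\<rfloor>"]) auto
  qed
qed

lemma round_vector:
  fixes x c :: "nat \<Rightarrow> real"
  assumes "(\<Sum>i<n. (x i)\<^sup>2) \<le> 1" and supp: "\<And>i. i \<notin> J \<Longrightarrow> x i = 0"
  shows "\<exists>k\<in>int_grid n. (\<forall>i<n. i \<notin> J \<longrightarrow> k i = 0) \<and>
    sqrt (real n) * (\<Sum>i<n. x i * c i) \<le> (\<Sum>i<n. real_of_int (k i) * c i)"
proof -
  have "\<exists>k::int. sqrt (real n) * x i * c i \<le> real_of_int k * c i \<and> (real_of_int k)\<^sup>2 \<le> 2 * (sqrt (real n) * x i)\<^sup>2 + 2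
     \<and> (sqrt (real n) * x i = 0 \<longrightarrow> k = 0)" for i
    using round_towards_sign[of "sqrt (real n) * x i" "c i"] by simp
  then obtain k0 :: "nat \<Rightarrow> int" where k0: "\<And>i. sqrt (real n) * x i * c i \<le> real_of_int (k0 i) * c i"
    "\<And>i. (real_of_int (k0 i))\<^sup>2 \<le> 2 * (sqrt (real n) * x i)\<^sup>2 + 2" "\<And>i. x i = 0 \<Longrightarrow> k0 i = 0"
    by (metis mult_zero_right)
  define k where "k = restrict k0 {..<n}"
  have ki: "k i = k0 i" if "i < n" for i using that by (simp add: k_def)
  \<comment> \<open>Of the 4 n, one half comes from the scaled vector and one half from rounding its
    n coordinates.\<close>
  have S: "(\<Sum>i<n. (real_of_int (k i))\<^sup>2) \<le> 4 * real n"
  proof -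
    have "(\<Sum>i<n. (real_of_int (k i))\<^sup>2) \<le> (\<Sum>i<n. 2 * real n * (x i)\<^sup>2 + 2)"
      using k0(2) by (intro sum_mono) (simp add: ki power_mult_distrib mult.assoc)
    also have "\<dots> = 2 * real n * (\<Sum>i<n. (x i)\<^sup>2) + 2 * real n" by (simp add: sum.distrib sum_distrib_left)
    also have "\<dots> \<le> 2 * real n * 1 + 2 * real n" using assms(1) by (intro add_mono mult_left_mono) auto
    finally show ?thesis by simp
  qed
  have "\<bar>k i\<bar> \<le> 2 * int n" if i: "i < n" for i
  proof -
    have "(real_of_int (k i))\<^sup>2 \<le> (\<Sum>i<n. (real_of_int (k i))\<^sup>2)" using i by (intro member_le_sum) auto
    also have "\<dots> \<le> 4 * real n" by (rule S)
    also have "\<dots> \<le> (2 * real n)\<^sup>2" using i by (simp add: power2_eq_square)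
    finally have "\<bar>real_of_int (k i)\<bar> \<le> 2 * real n" by (subst (asm) power2_le_iff_abs_le) auto
    then show ?thesis by linarith
  qed
  then have "k \<in> int_grid n" using S by (force simp: int_grid_def k_def abs_le_iff)
  moreover have "\<forall>i<n. i \<notin> J \<longrightarrow> k i = 0" using k0(3) supp by (simp add: ki)
  moreover have "sqrt (real n) * (\<Sum>i<n. x i * c i) \<le> (\<Sum>i<n. real_of_int (k i) * c i)"
    using k0(1) by (simp add: sum_distrib_left ki mult.assoc[symmetric] sum_mono)
  ultimately show ?thesis by blast
qed

text \<open>The form is linear in each argument: x is rounded for fixed y, then y for the already
  rounded k. Neither step decreases the form, and the two factors sqrt n produce the n on the right.
  Homogeneity extends the bound from unit vectors.\<close>

lemma op_bound_from_grid:
  fixes B :: "nat \<Rightarrow> nat \<Rightarrow> real"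
  assumes n: "0 < n" and C: "0 \<le> C"
    and grid: "\<And>k h. k \<in> int_grid n \<Longrightarrow> h \<in> int_grid n \<Longrightarrow> (\<forall>i<n. i \<notin> J \<longrightarrow> k i = 0) \<Longrightarrow> (\<forall>i<n. i \<notin> J \<longrightarrow> h i = 0) \<Longrightarrow>
      (\<Sum>i<n. \<Sum>j<n. real_of_int (k i) * real_of_int (h j) * B i j) \<le> C * real n"
  shows "op_bound n (\<lambda>i j. if i \<in> J \<and> j \<in> J then B i j else 0) C"
proof -
  let ?B = "\<lambda>i j. if i \<in> J \<and> j \<in> J then B i j else 0"
  have unit: "ip n x (mv n ?B y) \<le> C" if x: "(\<Sum>i<n. (x i)\<^sup>2) \<le> 1" and y: "(\<Sum>i<n. (y i)\<^sup>2) \<le> 1" for x y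
  proof -
    define x' where "x' i = (if i \<in> J then x i else 0)" for i
    define y' where "y' i = (if i \<in> J then y i else 0)" for i
    have x': "(\<Sum>i<n. (x' i)\<^sup>2) \<le> 1" by (rule order_trans[OF sum_mono x]) (simp add: x'_def)
    have y': "(\<Sum>i<n. (y' i)\<^sup>2) \<le> 1" by (rule order_trans[OF sum_mono y]) (simp add: y'_def)
    have e: "ip n x (mv n ?B y) = (\<Sum>i<n. x' i * (\<Sum>j<n. B i j * y' j))"
    proof -
      have "(\<Sum>j<n. ?B i j * y j) = (if i \<in> J then (\<Sum>j<n. B i j * y' j) else 0)" for i
        by (cases "i \<in> J") (auto simp: y'_def intro!: sum.cong)
      then show ?thesis unfolding ip_def mv_def by (intro sum.cong refl) (simp add: x'_def)
    qed
    obtain k where k: "k \<in> int_grid n" "\<forall>i<n. i \<notin> J \<longrightarrow> k i = 0"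
      "sqrt (real n) * (\<Sum>i<n. x' i * (\<Sum>j<n. B i j * y' j)) \<le> (\<Sum>i<n. real_of_int (k i) * (\<Sum>j<n. B i j * y' j))"
      using round_vector[OF x', of J "\<lambda>i. \<Sum>j<n. B i j * y' j"] by (auto simp: x'_def)
    have sw: "(\<Sum>i<n. real_of_int (k i) * (\<Sum>j<n. B i j * z j)) = (\<Sum>j<n. z j * (\<Sum>i<n. real_of_int (k i) * B i j))" for z
      unfolding sum_distrib_left by (subst sum.swap) (simp add: mult_ac)
    obtain h where h: "h \<in> int_grid n" "\<forall>i<n. i \<notin> J \<longrightarrow> h i = 0"
      "sqrt (real n) * (\<Sum>j<n. y' j * (\<Sum>i<n. real_of_int (k i) * B i j)) \<le> (\<Sum>j<n. real_of_int (h j) * (\<Sum>i<n. real_of_int (k i) * B i j))"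
      using round_vector[OF y', of J "\<lambda>j. \<Sum>i<n. real_of_int (k i) * B i j"] by (auto simp: y'_def)
    have "real n * ip n x (mv n ?B y) = sqrt (real n) * (sqrt (real n) * (\<Sum>i<n. x' i * (\<Sum>j<n. B i j * y' j)))"
      by (simp add: e)
    also have "\<dots> \<le> sqrt (real n) * (\<Sum>j<n. y' j * (\<Sum>i<n. real_of_int (k i) * B i j))"
      using k(3) unfolding sw[of y'] by (intro mult_left_mono) auto
    also have "\<dots> \<le> (\<Sum>j<n. real_of_int (h j) * (\<Sum>i<n. real_of_int (k i) * B i j))" by (rule h(3))
    also have "\<dots> = (\<Sum>i<n. \<Sum>j<n. real_of_int (k i) * real_of_int (h j) * B i j)"
      unfolding sum_distrib_left by (subst sum.swap) (simp add: mult_ac)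
    also have "\<dots> \<le> C * real n" by (rule grid[OF k(1) h(1) k(2) h(2)])
    finally show ?thesis using n by (simp add: mult.commute)
  qed
  have "ip n x (mv n ?B y) \<le> C * L2_set x {..<n} * L2_set y {..<n}" for x y
  proof (cases "L2_set x {..<n} = 0 \<or> L2_set y {..<n} = 0")
    case True
    then have "(\<forall>i<n. x i = 0) \<or> (\<forall>i<n. y i = 0)" by (auto simp: L2_set_eq_0_iff)
    then have "ip n x (mv n ?B y) = 0" by (auto simp: ip_def mv_def)
    then show ?thesis using True by auto
  next
    case False
    define a where "a = L2_set x {..<n}"
    define b where "b = L2_set y {..<n}"
    have ab: "a > 0" "b > 0" using False by (auto simp: a_def b_def order_less_le L2_set_nonneg)
    have nrm: "(\<Sum>i<n. ((1 / c) * z i)\<^sup>2) \<le> 1" if "c = L2_set z {..<n}" "c > 0" for c z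
    proof -
      have "(\<Sum>i<n. (z i)\<^sup>2) = c\<^sup>2" unfolding that(1) by (simp add: L2_set_def sum_nonneg)
      then show ?thesis using that(2) by (simp add: power_divide flip: sum_divide_distrib)
    qed
    have "ip n (\<lambda>i. (1/a) * x i) (mv n ?B (\<lambda>i. (1/b) * y i)) \<le> C"
      using ab by (intro unit nrm) (auto simp: a_def b_def)
    then have "(1/a) * ((1/b) * ip n x (mv n ?B y)) \<le> C"
      by (simp only: mv_scale ip_scale_left ip_scale_right)
    then show ?thesis using ab by (simp add: a_def[symmetric] b_def[symmetric] divide_le_eq mult_ac)
  qed
  then show ?thesis using C by (simp add: op_bound_def)
qed

section \<open>The weighted random graph given the labels\<close>

definition edge_set :: "nat \<Rightarrow> nat \<Rightarrow> (nat \<times> nat \<times> nat) set" where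
  "edge_set n L = {(l, i, j). l < L \<and> i < j \<and> j < n}"

lemma finite_edge_set: "finite (edge_set n L)"
  by (rule finite_subset[of _ "{..<L} \<times> {..<n} \<times> {..<n}"]) (auto simp: edge_set_def)

lemma sum_edge_set:
  "(\<Sum>e\<in>edge_set n L. H e) = (\<Sum>i<n. \<Sum>j<n. if i < j then (\<Sum>l<L. H (l, i, j)) else (0::real))"
proof -
  have "(\<Sum>e\<in>edge_set n L. H e) = (\<Sum>(l, i, j)\<in>{..<L} \<times> {..<n} \<times> {..<n}. if i < j then H (l, i, j) else 0)"
    by (rule sum.mono_neutral_cong_left) (auto simp: edge_set_def split: if_splits)
  also have "\<dots> = (\<Sum>l<L. \<Sum>(i, j)\<in>{..<n} \<times> {..<n}. if i < j then H (l, i, j) else 0)"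
    by (subst sum.cartesian_product) (simp add: case_prod_unfold)
  also have "\<dots> = (\<Sum>(i, j)\<in>{..<n} \<times> {..<n}. \<Sum>l<L. if i < j then H (l, i, j) else 0)"
    by (subst sum.swap) (simp add: case_prod_unfold)
  also have "\<dots> = (\<Sum>i<n. \<Sum>j<n. \<Sum>l<L. if i < j then H (l, i, j) else 0)"
    by (rule sum.cartesian_product[symmetric])
  also have "\<dots> = (\<Sum>i<n. \<Sum>j<n. if i < j then (\<Sum>l<L. H (l, i, j)) else 0)"
    by (intro sum.cong refl) simp
  finally show ?thesis .
qed

text \<open>Given the labels, edge probabilities differ from pair to pair; only the layerwise bound
  \<open>p l\<close> is retained. Edges are indexed with i < j, so that distinct entries of
  \<open>X\<close> are independent.\<close>

locale weighted_edges =
  fixes n L :: nat and \<alpha> p :: "nat \<Rightarrow> real" and \<pi> :: "nat \<times> nat \<times> nat \<Rightarrow> real"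
  assumes n: "0 < n"
    and \<alpha>: "\<And>l. l < L \<Longrightarrow> 0 \<le> \<alpha> l \<and> \<alpha> l \<le> 1"
    and p: "\<And>l. l < L \<Longrightarrow> p l \<le> 1"
    and \<pi>: "\<And>l i j. l < L \<Longrightarrow> 0 \<le> \<pi> (l, i, j) \<and> \<pi> (l, i, j) \<le> p l"
begin

definition m :: real where "m = (\<Sum>l<L. \<alpha> l * p l)"

definition X :: "(nat \<times> nat \<times> nat \<Rightarrow> bool) \<Rightarrow> nat \<Rightarrow> nat \<Rightarrow> real" where
  "X f i j = (if i < j then (\<Sum>l<L. \<alpha> l * of_bool (f (l, i, j))) else 0)"

definition M :: "nat \<Rightarrow> nat \<Rightarrow> real" where
  "M i j = (if i < j then (\<Sum>l<L. \<alpha> l * \<pi> (l, i, j)) else 0)"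

abbreviation P :: "(nat \<times> nat \<times> nat \<Rightarrow> bool) pmf" where
  "P \<equiv> bern (edge_set n L) \<pi>"

lemma \<pi>01: "e \<in> edge_set n L \<Longrightarrow> 0 \<le> \<pi> e \<and> \<pi> e \<le> 1"
proof -
  assume "e \<in> edge_set n L"
  then obtain l i j where e: "e = (l, i, j)" "l < L" by (auto simp: edge_set_def)
  show ?thesis using \<pi>[OF e(2), of i j] p[OF e(2)] unfolding e(1) by simp
qed

lemma X_nonneg: "0 \<le> X f i j"
  using \<alpha> by (auto simp: X_def intro!: sum_nonneg)

lemma M_bounds: "0 \<le> M i j" "M i j \<le> m"
proof -
  show "0 \<le> M i j" using \<alpha> \<pi> by (auto simp: M_def intro!: sum_nonneg)
  have "0 \<le> p l" if "l < L" for l using \<pi>[OF that] by (meson order_trans)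
  then have "0 \<le> m" unfolding m_def using \<alpha> by (auto intro!: sum_nonneg)
  moreover have "(\<Sum>l<L. \<alpha> l * \<pi> (l, i, j)) \<le> m"
    unfolding m_def using \<alpha> \<pi> by (intro sum_mono mult_left_mono) auto
  ultimately show "M i j \<le> m" by (simp add: M_def)
qed

lemma m_nonneg: "0 \<le> m" using M_bounds[of 0 0] by (simp add: M_def)

lemma bsum_X: "bsum (edge_set n L) (\<lambda>(l, i, j). \<alpha> l * g i j) f = (\<Sum>i<n. \<Sum>j<n. g i j * X f i j)"
  unfolding bsum_def sum_edge_set X_def
  by (intro sum.cong refl) (simp add: sum_distrib_left mult_ac del: sum_mult_of_bool_eq sum_of_bool_mult_eq)

lemma sum_mean: "(\<Sum>e\<in>edge_set n L. (case e of (l, i, j) \<Rightarrow> \<alpha> l * g i j) * \<pi> e) = (\<Sum>i<n. \<Sum>j<n. g i j * M i j)"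
  unfolding sum_edge_set M_def
  by (intro sum.cong refl) (simp add: sum_distrib_left mult_ac)

lemma sum_weights_le:
  assumes G: "\<And>i j. i < n \<Longrightarrow> j < n \<Longrightarrow> 0 \<le> G i j"
    and H: "\<And>l i j. l < L \<Longrightarrow> i < n \<Longrightarrow> j < n \<Longrightarrow> i < j \<Longrightarrow> H (l, i, j) \<le> p l * \<alpha> l * G i j"
  shows "(\<Sum>e\<in>edge_set n L. H e) \<le> m * (\<Sum>i<n. \<Sum>j<n. of_bool (i < j) * G i j)"
proof -
  have "(\<Sum>e\<in>edge_set n L. H e) \<le> (\<Sum>i<n. \<Sum>j<n. m * (of_bool (i < j) * G i j))"
    unfolding sum_edge_set
  proof (intro sum_mono)
    fix i j assume ij: "i \<in> {..<n}" "j \<in> {..<n}"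
    have "(\<Sum>l<L. H (l, i, j)) \<le> m * G i j" if "i < j"
      unfolding m_def sum_distrib_right using ij that H by (intro sum_mono) (auto simp: mult_ac)
    then show "(if i < j then (\<Sum>l<L. H (l, i, j)) else 0) \<le> m * (of_bool (i < j) * G i j)" by simp
  qed
  then show ?thesis by (simp only: sum_distrib_left)
qed

lemma p_nonneg: "l < L \<Longrightarrow> 0 \<le> p l"
  using \<pi> by (meson order_trans)

text \<open>Convexity of exp takes the layer weight out of the exponent, and nonnegativity of
  \<open>G\<close> lets \<pi> be raised to p. After that only the weighted mean \<open>m\<close> is
  left.\<close>

lemma exp_tail_weights:
  assumes "\<And>i j. i < n \<Longrightarrow> j < n \<Longrightarrow> 0 \<le> G i j"
    and "\<And>i j. i < n \<Longrightarrow> j < n \<Longrightarrow> exp (g i j) - 1 \<le> G i j"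
  shows "(\<Sum>e\<in>edge_set n L. \<pi> e * (exp (case e of (l, i, j) \<Rightarrow> \<alpha> l * g i j) - 1))
    \<le> m * (\<Sum>i<n. \<Sum>j<n. of_bool (i < j) * G i j)"
proof (rule sum_weights_le)
  fix l i j assume l: "l < L" and ij: "i < n" "j < n"
  have "exp (\<alpha> l * g i j) - 1 \<le> \<alpha> l * (exp (g i j) - 1)"
    using \<alpha>[OF l] by (intro exp_convex_combination) auto
  also have "\<dots> \<le> \<alpha> l * G i j" using \<alpha>[OF l] assms ij by (intro mult_left_mono) auto
  finally have "\<pi> (l, i, j) * (exp (\<alpha> l * g i j) - 1) \<le> \<pi> (l, i, j) * (\<alpha> l * G i j)"
    using \<pi>[OF l, of i j] by (intro mult_left_mono) auto
  also have "\<dots> \<le> p l * (\<alpha> l * G i j)"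
    using \<pi>[OF l, of i j] \<alpha>[OF l] assms(1)[OF ij] by (intro mult_right_mono) auto
  finally show "\<pi> (l, i, j) * (exp (case (l, i, j) of (l, i, j) \<Rightarrow> \<alpha> l * g i j) - 1) \<le> p l * \<alpha> l * G i j"
    by (simp add: mult.assoc)
qed (use assms in auto)

subsection \<open>Light pairs\<close>

text \<open>The exact negation of the heavy condition, in the same dyadic levels, so that the two
  cases are complementary.\<close>

definition light :: "real \<Rightarrow> (nat \<Rightarrow> int) \<Rightarrow> (nat \<Rightarrow> int) \<Rightarrow> nat \<Rightarrow> nat \<Rightarrow> bool" where
  "light Q k h i j \<longleftrightarrow> \<not> (0 < nat \<bar>k i\<bar> \<and> 0 < nat \<bar>h j\<bar> \<and> Q < 2 ^ (floor_log (nat \<bar>k i\<bar>) + floor_log (nat \<bar>h j\<bar>)))"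

lemma light_prod_le:
  assumes "light Q k h i j" "i < n" "j < n" "0 \<le> Q"
  shows "\<bar>real_of_int (k i) * real_of_int (h j)\<bar> \<le> 4 * Q"
proof (cases "k i = 0 \<or> h j = 0")
  case False
  let ?x = "\<lambda>i. nat \<bar>k i\<bar>" and ?y = "\<lambda>j. nat \<bar>h j\<bar>"
  have "real (?x i) \<le> 2 * 2 ^ floor_log (?x i)"
    using False assms by (intro level_bounds(2)[where n = n and x = ?x]) (auto simp: level_def)
  moreover have "real (?y j) \<le> 2 * 2 ^ floor_log (?y j)"
    using False assms by (intro level_bounds(2)[where n = n and x = ?y]) (auto simp: level_def)
  ultimately have "real (?x i) * real (?y j) \<le> (2 * 2 ^ floor_log (?x i)) * (2 * 2 ^ floor_log (?y j))"
    by (intro mult_mono) auto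
  also have "\<dots> = 4 * 2 ^ (floor_log (?x i) + floor_log (?y j))" by (simp add: power_add)
  also have "\<dots> \<le> 4 * Q" using assms(1) False by (simp add: light_def not_less)
  finally show ?thesis by (simp add: abs_mult)
qed (use assms in auto)

text \<open>Bernstein with coefficients divided by 4 Q, which bounds them by 1 on light pairs. The
  variance is then at most m (4 n)^2 / (16 Q^2) = n. The deviation 14 n, that is 56 n Q before
  scaling, is chosen so that exp (- 13 n) beats the exp (12 n) pairs of grid points.\<close>

lemma prob_light_pair:
  assumes k: "k \<in> int_grid n" and h: "h \<in> int_grid n" and d: "0 < m"
  defines "Q \<equiv> sqrt (real n * m)"
  shows "measure_pmf.prob P {f. 56 * real n * Q < (\<Sum>i<n. \<Sum>j<n. of_bool (light Q k h i j)
      * (real_of_int (k i) * real_of_int (h j) * (X f i j - M i j)))} \<le> exp (- (13 * real n))"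
proof -
  have Q: "Q > 0" "Q\<^sup>2 = real n * m" using d n by (auto simp: Q_def)
  define g :: "nat \<Rightarrow> nat \<Rightarrow> real" where "g i j = of_bool (light Q k h i j) * (real_of_int (k i) * real_of_int (h j)) / (4 * Q)" for i j
  let ?c = "\<lambda>(l, i, j). \<alpha> l * g i j"
  have g1: "\<bar>g i j\<bar> \<le> 1" if "i < n" "j < n" for i j
    using light_prod_le[of Q k h i j] that Q(1) by (cases "light Q k h i j") (auto simp: g_def abs_mult)
  have "measure_pmf.prob P {f. 14 * real n \<le> bsum (edge_set n L) ?c f - (\<Sum>e\<in>edge_set n L. ?c e * \<pi> e)} \<le> exp (real n - 14 * real n)"
  proof (rule bernstein_bern[OF finite_edge_set \<pi>01])
    fix e assume "e \<in> edge_set n L"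
    then obtain l i j where e: "e = (l, i, j)" "l < L" "i < n" "j < n" by (auto simp: edge_set_def)
    have "\<bar>\<alpha> l * g i j\<bar> \<le> 1 * 1" unfolding abs_mult using \<alpha>[OF e(2)] g1[OF e(3,4)] by (intro mult_mono) auto
    then show "\<bar>?c e\<bar> \<le> 1" by (simp add: e)
  next
    define G where "G i j = (real_of_int (k i))\<^sup>2 * (real_of_int (h j))\<^sup>2 / (16 * Q\<^sup>2)" for i j
    have gG: "(g i j)\<^sup>2 \<le> G i j" for i j by (simp add: g_def G_def power_mult_distrib power_divide)
    have "(\<Sum>e\<in>edge_set n L. \<pi> e * (?c e)\<^sup>2) \<le> m * (\<Sum>i<n. \<Sum>j<n. of_bool (i < j) * G i j)"
    proof (rule sum_weights_le)
      fix l i j assume l: "l < L"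
      have "\<alpha> l * \<alpha> l \<le> \<alpha> l" using \<alpha>[OF l] mult_left_mono[of "\<alpha> l" 1 "\<alpha> l"] by simp
      then have "(\<alpha> l * g i j)\<^sup>2 \<le> \<alpha> l * G i j"
        unfolding power_mult_distrib power2_eq_square[of "\<alpha> l"] using gG[of i j] \<alpha>[OF l] by (intro mult_mono) auto
      then have "\<pi> (l, i, j) * (\<alpha> l * g i j)\<^sup>2 \<le> p l * (\<alpha> l * G i j)"
        using \<pi>[OF l, of i j] p_nonneg[OF l] by (intro mult_mono) auto
      then show "\<pi> (l, i, j) * (case (l, i, j) of (l, i, j) \<Rightarrow> \<alpha> l * g i j)\<^sup>2 \<le> p l * \<alpha> l * G i j"
        by (simp add: mult.assoc)
    qed (simp add: G_def)
    also have "\<dots> \<le> m * (\<Sum>i<n. \<Sum>j<n. G i j)"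
      using m_nonneg by (intro mult_left_mono sum_mono) (auto simp: G_def)
    also have "(\<Sum>i<n. \<Sum>j<n. G i j) = (\<Sum>i<n. (real_of_int (k i))\<^sup>2) * (\<Sum>j<n. (real_of_int (h j))\<^sup>2) / (16 * Q\<^sup>2)"
      unfolding G_def sum_product by (simp only: sum_divide_distrib)
    also have "m * \<dots> \<le> m * ((4 * real n) * (4 * real n) / (16 * Q\<^sup>2))"
    proof (intro mult_left_mono divide_right_mono mult_mono m_nonneg sum_nonneg)
      show "(\<Sum>i<n. (real_of_int (k i))\<^sup>2) \<le> 4 * real n" using k by (simp add: int_grid_def)
      show "(\<Sum>i<n. (real_of_int (h i))\<^sup>2) \<le> 4 * real n" using h by (simp add: int_grid_def)
    qed simp_all
    also have "\<dots> = real n" using d n by (simp add: Q(2))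
    finally show "(\<Sum>e\<in>edge_set n L. \<pi> e * (?c e)\<^sup>2) \<le> real n" .
  qed
  moreover have sub: "{f. 56 * real n * Q < (\<Sum>i<n. \<Sum>j<n. of_bool (light Q k h i j)
      * (real_of_int (k i) * real_of_int (h j) * (X f i j - M i j)))}
      \<subseteq> {f. 14 * real n \<le> bsum (edge_set n L) ?c f - (\<Sum>e\<in>edge_set n L. ?c e * \<pi> e)}"
  proof clarify
    fix f assume lt: "56 * real n * Q < (\<Sum>i<n. \<Sum>j<n. of_bool (light Q k h i j)
      * (real_of_int (k i) * real_of_int (h j) * (X f i j - M i j)))"
    have "(\<Sum>i<n. \<Sum>j<n. of_bool (light Q k h i j) * (real_of_int (k i) * real_of_int (h j) * (X f i j - M i j)))
      = (\<Sum>i<n. \<Sum>j<n. (4 * Q) * (g i j * X f i j - g i j * M i j))"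
      using Q by (intro sum.cong refl) (simp add: g_def field_simps)
    also have "\<dots> = (4 * Q) * ((\<Sum>i<n. \<Sum>j<n. g i j * X f i j) - (\<Sum>i<n. \<Sum>j<n. g i j * M i j))"
      by (simp only: sum_distrib_left sum_subtractf[symmetric])
    finally have "56 * real n * Q < (4 * Q) * ((\<Sum>i<n. \<Sum>j<n. g i j * X f i j) - (\<Sum>i<n. \<Sum>j<n. g i j * M i j))"
      using lt by simp
    then have "(4 * Q) * (14 * real n) < (4 * Q) * ((\<Sum>i<n. \<Sum>j<n. g i j * X f i j) - (\<Sum>i<n. \<Sum>j<n. g i j * M i j))"
      by (simp add: mult_ac)
    then have "14 * real n < (\<Sum>i<n. \<Sum>j<n. g i j * X f i j) - (\<Sum>i<n. \<Sum>j<n. g i j * M i j)"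
      using Q(1) by simp
    then show "14 * real n \<le> bsum (edge_set n L) ?c f - (\<Sum>e\<in>edge_set n L. ?c e * \<pi> e)"
      unfolding bsum_X sum_mean by simp
  qed
  from measure_pmf.finite_measure_mono[OF this] have "measure_pmf.prob P {f. 56 * real n * Q < (\<Sum>i<n. \<Sum>j<n. of_bool (light Q k h i j)
      * (real_of_int (k i) * real_of_int (h j) * (X f i j - M i j)))}
      \<le> measure_pmf.prob P {f. 14 * real n \<le> bsum (edge_set n L) ?c f - (\<Sum>e\<in>edge_set n L. ?c e * \<pi> e)}"
    by simp
  ultimately show ?thesis by simp
qed

subsection \<open>Discrepancy\<close>

text \<open>Chernoff for the weighted number of edges from \<open>S\<close> to \<open>T\<close>,
  with the tilt \<theta> left free since each dyadic block needs its own.\<close>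

lemma prob_discrepancy_pair:
  assumes "S \<subseteq> {..<n}" "T \<subseteq> {..<n}" "0 \<le> \<theta>"
  shows "measure_pmf.prob P {f. m * (real (card S) * real (card T)) * exp \<theta> + u \<le> \<theta> * (\<Sum>i\<in>S. \<Sum>j\<in>T. X f i j)} \<le> exp (- u)"
proof -
  define g :: "nat \<Rightarrow> nat \<Rightarrow> real" where "g i j = \<theta> * of_bool (i \<in> S \<and> j \<in> T)" for i j :: nat
  let ?G = "\<lambda>i j. of_bool (i \<in> S) * (of_bool (j \<in> T) * exp \<theta>)"
  have fin: "finite S" "finite T" using assms finite_subset by blast+
  have ST: "(\<Sum>i<n. of_bool (i \<in> S) * H i) = (\<Sum>i\<in>S. H i)" "(\<Sum>i<n. of_bool (i \<in> T) * H i) = (\<Sum>i\<in>T. H i)" for H :: "nat \<Rightarrow> real"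
    using assms by (simp_all add: Int_absorb1)
  have "(\<Sum>e\<in>edge_set n L. \<pi> e * (exp (case e of (l, i, j) \<Rightarrow> \<alpha> l * g i j) - 1))
      \<le> m * (\<Sum>i<n. \<Sum>j<n. of_bool (i < j) * ?G i j)"
    by (rule exp_tail_weights) (auto simp: g_def)
  also have "\<dots> \<le> m * (\<Sum>i<n. \<Sum>j<n. ?G i j)"
    using m_nonneg by (intro mult_left_mono sum_mono) auto
  also have "(\<Sum>i<n. \<Sum>j<n. ?G i j) = real (card S) * real (card T) * exp \<theta>"
    unfolding sum_distrib_left[symmetric] ST by simp
  finally have "measure_pmf.prob P {f. m * (real (card S) * real (card T)) * exp \<theta> + u \<le> bsum (edge_set n L) (\<lambda>(l, i, j). \<alpha> l * g i j) f}
     \<le> exp (m * (real (card S) * real (card T)) * exp \<theta> - (m * (real (card S) * real (card T)) * exp \<theta> + u))"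
    by (intro chernoff_bern finite_edge_set \<pi>01) (auto simp: mult.assoc)
  moreover have "bsum (edge_set n L) (\<lambda>(l, i, j). \<alpha> l * g i j) f = \<theta> * (\<Sum>i\<in>S. \<Sum>j\<in>T. X f i j)" for f
  proof -
    have "(\<Sum>i<n. \<Sum>j<n. g i j * X f i j) = (\<Sum>i<n. of_bool (i \<in> S) * (\<Sum>j<n. of_bool (j \<in> T) * (\<theta> * X f i j)))"
      unfolding sum_distrib_left by (intro sum.cong refl) (simp add: g_def)
    then show ?thesis unfolding bsum_X ST by (simp only: sum_distrib_left)
  qed
  ultimately show ?thesis by simp
qed

subsection \<open>Trimmed vertices\<close>

definition degree_sum :: "(nat \<times> nat \<times> nat \<Rightarrow> bool) \<Rightarrow> nat \<Rightarrow> real" where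
  "degree_sum f i = (\<Sum>j<n. X f i j + X f j i)"

lemma sum_degree_sum:
  "S \<subseteq> {..<n} \<Longrightarrow> (\<Sum>i\<in>S. degree_sum f i) = (\<Sum>i<n. \<Sum>j<n. (of_bool (i \<in> S) + of_bool (j \<in> S)) * X f i j)"
proof -
  assume S: "S \<subseteq> {..<n}"
  then have e: "(\<Sum>i\<in>S. H i) = (\<Sum>i<n. of_bool (i \<in> S) * H i)" for H :: "nat \<Rightarrow> real"
    by (simp add: Int_absorb1)
  have "(\<Sum>i\<in>S. degree_sum f i) = (\<Sum>i<n. \<Sum>j<n. of_bool (i \<in> S) * X f i j) + (\<Sum>i<n. \<Sum>j<n. of_bool (i \<in> S) * X f j i)"
    unfolding e degree_sum_def sum.distrib distrib_left sum_distrib_left ..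
  also have "(\<Sum>i<n. \<Sum>j<n. of_bool (i \<in> S) * X f j i) = (\<Sum>i<n. \<Sum>j<n. of_bool (j \<in> S) * X f i j)"
    by (rule sum.swap)
  finally show ?thesis by (simp only: distrib_right sum.distrib)
qed

text \<open>Each endpoint in \<open>S\<close> counts 1/2, so coefficients stay in [0,1] and exp is
  linearised by convexity. The exponent is at most (e - 1 - \<gamma>) d |S| / 2, and \<gamma> \<ge>
  e leaves - d |S| / 2.\<close>

lemma prob_degree_set:
  assumes S: "S \<subseteq> {..<n}" and \<gamma>: "exp 1 \<le> \<gamma>"
  shows "measure_pmf.prob P {f. \<gamma> * (real n * m) * real (card S) \<le> (\<Sum>i\<in>S. degree_sum f i)}
    \<le> exp (- (real n * m * real (card S) / 2))"
proof -
  define g :: "nat \<Rightarrow> nat \<Rightarrow> real" where "g i j = (1/2) * (of_bool (i \<in> S) + of_bool (j \<in> S))" for i j :: nat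
  let ?G = "\<lambda>i j. g i j * (exp 1 - 1)"
  define d where "d = real n * m"
  have d0: "0 \<le> d" using m_nonneg by (simp add: d_def)
  have e1: "exp (1::real) \<ge> 1" by simp
  have "(\<Sum>e\<in>edge_set n L. \<pi> e * (exp (case e of (l, i, j) \<Rightarrow> \<alpha> l * g i j) - 1))
      \<le> m * (\<Sum>i<n. \<Sum>j<n. of_bool (i < j) * ?G i j)"
  proof (rule exp_tail_weights)
    fix i j
    have "0 \<le> g i j" "g i j \<le> 1" by (auto simp: g_def)
    then show "0 \<le> ?G i j" "exp (g i j) - 1 \<le> ?G i j"
      using exp_convex_combination[of "g i j" 1] e1 by auto
  qed
  also have "(\<Sum>i<n. \<Sum>j<n. of_bool (i < j) * ?G i j) \<le> (exp 1 - 1) / 2 * (real (card S) * real n)"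
  proof -
    have t: "(\<Sum>i<n. \<Sum>j<n. of_bool (i < j) * ?G i j) = (exp 1 - 1) / 2 *
        ((\<Sum>i<n. \<Sum>j<n. of_bool (i < j) * of_bool (i \<in> S)) + (\<Sum>i<n. \<Sum>j<n. of_bool (i < j) * of_bool (j \<in> S)))"
      unfolding sum.distrib[symmetric] sum_distrib_left by (intro sum.cong refl) (simp add: g_def algebra_simps)
    have "(\<Sum>i<n. \<Sum>j<n. of_bool (i < j) * of_bool (j \<in> S)) = (\<Sum>i<n. \<Sum>j<n. of_bool (j < i) * of_bool (i \<in> S) :: real)"
      by (rule sum.swap)
    then have "(\<Sum>i<n. \<Sum>j<n. of_bool (i < j) * of_bool (i \<in> S)) + (\<Sum>i<n. \<Sum>j<n. of_bool (i < j) * of_bool (j \<in> S) :: real)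
      = (\<Sum>i<n. \<Sum>j<n. of_bool (i < j) * of_bool (i \<in> S) + of_bool (j < i) * of_bool (i \<in> S))"
      by (simp only: sum.distrib)
    also have "\<dots> \<le> (\<Sum>i<n. \<Sum>j<n. of_bool (i \<in> S))" by (intro sum_mono) auto
    also have "\<dots> = real (card S) * real n"
      using S by (simp add: Int_absorb1 mult.commute flip: sum_distrib_left)
    finally show ?thesis unfolding t using e1 by (intro mult_left_mono) auto
  qed
  also have "m * ((exp 1 - 1) / 2 * (real (card S) * real n)) = (exp 1 - 1) / 2 * (d * real (card S))" by (simp add: d_def)
  finally have "measure_pmf.prob P {f. \<gamma> * d * real (card S) / 2 \<le> bsum (edge_set n L) (\<lambda>(l, i, j). \<alpha> l * g i j) f}
     \<le> exp ((exp 1 - 1) / 2 * (d * real (card S)) - \<gamma> * d * real (card S) / 2)"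
    using m_nonneg by (intro chernoff_bern finite_edge_set \<pi>01) (auto intro: order_trans mult_left_mono)
  also have "\<dots> \<le> exp (- (d * real (card S) / 2))"
  proof -
    have "exp 1 * (d * real (card S)) \<le> \<gamma> * (d * real (card S))" using \<gamma> d0 by (intro mult_right_mono) auto
    moreover have "(exp 1 - 1) / 2 * (d * real (card S)) - \<gamma> * d * real (card S) / 2
      = (exp 1 * (d * real (card S)) - \<gamma> * (d * real (card S))) / 2 - d * real (card S) / 2"
      by (simp add: field_simps)
    ultimately show ?thesis by simp
  qed
  finally have "measure_pmf.prob P {f. \<gamma> * d * real (card S) / 2 \<le> bsum (edge_set n L) (\<lambda>(l, i, j). \<alpha> l * g i j) f}
     \<le> exp (- (d * real (card S) / 2))" .
  moreover have "bsum (edge_set n L) (\<lambda>(l, i, j). \<alpha> l * g i j) f = (\<Sum>i\<in>S. degree_sum f i) / 2" for f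
    unfolding bsum_X sum_degree_sum[OF S] sum_divide_distrib by (intro sum.cong refl) (simp add: g_def)
  ultimately show ?thesis by (simp add: d_def)
qed

definition trimmed :: "real \<Rightarrow> (nat \<times> nat \<times> nat \<Rightarrow> bool) \<Rightarrow> nat set" where
  "trimmed \<gamma> f = {i. i < n \<and> \<gamma> * (real n * m) < degree_sum f i}"

text \<open>If too many vertices were trimmed, some set of exactly s of them, s about n / d, would
  have excessive total degree. Fixing the size makes the union bound cheap: the entropy costs at
  most half of the exponent d s / 2.\<close>

lemma prob_trimmed:
  assumes d: "24 \<le> real n * m" and \<gamma>: "exp 1 \<le> \<gamma>"
  shows "measure_pmf.prob P {f. real n \<le> real n * m * real (card (trimmed \<gamma> f))} \<le> exp (- (real n / 4))"
proof -
  define d where "d = real n * m"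
  define s where "s = nat \<lceil>real n / d\<rceil>"
  have d24: "24 \<le> d" using d by (simp add: d_def)
  have nd: "0 < real n / d" "real n / d \<le> real n" using n d24 by (auto simp: divide_le_eq)
  have s1: "1 \<le> s" "real n / d \<le> real s" "s \<le> n" using nd by (auto simp: s_def) linarith+
  have sd: "real n \<le> d * real s" using s1(2) d24 by (simp add: divide_le_eq mult.commute)
  \<comment> \<open>Splitting off ln 8 gives 1 + ln d \<le> d / 8 + 3, which is at most d / 4 from d
    = 24 on; this is the origin of the threshold 24.\<close>
  have ent: "entropy_bound n s \<le> real s * (d / 4)"
  proof -
    have "real n / real s \<le> d" using sd s1 by (simp add: divide_le_eq)
    then have "ln (real n / real s) \<le> ln d" using n s1 by (subst ln_le_cancel_iff) (auto intro: less_le_trans[OF _ d24])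
    also have "ln d = ln (d / 8) + ln 8" using d24 by (simp add: ln_div)
    also have "ln (d / 8) \<le> d / 8 - 1" using d24 by (intro ln_le_minus_one) auto
    also have "ln (8::real) = 3 * ln 2" using ln_realpow[of "2::real" 3] by simp
    also have "ln (2::real) \<le> 1" using ln_le_minus_one[of "2::real"] by simp
    finally have "1 + ln (real n / real s) \<le> d / 4" using d24 by simp
    then show ?thesis unfolding entropy_bound_def by (intro mult_left_mono) auto
  qed
  have sub: "{f. real n \<le> real n * m * real (card (trimmed \<gamma> f))}
     \<subseteq> (\<Union>S\<in>{S. S \<subseteq> {..<n} \<and> card S = s}. {f. \<gamma> * (real n * m) * real (card S) \<le> (\<Sum>i\<in>S. degree_sum f i)})"
  proof
    fix f assume "f \<in> {f. real n \<le> real n * m * real (card (trimmed \<gamma> f))}"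
    then have "real n \<le> d * real (card (trimmed \<gamma> f))" by (simp add: d_def)
    then have "real n / d \<le> real (card (trimmed \<gamma> f))" using d24 by (simp add: divide_le_eq mult.commute)
    then have "s \<le> card (trimmed \<gamma> f)" unfolding s_def by linarith
    then obtain S where S: "S \<subseteq> trimmed \<gamma> f" "card S = s" using obtain_subset_with_card_n by metis
    have "(\<Sum>i\<in>S. \<gamma> * (real n * m)) \<le> (\<Sum>i\<in>S. degree_sum f i)"
      using S(1) by (intro sum_mono) (auto simp: trimmed_def)
    moreover have "S \<subseteq> {..<n}" using S(1) by (auto simp: trimmed_def)
    ultimately show "f \<in> (\<Union>S\<in>{S. S \<subseteq> {..<n} \<and> card S = s}. {f. \<gamma> * (real n * m) * real (card S) \<le> (\<Sum>i\<in>S. degree_sum f i)})"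
      using S(2) by (auto simp: mult_ac)
  qed
  have "measure_pmf.prob P {f. real n \<le> real n * m * real (card (trimmed \<gamma> f))}
    \<le> measure_pmf.prob P (\<Union>S\<in>{S. S \<subseteq> {..<n} \<and> card S = s}. {f. \<gamma> * (real n * m) * real (card S) \<le> (\<Sum>i\<in>S. degree_sum f i)})"
    by (rule measure_pmf.finite_measure_mono[OF sub]) simp
  also have "\<dots> \<le> (\<Sum>S\<in>{S. S \<subseteq> {..<n} \<and> card S = s}. exp (- (d * real s / 2)))"
  proof (rule prob_union_bound)
    fix S assume "S \<in> {S. S \<subseteq> {..<n} \<and> card S = s}"
    then show "measure_pmf.prob P {f. \<gamma> * (real n * m) * real (card S) \<le> (\<Sum>i\<in>S. degree_sum f i)} \<le> exp (- (d * real s / 2))"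
      using prob_degree_set[of S \<gamma>] \<gamma> by (auto simp: d_def)
  qed simp
  also have "\<dots> = real (n choose s) * exp (- (d * real s / 2))" by (simp add: n_subsets)
  also have "\<dots> \<le> exp (real s * (d / 4)) * exp (- (d * real s / 2))"
    using binomial_le_exp_entropy[OF s1(1,3)] ent by (intro mult_right_mono) (auto intro: order_trans)
  also have "\<dots> = exp (- (d * real s / 4))" by (simp flip: exp_add)
  also have "\<dots> \<le> exp (- (real n / 4))" using sd by simp
  finally show ?thesis .
qed

section \<open>Union bounds and the norm of the centred graph\<close>

definition light_bad :: "(nat \<times> nat \<times> nat \<Rightarrow> bool) \<Rightarrow> bool" where
  "light_bad f \<longleftrightarrow> (\<exists>k\<in>int_grid n. \<exists>h\<in>int_grid n. 56 * real n * sqrt (real n * m)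
      < (\<Sum>i<n. \<Sum>j<n. of_bool (light (sqrt (real n * m)) k h i j)
      * (real_of_int (k i) * real_of_int (h j) * (X f i j - M i j))))"

lemma prob_light_bad:
  assumes "0 < m"
  shows "measure_pmf.prob P {f. light_bad f} \<le> exp (- real n)"
proof -
  let ?E = "\<lambda>(k, h). {f. 56 * real n * sqrt (real n * m)
      < (\<Sum>i<n. \<Sum>j<n. of_bool (light (sqrt (real n * m)) k h i j)
      * (real_of_int (k i) * real_of_int (h j) * (X f i j - M i j)))}"
  have "{f. light_bad f} = (\<Union>kh\<in>int_grid n \<times> int_grid n. ?E kh)" by (auto simp: light_bad_def)
  then have "measure_pmf.prob P {f. light_bad f} \<le> (\<Sum>kh\<in>int_grid n \<times> int_grid n. exp (- (13 * real n)))"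
    using prob_light_pair[OF _ _ assms] by (simp only:) (intro prob_union_bound finite_cartesian_product finite_int_grid, auto)
  also have "\<dots> = real (card (int_grid n)) * real (card (int_grid n)) * exp (- (13 * real n))" by (simp add: card_cartesian_product)
  also have "\<dots> \<le> exp (6 * real n) * exp (6 * real n) * exp (- (13 * real n))"
    by (intro mult_right_mono mult_mono card_int_grid) auto
  also have "\<dots> = exp (- real n)" by (simp flip: exp_add)
  finally show ?thesis .
qed

definition discrepancy_bad :: "real \<Rightarrow> (nat \<times> nat \<times> nat \<Rightarrow> bool) \<Rightarrow> bool" where
  "discrepancy_bad R f \<longleftrightarrow> (\<exists>S\<in>Pow {..<n} - {{}}. \<exists>T\<in>Pow {..<n} - {{}}. \<exists>N\<in>{..2 * n}.
     m * (real (card S) * real (card T)) * exp (tilt (sqrt (real n * m)) N)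
     + R * (entropy_bound n (card S) + entropy_bound n (card T))
     \<le> tilt (sqrt (real n * m)) N * (\<Sum>i\<in>S. \<Sum>j\<in>T. X f i j))"

lemma prob_discrepancy_bad:
  assumes "1 \<le> R"
  shows "measure_pmf.prob P {f. discrepancy_bad R f} \<le> (2 * real n + 1) * (real n powr (2 - R))\<^sup>2"
proof -
  let ?D = "Pow {..<n} - {{}} :: nat set set"
  let ?t = "tilt (sqrt (real n * m))"
  let ?H = "\<lambda>S. exp (- (R * entropy_bound n (card S)))"
  let ?E = "\<lambda>(S, T, N). {f. m * (real (card S) * real (card T)) * exp (?t N)
     + R * (entropy_bound n (card S) + entropy_bound n (card T)) \<le> ?t N * (\<Sum>i\<in>S. \<Sum>j\<in>T. X f i j)}"
  have "{f. discrepancy_bad R f} = (\<Union>x\<in>?D \<times> ?D \<times> {..2 * n}. ?E x)" by (auto simp: discrepancy_bad_def)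
  then have "measure_pmf.prob P {f. discrepancy_bad R f} = measure_pmf.prob P (\<Union>x\<in>?D \<times> ?D \<times> {..2 * n}. ?E x)" by simp
  also have "\<dots> \<le> (\<Sum>x\<in>?D \<times> ?D \<times> {..2 * n}. case x of (S, T, N) \<Rightarrow> ?H S * ?H T)"
  proof (rule prob_union_bound)
    fix x assume "x \<in> ?D \<times> ?D \<times> {..2 * n}"
    then obtain S T N where x: "x = (S, T, N)" "S \<subseteq> {..<n}" "T \<subseteq> {..<n}" by auto
    have "?t N \<ge> 0" by (simp add: tilt_def)
    from prob_discrepancy_pair[OF x(2,3) this, of "R * (entropy_bound n (card S) + entropy_bound n (card T))"]
    show "measure_pmf.prob P (?E x) \<le> (case x of (S, T, N) \<Rightarrow> ?H S * ?H T)"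
      by (simp add: x(1) algebra_simps flip: exp_add)
  qed auto
  also have "\<dots> = (\<Sum>S\<in>?D. \<Sum>T\<in>?D. \<Sum>N\<in>{..2 * n}. ?H S * ?H T)"
    by (simp only: sum.cartesian_product case_prod_unfold)
  also have "\<dots> = (2 * real n + 1) * ((\<Sum>S\<in>?D. ?H S) * (\<Sum>T\<in>?D. ?H T))"
    by (simp add: sum_product sum_distrib_left mult_ac add.commute)
  also have "\<dots> \<le> (2 * real n + 1) * (real n powr (2 - R) * real n powr (2 - R))"
    using sum_exp_neg_entropy[OF assms n] by (intro mult_left_mono mult_mono sum_nonneg) auto
  finally show ?thesis by (simp add: power2_eq_square)
qed

text \<open>Light pairs are covered by the Bernstein event. On heavy pairs signs are dropped, and
  the random part and its mean are bounded separately. Trimming enters because k and h vanish on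
  high-degree vertices, so the rows and columns that occur obey the degree bound. The constant is 56
  + 192 + 16 = 264.\<close>

lemma grid_form_bound:
  assumes d: "1 \<le> real n * m" and R: "0 \<le> R" and \<gamma>: "0 \<le> \<gamma>"
    and nl: "\<not> light_bad f" and nd: "\<not> discrepancy_bad R f"
    and k: "k \<in> int_grid n" and h: "h \<in> int_grid n"
    and kJ: "\<forall>i<n. i \<in> trimmed \<gamma> f \<longrightarrow> k i = 0" and hJ: "\<forall>i<n. i \<in> trimmed \<gamma> f \<longrightarrow> h i = 0"
  shows "(\<Sum>i<n. \<Sum>j<n. real_of_int (k i) * real_of_int (h j) * (X f i j - M i j))
     \<le> (16 * \<gamma> + 264 + 3072 * R) * sqrt (real n * m) * real n"
proof -
  define Q where "Q = sqrt (real n * m)"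
  have Q1: "1 \<le> Q" using d by (simp add: Q_def)
  have Q2: "Q\<^sup>2 = real n * m" using d by (simp add: Q_def)
  have mQ: "m = Q\<^sup>2 / real n" using n by (simp add: Q2)
  define x where "x i = nat \<bar>k i\<bar>" for i
  define y where "y i = nat \<bar>h i\<bar>" for i
  define F where "F i j = real_of_int (k i) * real_of_int (h j) * (X f i j - M i j)" for i j
  let ?heavy = "\<lambda>i j. 0 < x i \<and> 0 < y j \<and> Q < 2 ^ (floor_log (x i) + floor_log (y j))"
  have xk: "real (x i) = \<bar>real_of_int (k i)\<bar>" "real (y i) = \<bar>real_of_int (h i)\<bar>" for i by (auto simp: x_def y_def)
  have x: "(\<Sum>i<n. (real (x i))\<^sup>2) \<le> 4 * real n" using k by (simp add: xk int_grid_def)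
  have y: "(\<Sum>i<n. (real (y i))\<^sup>2) \<le> 4 * real n" using h by (simp add: xk int_grid_def)
  have Lp: "(\<Sum>i<n. \<Sum>j<n. of_bool (light Q k h i j) * F i j) \<le> 56 * real n * Q"
    using nl k h unfolding light_bad_def F_def Q_def by (meson not_less)
  have deg: "(\<Sum>j<n. X f i j) \<le> \<gamma> * Q\<^sup>2" "(\<Sum>j<n. X f j i) \<le> \<gamma> * Q\<^sup>2" if "i < n" "i \<notin> trimmed \<gamma> f" for i
  proof -
    have "(\<Sum>j<n. X f i j) + (\<Sum>j<n. X f j i) \<le> \<gamma> * Q\<^sup>2"
      using that unfolding Q2 by (simp add: trimmed_def degree_sum_def sum.distrib)
    moreover have "0 \<le> (\<Sum>j<n. X f i j)" "0 \<le> (\<Sum>j<n. X f j i)" by (auto intro!: sum_nonneg X_nonneg)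
    ultimately show "(\<Sum>j<n. X f i j) \<le> \<gamma> * Q\<^sup>2" "(\<Sum>j<n. X f j i) \<le> \<gamma> * Q\<^sup>2" by linarith+
  qed
  have H: "(\<Sum>i<n. \<Sum>j<n. of_bool (?heavy i j) * (real (x i) * real (y j) * X f i j))
     \<le> (16 * \<gamma> + 192 + 3072 * R) * real n * Q"
  proof (rule heavy_pairs_bound[OF n Q1 R \<gamma> X_nonneg x y])
    show "(\<Sum>j<n. X f i j) \<le> \<gamma> * Q\<^sup>2" if "i < n" "0 < x i" for i
      using that kJ by (intro deg) (auto simp: x_def)
    show "(\<Sum>i<n. X f i j) \<le> \<gamma> * Q\<^sup>2" if "j < n" "0 < y j" for j
      using that hJ by (intro deg) (auto simp: y_def)
    fix S T :: "nat set" and N :: nat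
    assume "S \<subseteq> {..<n}" "T \<subseteq> {..<n}" "S \<noteq> {}" "T \<noteq> {}" "N \<le> 2 * n"
    then have "S \<in> Pow {..<n} - {{}}" "T \<in> Pow {..<n} - {{}}" "N \<in> {..2 * n}" by auto
    then have "\<not> (m * (real (card S) * real (card T)) * exp (tilt Q N)
     + R * (entropy_bound n (card S) + entropy_bound n (card T)) \<le> tilt Q N * (\<Sum>i\<in>S. \<Sum>j\<in>T. X f i j))"
      using nd unfolding discrepancy_bad_def Q_def by blast
    then show "tilt Q N * (\<Sum>i\<in>S. \<Sum>j\<in>T. X f i j) \<le> Q\<^sup>2 / real n * (real (card S) * real (card T)) * exp (tilt Q N)
            + R * (entropy_bound n (card S) + entropy_bound n (card T))"
      unfolding mQ by linarith
  qed
  \<comment> \<open>On heavy pairs x y \<ge> Q, hence x y \<le> (x y)^2 / Q; with M \<le> m this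
    leaves 16 n^2 m / Q = 16 n Q.\<close>
  have Mp: "(\<Sum>i<n. \<Sum>j<n. of_bool (?heavy i j) * (real (x i) * real (y j) * M i j)) \<le> 16 * real n * Q"
  proof -
    have "(\<Sum>i<n. \<Sum>j<n. of_bool (?heavy i j) * (real (x i) * real (y j) * M i j))
       \<le> (\<Sum>i<n. \<Sum>j<n. (real (x i))\<^sup>2 * (real (y j))\<^sup>2 * (m / Q))"
    proof (intro sum_mono)
      fix i j assume ij: "i \<in> {..<n}" "j \<in> {..<n}"
      show "of_bool (?heavy i j) * (real (x i) * real (y j) * M i j) \<le> (real (x i))\<^sup>2 * (real (y j))\<^sup>2 * (m / Q)"
      proof (cases "?heavy i j")
        case True
        have "Q \<le> 2 ^ floor_log (x i) * 2 ^ floor_log (y j)" using True by (simp add: power_add)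
        also have "\<dots> \<le> real (x i) * real (y j)"
          using True ij by (intro mult_mono level_bounds(1)[where n = n]) (auto simp: level_def)
        finally have "real (x i) * real (y j) * Q \<le> real (x i) * real (y j) * (real (x i) * real (y j))"
          by (intro mult_left_mono) auto
        then have "real (x i) * real (y j) \<le> (real (x i))\<^sup>2 * (real (y j))\<^sup>2 / Q"
          using Q1 by (simp add: le_divide_eq power2_eq_square mult_ac)
        then have "real (x i) * real (y j) * M i j \<le> (real (x i))\<^sup>2 * (real (y j))\<^sup>2 / Q * m"
          using M_bounds[of i j] Q1 by (intro mult_mono) auto
        then show ?thesis using True by simp
      next
        case False
        then have z: "of_bool (?heavy i j) = (0::real)" by (subst of_bool_eq_0_iff)
        show ?thesis unfolding z using m_nonneg Q1 by simp
      qed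
    qed
    also have "\<dots> = (\<Sum>i<n. (real (x i))\<^sup>2) * (\<Sum>j<n. (real (y j))\<^sup>2) * (m / Q)"
      unfolding sum_product by (simp only: sum_distrib_right)
    also have "\<dots> \<le> (4 * real n) * (4 * real n) * (m / Q)"
      using x y m_nonneg Q1 by (intro mult_right_mono mult_mono sum_nonneg) auto
    also have "\<dots> = 16 * real n * Q" using n Q1 by (simp add: mQ power2_eq_square)
    finally show ?thesis .
  qed
  have "(\<Sum>i<n. \<Sum>j<n. F i j) \<le> (\<Sum>i<n. \<Sum>j<n. of_bool (light Q k h i j) * F i j
      + (of_bool (?heavy i j) * (real (x i) * real (y j) * X f i j) + of_bool (?heavy i j) * (real (x i) * real (y j) * M i j)))"
  proof (intro sum_mono)
    fix i j
    have "F i j \<le> \<bar>F i j\<bar>" by simp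
    also have "\<dots> = real (x i) * real (y j) * \<bar>X f i j - M i j\<bar>" by (simp add: F_def xk abs_mult)
    also have "\<dots> \<le> real (x i) * real (y j) * (X f i j + M i j)"
      using X_nonneg[of f i j] M_bounds[of i j] by (intro mult_left_mono) auto
    finally have "F i j \<le> real (x i) * real (y j) * (X f i j + M i j)" .
    then show "F i j \<le> of_bool (light Q k h i j) * F i j
      + (of_bool (?heavy i j) * (real (x i) * real (y j) * X f i j) + of_bool (?heavy i j) * (real (x i) * real (y j) * M i j))"
    proof (cases "?heavy i j")
      case True
      then show ?thesis using \<open>F i j \<le> real (x i) * real (y j) * (X f i j + M i j)\<close>
        by (simp add: light_def x_def y_def distrib_left)
    next
      case False
      then have z: "of_bool (?heavy i j) = (0::real)" by (subst of_bool_eq_0_iff)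
      have "light Q k h i j" using False by (simp add: light_def x_def y_def)
      then show ?thesis unfolding z by simp
    qed
  qed
  also have "\<dots> \<le> 56 * real n * Q + ((16 * \<gamma> + 192 + 3072 * R) * real n * Q + 16 * real n * Q)"
    unfolding sum.distrib by (intro add_mono Lp H Mp)
  also have "\<dots> = (16 * \<gamma> + 264 + 3072 * R) * Q * real n" by (simp add: algebra_simps)
  finally show ?thesis by (simp only: F_def Q_def)
qed

text \<open>The trimmed set depends on the edges. The light and discrepancy events are therefore
  controlled uniformly over the full grid and over all vertex sets; the restriction to vectors
  vanishing on the trimmed set is made only afterwards, for a fixed outcome.\<close>

theorem edge_concentration:
  assumes d: "24 \<le> real n * m" and \<gamma>: "exp 1 \<le> \<gamma>" and R: "1 \<le> R"
  shows "measure_pmf.prob P {f. \<not> (real n * m * real (card (trimmed \<gamma> f)) \<le> real n \<and>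
      op_bound n (\<lambda>i j. if i \<notin> trimmed \<gamma> f \<and> j \<notin> trimmed \<gamma> f then X f i j - M i j else 0)
        ((16 * \<gamma> + 264 + 3072 * R) * sqrt (real n * m)))}
    \<le> exp (- (real n / 4)) + exp (- real n) + (2 * real n + 1) * (real n powr (2 - R))\<^sup>2"
    (is "measure_pmf.prob P ?B \<le> _")
proof -
  have m0: "0 < m" using d n by (metis less_le_trans mult_zero_right not_less of_nat_0_less_iff zero_less_numeral m_nonneg order_le_less)
  have g0: "0 \<le> \<gamma>" using \<gamma> by (meson exp_ge_zero order_trans)
  have sub: "?B \<subseteq> {f. real n \<le> real n * m * real (card (trimmed \<gamma> f))} \<union> ({f. light_bad f} \<union> {f. discrepancy_bad R f})"
  proof (rule ccontr)
    assume "\<not> ?thesis"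
    then obtain f where f: "f \<in> ?B" "\<not> real n \<le> real n * m * real (card (trimmed \<gamma> f))" "\<not> light_bad f" "\<not> discrepancy_bad R f"
      by blast
    have "op_bound n (\<lambda>i j. if i \<in> - trimmed \<gamma> f \<and> j \<in> - trimmed \<gamma> f then X f i j - M i j else 0)
        ((16 * \<gamma> + 264 + 3072 * R) * sqrt (real n * m))"
    proof (rule op_bound_from_grid[OF n])
      show "0 \<le> (16 * \<gamma> + 264 + 3072 * R) * sqrt (real n * m)" using g0 R m0 by auto
    next
      fix k h assume kh: "k \<in> int_grid n" "h \<in> int_grid n" "\<forall>i<n. i \<notin> - trimmed \<gamma> f \<longrightarrow> k i = 0" "\<forall>i<n. i \<notin> - trimmed \<gamma> f \<longrightarrow> h i = 0"
      show "(\<Sum>i<n. \<Sum>j<n. real_of_int (k i) * real_of_int (h j) * (X f i j - M i j))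
          \<le> (16 * \<gamma> + 264 + 3072 * R) * sqrt (real n * m) * real n"
        using kh d R g0 f by (intro grid_form_bound) auto
    qed
    then show False using f by simp
  qed
  have "measure_pmf.prob P ?B \<le> measure_pmf.prob P ({f. real n \<le> real n * m * real (card (trimmed \<gamma> f))} \<union> ({f. light_bad f} \<union> {f. discrepancy_bad R f}))"
    by (rule measure_pmf.finite_measure_mono[OF sub]) simp
  also have "\<dots> \<le> measure_pmf.prob P {f. real n \<le> real n * m * real (card (trimmed \<gamma> f))}
      + (measure_pmf.prob P {f. light_bad f} + measure_pmf.prob P {f. discrepancy_bad R f})"
    by (intro order_trans[OF measure_Un_le] add_left_mono measure_Un_le) auto
  also have "\<dots> \<le> exp (- (real n / 4)) + (exp (- real n) + (2 * real n + 1) * (real n powr (2 - R))\<^sup>2)"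
    by (intro add_mono prob_trimmed[OF d \<gamma>] prob_light_bad[OF m0] prob_discrepancy_bad[OF R])
  finally show ?thesis by simp
qed

end

section \<open>Label fluctuations\<close>

definition col :: "nat \<Rightarrow> (nat \<Rightarrow> real) \<Rightarrow> real \<Rightarrow> (nat \<times> nat \<Rightarrow> bool) \<Rightarrow> nat \<Rightarrow> real" where
  "col L \<sigma> \<rho> f j = (\<Sum>l<L. \<sigma> l * (of_bool (f (l, j)) - \<rho>))"

abbreviation grid :: "nat \<Rightarrow> nat set \<Rightarrow> (nat \<times> nat) set" where
  "grid L J \<equiv> {0..<L} \<times> J"

lemma sum_column:
  fixes H :: "nat \<times> nat \<Rightarrow> real"
  assumes "finite J" "j \<in> J" "\<And>l k. k \<noteq> j \<Longrightarrow> H (l, k) = 0"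
  shows "(\<Sum>e\<in>grid L J. H e) = (\<Sum>l<L. H (l, j))"
proof -
  have "(\<Sum>e\<in>grid L J. H e) = (\<Sum>l\<in>{0..<L}. \<Sum>k\<in>J. H (l, k))" by (simp add: sum.cartesian_product)
  also have "\<dots> = (\<Sum>l\<in>{0..<L}. H (l, j))"
  proof (rule sum.cong)
    fix l
    have "(\<Sum>k\<in>J. H (l, k)) = (\<Sum>k\<in>{j}. H (l, k))" using assms by (intro sum.mono_neutral_right) auto
    then show "(\<Sum>k\<in>J. H (l, k)) = H (l, j)" by simp
  qed simp
  finally show ?thesis by (simp add: lessThan_atLeast0)
qed

definition col_weight :: "nat \<Rightarrow> real \<Rightarrow> (nat \<Rightarrow> real) \<Rightarrow> nat \<times> nat \<Rightarrow> real" where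
  "col_weight j \<phi> \<sigma> e = (if snd e = j then \<phi> * \<sigma> (fst e) else 0)"

lemma bsum_col_weight:
  assumes "finite J" "j \<in> J"
  shows "bsum (grid L J) (col_weight j \<phi> \<sigma>) f - (\<Sum>e\<in>grid L J. col_weight j \<phi> \<sigma> e * \<rho>) = \<phi> * col L \<sigma> \<rho> f j"
  unfolding bsum_def
  by (subst (1 2) sum_column[OF assms])
     (simp_all add: col_weight_def col_def sum_distrib_left algebra_simps sum_subtractf
        del: sum_mult_of_bool_eq sum_of_bool_mult_eq)

lemma col_weight_variance:
  assumes "finite J" "j \<in> J" "\<And>l. \<bar>\<sigma> l\<bar> \<le> 1" "0 \<le> \<rho>"
  shows "(\<Sum>e\<in>grid L J. \<rho> * (col_weight j \<phi> \<sigma> e)\<^sup>2) \<le> real L * \<rho> * \<phi>\<^sup>2"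
proof -
  have "(\<Sum>e\<in>grid L J. \<rho> * (col_weight j \<phi> \<sigma> e)\<^sup>2) = (\<Sum>l<L. \<rho> * (\<phi> * \<sigma> l)\<^sup>2)"
    using assms by (subst sum_column[OF assms(1,2)]) (auto simp: col_weight_def)
  also have "\<dots> \<le> (\<Sum>l<L. \<rho> * (\<phi>\<^sup>2 * 1))"
    unfolding power_mult_distrib using assms
    by (intro sum_mono mult_left_mono) (auto simp: abs_square_le_1)
  finally show ?thesis by (simp add: mult_ac)
qed

text \<open>exp x + exp (- x) - 2 is the square of exp (x/2) - exp (- x/2). Serves to read off a
  second moment from the moment generating function.\<close>

lemma exp_plus_exp_neg_ge:
  fixes x :: real
  shows "2 + x\<^sup>2 / 4 \<le> exp x + exp (- x)"
proof -
  have pos: "y \<le> exp y - exp (- y)" if "y \<ge> 0" for y :: real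
  proof -
    have "exp (- y) \<le> 1" using that by simp
    then show ?thesis using exp_ge_add_one_self[of y] by linarith
  qed
  define y where "y = \<bar>x\<bar> / 2"
  have "y\<^sup>2 \<le> (exp y - exp (- y))\<^sup>2" using pos[of y] by (intro power_mono) (auto simp: y_def)
  also have "\<dots> = exp (2 * y) + exp (- (2 * y)) - 2"
    by (simp add: power2_eq_square algebra_simps flip: exp_add)
  also have "\<dots> = exp x + exp (- x) - 2" by (cases "x \<ge> 0") (auto simp: y_def)
  finally show ?thesis by (simp add: y_def power_divide)
qed

text \<open>The variance is extracted from the moment generating function at t and - t, with t^2 = 1
  / (1 + L \<rho>), so that both t \<le> 1 and L \<rho> t^2 \<le> 1 hold and exp can be
  linearised.\<close>

lemma second_moment_col:
  assumes J: "finite J" "j \<in> J" and \<sigma>: "\<And>l. \<bar>\<sigma> l\<bar> \<le> 1" and \<rho>: "0 \<le> \<rho>" "\<rho> \<le> 1"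
  shows "measure_pmf.expectation (bern (grid L J) (\<lambda>_. \<rho>)) (\<lambda>f. (col L \<sigma> \<rho> f j)\<^sup>2) \<le> 16 * (real L * \<rho>)"
proof -
  define lam where "lam = real L * \<rho>"
  have lam0: "lam \<ge> 0" using \<rho> by (simp add: lam_def)
  define t where "t = sqrt (1 / (1 + lam))"
  have t: "0 < t" "t \<le> 1" "t\<^sup>2 = 1 / (1 + lam)" using lam0 by (auto simp: t_def)
  have fin: "finite (grid L J)" using J by auto
  let ?P = "bern (grid L J) (\<lambda>_. \<rho>)"
  let ?Z = "\<lambda>f. col L \<sigma> \<rho> f j"
  have mgf: "measure_pmf.expectation ?P (\<lambda>f. exp (\<phi> * ?Z f)) \<le> exp (lam * \<phi>\<^sup>2)" if "\<bar>\<phi>\<bar> \<le> 1" for \<phi>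
  proof -
    have cw: "\<bar>col_weight j \<phi> \<sigma> e\<bar> \<le> 1" for e
      using mult_mono[OF that \<sigma>[of "fst e"]] by (auto simp: col_weight_def abs_mult)
    have "measure_pmf.expectation ?P (\<lambda>f. exp (bsum (grid L J) (col_weight j \<phi> \<sigma>) f - (\<Sum>e\<in>grid L J. col_weight j \<phi> \<sigma> e * \<rho>)))
      \<le> exp (\<Sum>e\<in>grid L J. \<rho> * (col_weight j \<phi> \<sigma> e)\<^sup>2)"
      using \<rho> by (intro mgf_bern_centered[OF fin] cw) auto
    then have "measure_pmf.expectation ?P (\<lambda>f. exp (\<phi> * ?Z f)) \<le> exp (\<Sum>e\<in>grid L J. \<rho> * (col_weight j \<phi> \<sigma> e)\<^sup>2)"
      unfolding bsum_col_weight[OF J] .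
    also have "\<dots> \<le> exp (lam * \<phi>\<^sup>2)" using col_weight_variance[OF J \<sigma> \<rho>(1), where L = L and \<phi> = \<phi>] by (simp add: lam_def)
    finally show ?thesis .
  qed
  have "measure_pmf.expectation ?P (\<lambda>f. 2 + t\<^sup>2 / 4 * (?Z f)\<^sup>2) \<le> measure_pmf.expectation ?P (\<lambda>f. exp (t * ?Z f) + exp (- t * ?Z f))"
  proof (rule expectation_Pi_bool_mono[OF fin])
    fix f show "2 + t\<^sup>2 / 4 * (?Z f)\<^sup>2 \<le> exp (t * ?Z f) + exp (- t * ?Z f)"
      using exp_plus_exp_neg_ge[of "t * ?Z f"] by (simp add: power_mult_distrib)
  qed
  also have "\<dots> = measure_pmf.expectation ?P (\<lambda>f. exp (t * ?Z f)) + measure_pmf.expectation ?P (\<lambda>f. exp (- t * ?Z f))"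
    by (intro Bochner_Integration.integral_add integrable_Pi_bool fin)
  also have "\<dots> \<le> 2 * exp (lam * t\<^sup>2)" using mgf[of t] mgf[of "- t"] t by simp
  also have "exp (lam * t\<^sup>2) \<le> 1 + 2 * (lam * t\<^sup>2)"
  proof -
    define x where "x = lam * t\<^sup>2"
    have x: "0 \<le> x" "x \<le> 1" using lam0 t by (auto simp: x_def)
    have "x\<^sup>2 \<le> x" using x mult_left_mono[of x 1 x] by (simp add: power2_eq_square)
    then show ?thesis using exp_le_quadratic[of x] x unfolding x_def[symmetric] by simp
  qed
  also have "measure_pmf.expectation ?P (\<lambda>f. 2 + t\<^sup>2 / 4 * (?Z f)\<^sup>2) = 2 + t\<^sup>2 / 4 * measure_pmf.expectation ?P (\<lambda>f. (?Z f)\<^sup>2)"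
    by (subst Bochner_Integration.integral_add) (auto intro!: integrable_Pi_bool fin)
  finally have "t\<^sup>2 / 4 * measure_pmf.expectation ?P (\<lambda>f. (?Z f)\<^sup>2) \<le> t\<^sup>2 / 4 * (16 * lam)" by simp
  then show ?thesis using t(1) by (simp add: lam_def mult.commute)
qed

lemma ln_cube_le: "1 \<le> x \<Longrightarrow> (ln x) ^ 3 \<le> 216 * sqrt x" for x :: real
proof -
  assume x: "1 \<le> x"
  have "ln (x powr (1/6)) \<le> x powr (1/6)" using x ln_le_minus_one[of "x powr (1/6)"] by simp
  then have "ln x \<le> 6 * x powr (1/6)" using x by (simp add: ln_powr)
  then have "(ln x) ^ 3 \<le> (6 * x powr (1/6)) ^ 3" using x by (intro power_mono) auto
  also have "\<dots> = 216 * (x powr (1/6)) ^ 3" by (simp add: power_mult_distrib)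
  also have "(x powr (1/6)) ^ 3 = x powr (1/2)" using x by (simp add: powr_power)
  finally show ?thesis using x by (simp add: powr_half_sqrt)
qed

lemma ln_sq_le: "1 \<le> x \<Longrightarrow> (ln x)\<^sup>2 \<le> 4 * x" for x :: real
proof -
  assume x: "1 \<le> x"
  have "ln (sqrt x) \<le> sqrt x" using x ln_le_minus_one[of "sqrt x"] by simp
  then have "ln x \<le> 2 * sqrt x" using x by (simp add: ln_sqrt)
  then have "(ln x)\<^sup>2 \<le> (2 * sqrt x)\<^sup>2" using x by (intro power_mono) auto
  then show ?thesis using x by (simp add: power_mult_distrib)
qed

text \<open>The truncation level \<open>b\<close> is constant when flips are rare (\<open>n L \<rho> \<le> sqrt n\<close>) and is given by
  Bernstein's inequality otherwise; in both regimes \<open>b\<^sup>2 ln n\<close> is of the order of the mean.\<close>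

lemma col_tail:
  assumes n: "3 \<le> n" and r: "1 \<le> r" and \<rho>: "0 \<le> \<rho>" "\<rho> \<le> 1"
  obtains b where "b > 0" "b\<^sup>2 * ln (real n) \<le> 450 * (r + 1)\<^sup>2 * (real n * (real L * \<rho>) + ln (real n))"
    "\<And>J j \<sigma>. finite J \<Longrightarrow> j \<in> J \<Longrightarrow> (\<And>l. \<bar>\<sigma> l\<bar> \<le> 1) \<Longrightarrow>
       measure_pmf.prob (bern (grid L J) (\<lambda>_. \<rho>)) {f. b < \<bar>col L \<sigma> \<rho> f j\<bar>} \<le> 3 * real n powr (- r)"
proof (cases "real n * (real L * \<rho>) \<le> sqrt (real n)")
  case True
  define lam where "lam = real L * \<rho>"
  have lam0: "lam \<ge> 0" using \<rho> by (simp add: lam_def)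
  have ln0: "ln (real n) > 0" using n by simp
  have ls: "lam * sqrt (real n) \<le> 1"
  proof -
    have "sqrt (real n) * (lam * sqrt (real n)) \<le> sqrt (real n) * 1"
      using True n by (simp add: lam_def mult_ac)
    then show ?thesis using n by (subst (asm) mult_le_cancel_left_pos) auto
  qed
  have "1 \<le> sqrt (real n)" using n by simp
  then have lam1: "lam \<le> 1" using ls lam0 mult_left_mono[of 1 "sqrt (real n)" lam] by linarith
  show ?thesis
  proof (rule that[of "2 * r + 1"])
    show "0 < 2 * r + 1" using r by simp
    have "(2 * r + 1)\<^sup>2 \<le> (2 * (r + 1))\<^sup>2" using r by (intro power_mono) auto
    also have "\<dots> \<le> 450 * (r + 1)\<^sup>2" unfolding power_mult_distrib by (intro mult_right_mono) auto
    finally have "(2 * r + 1)\<^sup>2 \<le> 450 * (r + 1)\<^sup>2" .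
    then have "(2 * r + 1)\<^sup>2 * ln (real n) \<le> 450 * (r + 1)\<^sup>2 * ln (real n)" using ln0 by (intro mult_right_mono) auto
    also have "\<dots> \<le> 450 * (r + 1)\<^sup>2 * (real n * (real L * \<rho>) + ln (real n))"
      using \<rho> by (intro mult_left_mono) auto
    finally show "(2 * r + 1)\<^sup>2 * ln (real n) \<le> 450 * (r + 1)\<^sup>2 * (real n * (real L * \<rho>) + ln (real n))" .
  next
    fix J :: "nat set" and j and \<sigma> :: "nat \<Rightarrow> real"
    assume J: "finite J" "j \<in> J" and \<sigma>: "\<And>l. \<bar>\<sigma> l\<bar> \<le> 1"
    have fin: "finite (grid L J)" using J by auto
    let ?P = "bern (grid L J) (\<lambda>_. \<rho>)"
    \<comment> \<open>Each flip carries exponent ln n / 2, a factor sqrt n; as L \<rho> sqrt n \<le>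
      1, the logarithmic moment generating function stays below 1, and 2 r flips cost
      n^(-r).\<close>
    define c where "c = col_weight j (ln (real n) / 2) (\<lambda>_. 1)"
    have sc: "(\<Sum>e\<in>grid L J. \<rho> * (exp (c e) - 1)) \<le> 1"
    proof -
      have "(\<Sum>e\<in>grid L J. \<rho> * (exp (c e) - 1)) = (\<Sum>l<L. \<rho> * (exp (ln (real n) / 2) - 1))"
        using J by (subst sum_column[OF J]) (auto simp: c_def col_weight_def)
      also have "exp (ln (real n) / 2) = sqrt (real n)"
        using n by (simp add: powr_half_sqrt[symmetric] powr_def)
      also have "(\<Sum>l<L. \<rho> * (sqrt (real n) - 1)) = lam * (sqrt (real n) - 1)" by (simp add: lam_def)
      also have "\<dots> \<le> 1" using ls lam0 by (simp add: algebra_simps)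
      finally show ?thesis .
    qed
    have "measure_pmf.prob ?P {f. b < \<bar>col L \<sigma> \<rho> f j\<bar>} \<le> measure_pmf.prob ?P {f. r * ln (real n) \<le> bsum (grid L J) c f}" if "b = 2 * r + 1" for b
    proof (rule measure_pmf.finite_measure_mono)
      show "{f. b < \<bar>col L \<sigma> \<rho> f j\<bar>} \<subseteq> {f. r * ln (real n) \<le> bsum (grid L J) c f}"
      proof clarify
        fix f assume f: "b < \<bar>col L \<sigma> \<rho> f j\<bar>"
        define N where "N = (\<Sum>l<L. of_bool (f (l, j)) :: real)"
        have "\<bar>col L \<sigma> \<rho> f j\<bar> \<le> (\<Sum>l<L. of_bool (f (l, j)) + \<rho>)"
          unfolding col_def
        proof (rule order_trans[OF sum_abs], rule sum_mono)
          fix l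
          have "\<bar>\<sigma> l * (of_bool (f (l, j)) - \<rho>)\<bar> \<le> 1 * \<bar>of_bool (f (l, j)) - \<rho>\<bar>"
            unfolding abs_mult using \<sigma> by (intro mult_right_mono) auto
          also have "\<dots> \<le> of_bool (f (l, j)) + \<rho>" using \<rho> by auto
          finally show "\<bar>\<sigma> l * (of_bool (f (l, j)) - \<rho>)\<bar> \<le> of_bool (f (l, j)) + \<rho>" .
        qed
        also have "\<dots> = N + lam" by (simp add: N_def lam_def sum.distrib)
        finally have "2 * r \<le> N" using f lam1 that by linarith
        then have "2 * r * (ln (real n) / 2) \<le> N * (ln (real n) / 2)" using ln0 by (intro mult_right_mono) auto
        also have "N * (ln (real n) / 2) = bsum (grid L J) c f"
          unfolding bsum_def using J
          by (subst sum_column[OF J]) (auto simp: c_def col_weight_def N_def sum_distrib_left mult_ac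
            simp del: sum_mult_of_bool_eq sum_of_bool_mult_eq sum_of_bool_eq)
        finally show "r * ln (real n) \<le> bsum (grid L J) c f" by simp
      qed
    qed simp
    also have "measure_pmf.prob ?P {f. r * ln (real n) \<le> bsum (grid L J) c f} \<le> exp (1 - r * ln (real n))"
      using \<rho> sc by (intro chernoff_bern fin) auto
    also have "\<dots> = exp 1 * real n powr (- r)" using n by (simp add: powr_def flip: exp_add)
    also have "\<dots> \<le> 3 * real n powr (- r)" using exp_le by (intro mult_right_mono) auto
    finally show "measure_pmf.prob ?P {f. 2 * r + 1 < \<bar>col L \<sigma> \<rho> f j\<bar>} \<le> 3 * real n powr (- r)" by simp
  qed
next
  case False
  define lam where "lam = real L * \<rho>"
  define lg where "lg = ln (real n)"
  have lg0: "lg > 0" using n by (simp add: lg_def)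
  have nl: "sqrt (real n) < real n * lam" using False by (simp add: lam_def)
  have "0 < real n * lam" using nl real_sqrt_ge_zero[of "real n"] by linarith
  then have lam0: "lam > 0" using n by (simp add: zero_less_mult_iff)
  \<comment> \<open>One unit of \<kappa> pays for the Bernstein variance term, which is at most ln
    n, and r units remain; \<phi> is the Bernstein optimum sqrt (ln n / (L \<rho>)), up to a
    constant, capped at 1.\<close>
  define \<kappa> where "\<kappa> = r + 1"
  define b where "b = \<kappa> * (sqrt (lam * lg) + lg)"
  define \<phi> where "\<phi> = min 1 (sqrt (lg / lam))"
  have \<phi>: "0 < \<phi>" "\<phi> \<le> 1" using lg0 lam0 by (auto simp: \<phi>_def)
  have k0: "\<kappa> > 0" using r by (simp add: \<kappa>_def)
  have v: "lam * \<phi>\<^sup>2 \<le> lg"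
  proof -
    have "\<phi>\<^sup>2 \<le> (sqrt (lg / lam))\<^sup>2" using \<phi> by (intro power_mono) (auto simp: \<phi>_def)
    then have "\<phi>\<^sup>2 \<le> lg / lam" using lg0 lam0 by simp
    then show ?thesis using lam0 by (simp add: le_divide_eq mult.commute)
  qed
  have pb: "\<kappa> * lg \<le> \<phi> * b"
  proof -
    have "lg \<le> \<phi> * (sqrt (lam * lg) + lg)"
    proof (cases "sqrt (lg / lam) \<ge> 1")
      case True
      then have "\<phi> = 1" by (simp add: \<phi>_def)
      then show ?thesis using lg0 lam0 by simp
    next
      case False
      then have "\<phi> = sqrt (lg / lam)" by (simp add: \<phi>_def)
      then have "\<phi> * sqrt (lam * lg) = sqrt ((lg / lam) * (lam * lg))" by (simp only: real_sqrt_mult)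
      also have "(lg / lam) * (lam * lg) = lg\<^sup>2" using lam0 by (simp add: power2_eq_square)
      also have "sqrt (lg\<^sup>2) = lg" using lg0 by simp
      finally show ?thesis using \<phi> lg0 by (simp add: distrib_left)
    qed
    then have "\<kappa> * lg \<le> \<kappa> * (\<phi> * (sqrt (lam * lg) + lg))" using k0 by (intro mult_left_mono) auto
    then show ?thesis by (simp add: b_def mult_ac)
  qed
  show ?thesis
  proof (rule that[of b])
    show "0 < b" unfolding b_def using k0 lg0 lam0 by (intro mult_pos_pos add_nonneg_pos) auto
    have "(sqrt (lam * lg) + lg)\<^sup>2 \<le> 2 * (lam * lg) + 2 * lg\<^sup>2"
    proof -
      have "(sqrt (lam * lg) + lg)\<^sup>2 \<le> 2 * (sqrt (lam * lg))\<^sup>2 + 2 * lg\<^sup>2"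
        using sum_squares_bound[of "sqrt (lam * lg)" lg] by (simp add: power2_sum)
      then show ?thesis using lg0 lam0 by simp
    qed
    then have "b\<^sup>2 * lg \<le> \<kappa>\<^sup>2 * (2 * (lam * lg) + 2 * lg\<^sup>2) * lg"
      unfolding b_def power_mult_distrib using lg0 by (intro mult_right_mono mult_left_mono) auto
    also have "\<dots> = \<kappa>\<^sup>2 * (2 * lam * lg\<^sup>2 + 2 * lg ^ 3)" by (simp add: power2_eq_square power3_eq_cube algebra_simps)
    \<comment> \<open>The cubed logarithm is absorbed because sqrt n < n L \<rho> in this regime; 2
      * 4 + 2 * 216 = 440.\<close>
    also have "\<dots> \<le> \<kappa>\<^sup>2 * (2 * lam * (4 * real n) + 2 * (216 * (real n * lam)))"
    proof (intro mult_left_mono add_mono)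
      show "lg\<^sup>2 \<le> 4 * real n" unfolding lg_def using n by (intro ln_sq_le) auto
      have "lg ^ 3 \<le> 216 * sqrt (real n)" unfolding lg_def using n by (intro ln_cube_le) auto
      then show "lg ^ 3 \<le> 216 * (real n * lam)" using nl by linarith
    qed (use lam0 in auto)
    also have "\<dots> = \<kappa>\<^sup>2 * (440 * (real n * lam))" by (simp add: algebra_simps)
    also have "\<dots> \<le> \<kappa>\<^sup>2 * (450 * (real n * lam + lg))" using lg0 lam0 by (intro mult_left_mono) auto
    finally show "b\<^sup>2 * ln (real n) \<le> 450 * (r + 1)\<^sup>2 * (real n * (real L * \<rho>) + ln (real n))"
      by (simp add: \<kappa>_def lg_def lam_def mult_ac)
  next
    fix J :: "nat set" and j and \<sigma> :: "nat \<Rightarrow> real"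
    assume J: "finite J" "j \<in> J" and \<sigma>: "\<And>l. \<bar>\<sigma> l\<bar> \<le> 1"
    have fin: "finite (grid L J)" using J by auto
    let ?P = "bern (grid L J) (\<lambda>_. \<rho>)"
    have one: "measure_pmf.prob ?P {f. \<phi> * b \<le> \<phi>' * col L \<sigma> \<rho> f j} \<le> real n powr (- r)" if \<phi>': "\<bar>\<phi>'\<bar> = \<phi>" for \<phi>'
    proof -
      have cw: "\<bar>col_weight j \<phi>' \<sigma> e\<bar> \<le> 1" for e
        using mult_mono[of "\<bar>\<phi>'\<bar>" 1 "\<bar>\<sigma> (fst e)\<bar>" 1] \<sigma>[of "fst e"] \<phi> \<phi>' by (auto simp: col_weight_def abs_mult)
      have "(\<Sum>e\<in>grid L J. \<rho> * (col_weight j \<phi>' \<sigma> e)\<^sup>2) \<le> lam * \<phi>'\<^sup>2"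
        unfolding lam_def by (rule col_weight_variance[OF J \<sigma> \<rho>(1)])
      also have "\<phi>'\<^sup>2 = \<phi>\<^sup>2" using \<phi>' by (metis power2_abs)
      also have "lam * \<phi>\<^sup>2 \<le> lg" by (rule v)
      finally have "measure_pmf.prob ?P {f. \<phi> * b \<le> bsum (grid L J) (col_weight j \<phi>' \<sigma>) f - (\<Sum>e\<in>grid L J. col_weight j \<phi>' \<sigma> e * \<rho>)}
        \<le> exp (lg - \<phi> * b)"
        using \<rho> cw by (intro bernstein_bern fin) auto
      also have "\<dots> \<le> exp (- r * lg)" using pb by (simp add: \<kappa>_def algebra_simps)
      also have "\<dots> = real n powr (- r)" using n by (simp add: powr_def lg_def)
      finally show ?thesis unfolding bsum_col_weight[OF J] .
    qed
    have sub: "{f. b < \<bar>col L \<sigma> \<rho> f j\<bar>} \<subseteq> {f. \<phi> * b \<le> \<phi> * col L \<sigma> \<rho> f j} \<union> {f. \<phi> * b \<le> (- \<phi>) * col L \<sigma> \<rho> f j}"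
    proof
      fix f assume "f \<in> {f. b < \<bar>col L \<sigma> \<rho> f j\<bar>}"
      then have "\<phi> * b \<le> \<phi> * \<bar>col L \<sigma> \<rho> f j\<bar>" using \<phi> by (intro mult_left_mono) auto
      then show "f \<in> {f. \<phi> * b \<le> \<phi> * col L \<sigma> \<rho> f j} \<union> {f. \<phi> * b \<le> (- \<phi>) * col L \<sigma> \<rho> f j}"
        by (cases "col L \<sigma> \<rho> f j \<ge> 0") auto
    qed
    have "measure_pmf.prob ?P {f. b < \<bar>col L \<sigma> \<rho> f j\<bar>} \<le> measure_pmf.prob ?P ({f. \<phi> * b \<le> \<phi> * col L \<sigma> \<rho> f j} \<union> {f. \<phi> * b \<le> (- \<phi>) * col L \<sigma> \<rho> f j})"
      by (rule measure_pmf.finite_measure_mono[OF sub]) simp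
    also have "\<dots> \<le> real n powr (- r) + real n powr (- r)"
      using \<phi> by (intro order_trans[OF measure_Un_le] add_mono one) auto
    also have "\<dots> \<le> 3 * real n powr (- r)" by simp
    finally show "measure_pmf.prob ?P {f. b < \<bar>col L \<sigma> \<rho> f j\<bar>} \<le> 3 * real n powr (- r)" .
  qed
qed

text \<open>32 comes from the exponential moment of the truncated squares; r times the constant of
  \<open>col_tail\<close> pays for the probability n^(-r).\<close>

definition label_const :: "real \<Rightarrow> real" where
  "label_const r = 32 + r * (450 * (r + 1)\<^sup>2)"

text \<open>Squares of Bernoulli sums have too heavy tails for a direct Chernoff bound. Truncated at
  b^2 they have an exponential moment at scale 1 / b^2, controlled by the second moment, and
  distinct columns are independent; exceeding b in some column costs a union of at most n
  tails.\<close>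

lemma prob_sum_col_squares:
  assumes n: "3 \<le> n" and r: "1 \<le> r" and \<rho>: "0 \<le> \<rho>" "\<rho> \<le> 1" and J: "finite J" "card J \<le> n"
    and \<sigma>: "\<And>l. \<bar>\<sigma> l\<bar> \<le> 1"
  shows "measure_pmf.prob (bern (grid L J) (\<lambda>_. \<rho>))
     {f. label_const r * (real n * (real L * \<rho>) + ln (real n)) < (\<Sum>j\<in>J. (col L \<sigma> \<rho> f j)\<^sup>2)} \<le> 4 * real n powr (1 - r)"
proof -
  let ?P = "bern (grid L J) (\<lambda>_. \<rho>)"
  define lam where "lam = real L * \<rho>"
  have lam0: "lam \<ge> 0" using \<rho> by (simp add: lam_def)
  have fin: "finite (grid L J)" using J by auto
  obtain b where b: "b > 0" "b\<^sup>2 * ln (real n) \<le> 450 * (r + 1)\<^sup>2 * (real n * lam + ln (real n))"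
    and tail: "\<And>j. j \<in> J \<Longrightarrow> measure_pmf.prob ?P {f. b < \<bar>col L \<sigma> \<rho> f j\<bar>} \<le> 3 * real n powr (- r)"
    using col_tail[OF n r \<rho>, of L] J(1) \<sigma> unfolding lam_def by metis
  define t where "t = 32 * (real n * lam) + r * (b\<^sup>2 * ln (real n))"
  define F where "F j f = exp (min ((col L \<sigma> \<rho> f j)\<^sup>2) (b\<^sup>2) / b\<^sup>2)" for j f
  have EF: "measure_pmf.expectation ?P (F j) \<le> exp (32 * lam / b\<^sup>2)" if j: "j \<in> J" for j
  proof -
    have "measure_pmf.expectation ?P (F j) \<le> measure_pmf.expectation ?P (\<lambda>f. 1 + 2 / b\<^sup>2 * (col L \<sigma> \<rho> f j)\<^sup>2)"
    proof (rule expectation_Pi_bool_mono[OF fin])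
      fix f
      define x where "x = min ((col L \<sigma> \<rho> f j)\<^sup>2) (b\<^sup>2) / b\<^sup>2"
      have x: "0 \<le> x" "x \<le> 1" "x \<le> (col L \<sigma> \<rho> f j)\<^sup>2 / b\<^sup>2"
        using b(1) by (auto simp: x_def divide_right_mono)
      have "x\<^sup>2 \<le> x" using x mult_left_mono[of x 1 x] by (simp add: power2_eq_square)
      then have "exp x \<le> 1 + 2 * x" using exp_le_quadratic[of x] x by simp
      then show "F j f \<le> 1 + 2 / b\<^sup>2 * (col L \<sigma> \<rho> f j)\<^sup>2" using x(3) by (simp add: F_def x_def[symmetric])
    qed
    also have "\<dots> = 1 + 2 / b\<^sup>2 * measure_pmf.expectation ?P (\<lambda>f. (col L \<sigma> \<rho> f j)\<^sup>2)"
      by (subst Bochner_Integration.integral_add) (auto intro!: integrable_Pi_bool fin)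
    also have "\<dots> \<le> 1 + 2 / b\<^sup>2 * (16 * lam)"
      unfolding lam_def using second_moment_col[OF J(1) j \<sigma> \<rho>] by (intro add_left_mono mult_left_mono) auto
    also have "\<dots> = 1 + 32 * lam / b\<^sup>2" by simp
    also have "\<dots> \<le> exp (32 * lam / b\<^sup>2)" by (rule exp_ge_add_one_self)
    finally show ?thesis .
  qed
  have "measure_pmf.prob ?P {f. t \<le> (\<Sum>j\<in>J. min ((col L \<sigma> \<rho> f j)\<^sup>2) (b\<^sup>2))}
     \<le> measure_pmf.expectation ?P (\<lambda>f. exp (- (t / b\<^sup>2)) * (\<Prod>j\<in>J. F j f))"
  proof (rule prob_le_expectation[OF fin])
    fix f assume "f \<in> {f. t \<le> (\<Sum>j\<in>J. min ((col L \<sigma> \<rho> f j)\<^sup>2) (b\<^sup>2))}"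
    then have "t / b\<^sup>2 \<le> (\<Sum>j\<in>J. min ((col L \<sigma> \<rho> f j)\<^sup>2) (b\<^sup>2) / b\<^sup>2)"
      by (simp add: divide_right_mono flip: sum_divide_distrib)
    then show "1 \<le> exp (- (t / b\<^sup>2)) * (\<Prod>j\<in>J. F j f)"
      using J(1) by (simp add: F_def flip: exp_sum exp_add)
  next
    fix f show "0 \<le> exp (- (t / b\<^sup>2)) * (\<Prod>j\<in>J. F j f)" by (simp add: F_def prod_nonneg)
  qed
  also have "\<dots> = exp (- (t / b\<^sup>2)) * measure_pmf.expectation ?P (\<lambda>f. \<Prod>j\<in>J. F j f)" by simp
  also have "measure_pmf.expectation ?P (\<lambda>f. \<Prod>j\<in>J. F j f) = (\<Prod>j\<in>J. measure_pmf.expectation ?P (F j))"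
  proof (rule expectation_Pi_bool_prod[OF fin J(1), where B = "\<lambda>j. {0..<L} \<times> {j}"])
    fix j and f g :: "nat \<times> nat \<Rightarrow> bool" assume "j \<in> J" and fg: "\<And>e. e \<in> {0..<L} \<times> {j} \<Longrightarrow> f e = g e"
    have "col L \<sigma> \<rho> f j = col L \<sigma> \<rho> g j" unfolding col_def by (intro sum.cong refl) (simp add: fg)
    then show "F j f = F j g" by (simp add: F_def)
  qed (auto simp: disjoint_family_on_def F_def)
  also have "\<dots> \<le> (\<Prod>j\<in>J. exp (32 * lam / b\<^sup>2))"
    by (intro prod_mono conjI EF Bochner_Integration.integral_nonneg) (auto simp: F_def)
  also have "\<dots> = exp (real (card J) * (32 * lam / b\<^sup>2))" by (simp flip: exp_of_nat_mult)
  also have "\<dots> \<le> exp (real n * (32 * lam / b\<^sup>2))"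
  proof -
    have "real (card J) * (32 * lam / b\<^sup>2) \<le> real n * (32 * lam / b\<^sup>2)" using J(2) lam0 by (intro mult_right_mono) auto
    then show ?thesis by simp
  qed
  also have "exp (- (t / b\<^sup>2)) * exp (real n * (32 * lam / b\<^sup>2)) = real n powr (- r)"
  proof -
    have "- (t / b\<^sup>2) + real n * (32 * lam / b\<^sup>2) = - r * ln (real n)"
      using b(1) by (simp add: t_def add_divide_distrib)
    then show ?thesis using n by (simp add: powr_def flip: exp_add)
  qed
  finally have trunc: "measure_pmf.prob ?P {f. t \<le> (\<Sum>j\<in>J. min ((col L \<sigma> \<rho> f j)\<^sup>2) (b\<^sup>2))} \<le> real n powr (- r)" by simp
  have tle: "t \<le> label_const r * (real n * lam + ln (real n))"
  proof -
    have "r * (b\<^sup>2 * ln (real n)) \<le> r * (450 * (r + 1)\<^sup>2 * (real n * lam + ln (real n)))" using b(2) r by (intro mult_left_mono) auto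
    moreover have "32 * (real n * lam) \<le> 32 * (real n * lam + ln (real n))" using n by simp
    ultimately show ?thesis unfolding t_def label_const_def by (simp add: algebra_simps)
  qed
  have sub: "{f. label_const r * (real n * (real L * \<rho>) + ln (real n)) < (\<Sum>j\<in>J. (col L \<sigma> \<rho> f j)\<^sup>2)}
     \<subseteq> {f. t \<le> (\<Sum>j\<in>J. min ((col L \<sigma> \<rho> f j)\<^sup>2) (b\<^sup>2))} \<union> (\<Union>j\<in>J. {f. b < \<bar>col L \<sigma> \<rho> f j\<bar>})"
  proof
    fix f assume f: "f \<in> {f. label_const r * (real n * (real L * \<rho>) + ln (real n)) < (\<Sum>j\<in>J. (col L \<sigma> \<rho> f j)\<^sup>2)}"
    show "f \<in> {f. t \<le> (\<Sum>j\<in>J. min ((col L \<sigma> \<rho> f j)\<^sup>2) (b\<^sup>2))} \<union> (\<Union>j\<in>J. {f. b < \<bar>col L \<sigma> \<rho> f j\<bar>})"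
    proof (cases "\<exists>j\<in>J. b < \<bar>col L \<sigma> \<rho> f j\<bar>")
      case False
      then have "(\<Sum>j\<in>J. min ((col L \<sigma> \<rho> f j)\<^sup>2) (b\<^sup>2)) = (\<Sum>j\<in>J. (col L \<sigma> \<rho> f j)\<^sup>2)"
        using b(1) by (intro sum.cong refl) (auto simp: min_def not_less abs_le_square_iff[symmetric])
      then show ?thesis using f tle by (simp add: lam_def)
    qed blast
  qed
  have "measure_pmf.prob ?P {f. label_const r * (real n * (real L * \<rho>) + ln (real n)) < (\<Sum>j\<in>J. (col L \<sigma> \<rho> f j)\<^sup>2)}
    \<le> measure_pmf.prob ?P ({f. t \<le> (\<Sum>j\<in>J. min ((col L \<sigma> \<rho> f j)\<^sup>2) (b\<^sup>2))} \<union> (\<Union>j\<in>J. {f. b < \<bar>col L \<sigma> \<rho> f j\<bar>}))"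
    by (rule measure_pmf.finite_measure_mono[OF sub]) simp
  also have "\<dots> \<le> real n powr (- r) + (\<Sum>j\<in>J. 3 * real n powr (- r))"
    by (intro order_trans[OF measure_Un_le] add_mono trunc prob_union_bound J(1) tail) auto
  also have "\<dots> = real n powr (- r) + real (card J) * (3 * real n powr (- r))" by simp
  also have "\<dots> \<le> real n * real n powr (- r) + real n * (3 * real n powr (- r))"
    using J(2) n by (intro add_mono mult_right_mono) auto
  also have "\<dots> = 4 * (real n powr 1 * real n powr (- r))" using n by simp
  also have "\<dots> = 4 * real n powr (1 - r)" unfolding powr_add[symmetric] by simp
  finally show ?thesis .
qed

definition flip_sign :: "(nat \<times> nat \<Rightarrow> bool) \<Rightarrow> nat \<Rightarrow> nat \<Rightarrow> real" where
  "flip_sign f l i = (if f (l, i) then - 1 else 1)"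

text \<open>(1 - 2 \<rho>)^2 is the mean of a product of two independent flip signs, so the sum is
  centred for i \<noteq> j; the division by 2 matches the coefficient (p l - q l) / 2 in
  \<open>edge_prob_sign\<close>.\<close>

definition label_dev :: "nat \<Rightarrow> (nat \<Rightarrow> real) \<Rightarrow> real \<Rightarrow> (nat \<times> nat \<Rightarrow> bool) \<Rightarrow> nat \<Rightarrow> nat \<Rightarrow> real" where
  "label_dev L y \<rho> f i j = (\<Sum>l<L. y l * (flip_sign f l i * flip_sign f l j - (1 - 2 * \<rho>)\<^sup>2)) / 2"

text \<open>Row \<open>i\<close> of the deviation matrix is, given the flips of node \<open>i\<close>, a vector of independent linear
  forms in the flips of the other nodes.\<close>

lemma label_concentration:
  assumes n: "3 \<le> n" and r: "1 \<le> r" and \<rho>: "0 \<le> \<rho>" "\<rho> \<le> 1/2" and y: "\<And>l. 0 \<le> y l \<and> y l \<le> 1"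
  shows "measure_pmf.prob (bern (grid L {0..<n}) (\<lambda>_. \<rho>))
    {f. 4 * label_const r * real n * (real n * (real L * \<rho>) + ln (real n))
       < (\<Sum>i<n. \<Sum>j\<in>{0..<n} - {i}. (label_dev L y \<rho> f i j)\<^sup>2)}
    \<le> 8 * real n powr (2 - r)"
proof -
  let ?P = "bern (grid L {0..<n}) (\<lambda>_. \<rho>)"
  define \<tau> where "\<tau> = label_const r * (real n * (real L * \<rho>) + ln (real n))"
  define \<sigma> where "\<sigma> f i l = y l * flip_sign f l i" for f i l
  have \<rho>1: "\<rho> \<le> 1" using \<rho> by simp
  have \<sigma>1: "\<bar>\<sigma> f i l\<bar> \<le> 1" for f i l using y[of l] by (simp add: \<sigma>_def flip_sign_def abs_mult)
  define B where "B i = {f. \<tau> < (\<Sum>j\<in>{0..<n} - {i}. (col L (\<sigma> f i) \<rho> f j)\<^sup>2)}" for i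
  define B0 where "B0 = {f. \<tau> < (\<Sum>j\<in>{0..<n}. (col L y \<rho> f j)\<^sup>2)}"
  have pB0: "measure_pmf.prob ?P B0 \<le> 4 * real n powr (1 - r)"
    unfolding B0_def \<tau>_def using y by (intro prob_sum_col_squares[OF n r \<rho>(1) \<rho>1]) auto
  have pB: "measure_pmf.prob ?P (B i) \<le> 4 * real n powr (1 - r)" if i: "i \<in> {..<n}" for i
  proof -
    have e: "grid L {0..<n} = grid L {i} \<union> grid L ({0..<n} - {i})" using i by auto
    show ?thesis
      unfolding e
    proof (rule prob_Pi_bool_condition)
      fix f :: "nat \<times> nat \<Rightarrow> bool"
      let ?h = "\<lambda>g x. if x \<in> grid L {i} then f x else g x"
      have c: "col L (\<sigma> (?h g) i) \<rho> (?h g) j = col L (\<sigma> f i) \<rho> g j" if "j \<noteq> i" for g j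
        unfolding col_def using that by (intro sum.cong refl) (simp add: \<sigma>_def flip_sign_def)
      have "{g. ?h g \<in> B i} = {g. \<tau> < (\<Sum>j\<in>{0..<n} - {i}. (col L (\<sigma> f i) \<rho> g j)\<^sup>2)}"
        unfolding B_def by (simp add: c)
      then show "measure_pmf.prob (bern (grid L ({0..<n} - {i})) (\<lambda>_. \<rho>)) {g. ?h g \<in> B i} \<le> 4 * real n powr (1 - r)"
        unfolding \<tau>_def using prob_sum_col_squares[OF n r \<rho>(1) \<rho>1 _ _ \<sigma>1, where J = "{0..<n} - {i}" and L = L]
        by (simp add: card_Diff_singleton_if)
    qed auto
  qed
  have q: "(((- 2) * v) / 2)\<^sup>2 = v\<^sup>2" for v :: real by (simp add: power2_eq_square)
  \<comment> \<open>With s_i for the sign of node i in a layer and \<mu> = 1 - 2 \<rho> its mean,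
    s_i s_j - \<mu>^2 = s_i (s_j - \<mu>) + \<mu> (s_i - \<mu>), and s - \<mu> is - 2 times the
    centred flip.\<close>
  have pt: "(label_dev L y \<rho> f i j)\<^sup>2
      \<le> 2 * (col L (\<sigma> f i) \<rho> f j)\<^sup>2 + 2 * (col L y \<rho> f i)\<^sup>2" for f i j
  proof -
    have s: "flip_sign f l i * flip_sign f l j - (1 - 2 * \<rho>)\<^sup>2
      = (- 2) * (flip_sign f l i * (of_bool (f (l, j)) - \<rho>)) + (- 2) * ((1 - 2 * \<rho>) * (of_bool (f (l, i)) - \<rho>))" for l
      by (simp add: flip_sign_def power2_eq_square algebra_simps)
    have "(\<Sum>l<L. y l * (flip_sign f l i * flip_sign f l j - (1 - 2 * \<rho>)\<^sup>2))
       = (\<Sum>l<L. (- 2) * (\<sigma> f i l * (of_bool (f (l, j)) - \<rho>)) + (- 2) * (1 - 2 * \<rho>) * (y l * (of_bool (f (l, i)) - \<rho>)))"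
      unfolding s \<sigma>_def by (intro sum.cong refl) (simp add: algebra_simps)
    also have "\<dots> = (- 2) * col L (\<sigma> f i) \<rho> f j + (- 2) * (1 - 2 * \<rho>) * col L y \<rho> f i"
      unfolding col_def sum_distrib_left sum.distrib ..
    also have "\<dots> = (- 2) * (col L (\<sigma> f i) \<rho> f j + (1 - 2 * \<rho>) * col L y \<rho> f i)" by (simp only: distrib_left mult.assoc)
    finally have S: "(\<Sum>l<L. y l * (flip_sign f l i * flip_sign f l j - (1 - 2 * \<rho>)\<^sup>2))
       = (- 2) * (col L (\<sigma> f i) \<rho> f j + (1 - 2 * \<rho>) * col L y \<rho> f i)" .
    have "(label_dev L y \<rho> f i j)\<^sup>2
       = (col L (\<sigma> f i) \<rho> f j + (1 - 2 * \<rho>) * col L y \<rho> f i)\<^sup>2"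
      unfolding label_dev_def S using q .
    also have "\<dots> \<le> 2 * (col L (\<sigma> f i) \<rho> f j)\<^sup>2 + 2 * ((1 - 2 * \<rho>) * col L y \<rho> f i)\<^sup>2"
      using sum_squares_bound[of "col L (\<sigma> f i) \<rho> f j" "(1 - 2 * \<rho>) * col L y \<rho> f i"] by (simp add: power2_sum)
    also have "((1 - 2 * \<rho>) * col L y \<rho> f i)\<^sup>2 \<le> (1 * \<bar>col L y \<rho> f i\<bar>)\<^sup>2"
      using \<rho> by (subst power2_abs[symmetric], unfold abs_mult, intro power_mono mult_right_mono) auto
    finally show ?thesis by simp
  qed
  have sub: "{f. 4 * label_const r * real n * (real n * (real L * \<rho>) + ln (real n))
       < (\<Sum>i<n. \<Sum>j\<in>{0..<n} - {i}. (label_dev L y \<rho> f i j)\<^sup>2)}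
     \<subseteq> B0 \<union> (\<Union>i\<in>{..<n}. B i)"
  proof (rule ccontr)
    assume "\<not> ?thesis"
    then obtain f where f: "4 * label_const r * real n * (real n * (real L * \<rho>) + ln (real n))
       < (\<Sum>i<n. \<Sum>j\<in>{0..<n} - {i}. (label_dev L y \<rho> f i j)\<^sup>2)"
      and nB: "f \<notin> B0" "\<And>i. i < n \<Longrightarrow> f \<notin> B i" by blast
    have "(\<Sum>i<n. \<Sum>j\<in>{0..<n} - {i}. (label_dev L y \<rho> f i j)\<^sup>2)
       \<le> (\<Sum>i<n. \<Sum>j\<in>{0..<n} - {i}. 2 * (col L (\<sigma> f i) \<rho> f j)\<^sup>2 + 2 * (col L y \<rho> f i)\<^sup>2)"
      by (intro sum_mono pt)
    also have "\<dots> \<le> (\<Sum>i<n. 2 * \<tau> + 2 * real n * (col L y \<rho> f i)\<^sup>2)"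
    proof (rule sum_mono)
      fix i assume i: "i \<in> {..<n}"
      have "(\<Sum>j\<in>{0..<n} - {i}. 2 * (col L (\<sigma> f i) \<rho> f j)\<^sup>2 + 2 * (col L y \<rho> f i)\<^sup>2)
         = 2 * (\<Sum>j\<in>{0..<n} - {i}. (col L (\<sigma> f i) \<rho> f j)\<^sup>2) + real (card ({0..<n} - {i})) * (2 * (col L y \<rho> f i)\<^sup>2)"
        by (simp add: sum.distrib sum_distrib_left)
      also have "\<dots> \<le> 2 * \<tau> + real n * (2 * (col L y \<rho> f i)\<^sup>2)"
        using nB(2)[of i] i card_mono[of "{0..<n}" "{0..<n} - {i}"]
        by (intro add_mono mult_left_mono mult_right_mono) (auto simp: B_def not_less)
      finally show "(\<Sum>j\<in>{0..<n} - {i}. 2 * (col L (\<sigma> f i) \<rho> f j)\<^sup>2 + 2 * (col L y \<rho> f i)\<^sup>2)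
        \<le> 2 * \<tau> + 2 * real n * (col L y \<rho> f i)\<^sup>2" by simp
    qed
    also have "\<dots> = 2 * real n * \<tau> + 2 * real n * (\<Sum>i<n. (col L y \<rho> f i)\<^sup>2)"
      by (simp add: sum.distrib sum_distrib_left)
    also have "\<dots> \<le> 2 * real n * \<tau> + 2 * real n * \<tau>"
      using nB(1) by (intro add_mono mult_left_mono) (auto simp: B0_def not_less lessThan_atLeast0)
    finally show False using f by (simp add: \<tau>_def mult_ac)
  qed
  have "measure_pmf.prob ?P {f. 4 * label_const r * real n * (real n * (real L * \<rho>) + ln (real n))
       < (\<Sum>i<n. \<Sum>j\<in>{0..<n} - {i}. (label_dev L y \<rho> f i j)\<^sup>2)}
     \<le> measure_pmf.prob ?P (B0 \<union> (\<Union>i\<in>{..<n}. B i))"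
    by (rule measure_pmf.finite_measure_mono[OF sub]) simp
  also have "\<dots> \<le> 4 * real n powr (1 - r) + (\<Sum>i\<in>{..<n}. 4 * real n powr (1 - r))"
    by (intro order_trans[OF measure_Un_le] add_mono pB0 prob_union_bound pB) auto
  also have "\<dots> = (1 + real n) * (4 * real n powr (1 - r))" by (simp add: algebra_simps)
  also have "\<dots> \<le> (2 * real n) * (4 * real n powr (1 - r))" using n by (intro mult_right_mono) auto
  also have "\<dots> = 8 * (real n powr 1 * real n powr (1 - r))" using n by simp
  also have "\<dots> = 8 * real n powr (2 - r)" unfolding powr_add[symmetric] by simp
  finally show ?thesis .
qed

section \<open>Assembly\<close>

lemma op_bound_scale:
  assumes "op_bound n B \<delta>" "0 \<le> c"
  shows "op_bound n (\<lambda>i j. c * B i j) (c * \<delta>)"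
proof -
  have "mv n (\<lambda>i j. c * B i j) y = (\<lambda>i. c * mv n B y i)" for y
    by (simp add: mv_def fun_eq_iff sum_distrib_left mult.assoc)
  then show ?thesis
    using assms mult_left_mono[OF _ assms(2)] unfolding op_bound_def by (simp add: ip_scale_right mult.assoc)
qed

lemma op_bound_transpose:
  assumes "op_bound n B \<delta>"
  shows "op_bound n (\<lambda>i j. B j i) \<delta>"
proof -
  have "ip n x (mv n (\<lambda>i j. B j i) y) = ip n y (mv n B x)" for x y
    unfolding ip_def mv_def sum_distrib_left by (subst sum.swap) (simp add: mult_ac)
  moreover have "ip n y (mv n B x) \<le> \<delta> * L2_set x {..<n} * L2_set y {..<n}" for x y
    using assms by (simp add: op_bound_def mult.assoc mult.commute[of "L2_set x {..<n}"])
  ultimately show ?thesis using assms by (simp add: op_bound_def)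
qed

lemma op_bound_frobenius:
  assumes F: "0 \<le> F" "(\<Sum>i<n. \<Sum>j<n. (B i j)\<^sup>2) \<le> F\<^sup>2"
  shows "op_bound n B F"
proof -
  have "ip n x (mv n B y) \<le> F * L2_set x {..<n} * L2_set y {..<n}" for x y
  proof -
    have "(L2_set (mv n B y) {..<n})\<^sup>2 = (\<Sum>i<n. (mv n B y i)\<^sup>2)" by (simp add: L2_set_def sum_nonneg)
    also have "\<dots> \<le> (\<Sum>i<n. (\<Sum>j<n. (B i j)\<^sup>2) * (\<Sum>j<n. (y j)\<^sup>2))"
      unfolding mv_def by (intro sum_mono Cauchy_Schwarz_ineq_sum)
    also have "\<dots> = (\<Sum>i<n. \<Sum>j<n. (B i j)\<^sup>2) * (L2_set y {..<n})\<^sup>2"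
      by (simp add: L2_set_def sum_nonneg sum_distrib_right)
    also have "\<dots> \<le> F\<^sup>2 * (L2_set y {..<n})\<^sup>2" using F by (intro mult_right_mono) auto
    finally have "L2_set (mv n B y) {..<n} \<le> F * L2_set y {..<n}"
      unfolding power_mult_distrib[symmetric] by (rule power2_le_imp_le) (use F in \<open>simp add: L2_set_nonneg\<close>)
    then have "L2_set x {..<n} * L2_set (mv n B y) {..<n} \<le> L2_set x {..<n} * (F * L2_set y {..<n})"
      by (intro mult_left_mono L2_set_nonneg)
    then show ?thesis using ip_le_L2[of n x "mv n B y"] by (simp add: mult_ac)
  qed
  then show ?thesis using F by (simp add: op_bound_def)
qed

lemma op_bound_diag:
  assumes "0 \<le> a"
  shows "op_bound n (\<lambda>i j. if i = j then - a else 0) a"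
proof -
  have "ip n x (mv n (\<lambda>i j. if i = j then - a else 0) y) \<le> a * L2_set x {..<n} * L2_set y {..<n}" for x y
  proof -
    have "mv n (\<lambda>i j. if i = j then - a else 0) y i = - a * y i" if "i < n" for i
      using that by (simp add: mv_def if_distrib[of "\<lambda>c. c * y _"] cong: if_cong)
    then have "ip n x (mv n (\<lambda>i j. if i = j then - a else 0) y) = ip n x (\<lambda>i. (- a) * y i)"
      by (intro ip_cong) auto
    also have "\<dots> = - a * ip n x y" by (simp only: ip_scale_right)
    also have "\<dots> \<le> a * \<bar>ip n x y\<bar>" using assms by (simp add: abs_if mult_left_mono)
    also have "\<dots> \<le> a * (L2_set x {..<n} * L2_set y {..<n})" using assms by (intro mult_left_mono ip_le_L2)
    finally show ?thesis by simp
  qed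
  then show ?thesis using assms by (simp add: op_bound_def)
qed

section \<open>Conditional edge probabilities and model parameters\<close>

definition edge_prob :: "(nat \<Rightarrow> real) \<Rightarrow> (nat \<Rightarrow> real) \<Rightarrow> (nat \<Rightarrow> int) \<Rightarrow> (nat \<times> nat \<Rightarrow> bool) \<Rightarrow> nat \<times> nat \<times> nat \<Rightarrow> real" where
  "edge_prob p q zs \<xi> = (\<lambda>(l, i, j). if layer_label zs \<xi> l i = layer_label zs \<xi> l j then p l else q l)"

lemma edge_pmf_bern: "edge_pmf n L p q zs \<xi> = bern (edge_set n L) (edge_prob p q zs \<xi>)"
  unfolding edge_pmf_def edge_set_def edge_prob_def by (intro arg_cong2[of _ _ _ _ "\<lambda>A. Pi_pmf A False"]) auto

lemma label_pmf_bern: "label_pmf n L \<rho> = bern (grid L {0..<n}) (\<lambda>_. \<rho>)"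
  by (simp add: label_pmf_def)

locale imlsbm =
  fixes n L :: nat and zs :: "nat \<Rightarrow> int" and \<rho> :: real and p q :: "nat \<Rightarrow> real" and \<beta> :: real
    and \<omega> :: "nat \<Rightarrow> real" and c0 c1 :: real
  assumes model: "in_model_class n L zs \<rho> p q \<beta>" and \<rho>_lt: "\<rho> < 1/2"
    and bal: "balanced_weights L \<omega> p q c0 c1"
begin

definition w where "w = Max (\<omega> ` {..<L})"
definition \<alpha> where "\<alpha> l = \<omega> l / w"
definition pbar where "pbar = (\<Sum>l<L. \<omega> l * p l)"
definition qbar where "qbar = (\<Sum>l<L. \<omega> l * q l)"
definition a where "a = pbar - 2 * \<rho> * (1 - \<rho>) * (pbar - qbar)"
definition b where "b = qbar + 2 * \<rho> * (1 - \<rho>) * (pbar - qbar)"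
definition W2 where "W2 = Max ((\<lambda>l. (\<omega> l)\<^sup>2 * (p l - q l)\<^sup>2) ` {..<L})"
definition m where "m = (\<Sum>l<L. \<alpha> l * p l)"

lemma n1: "1 \<le> n" and L1: "1 \<le> L" and \<rho>0: "0 \<le> \<rho>" and \<beta>1: "1 \<le> \<beta>"
  and zs: "i < n \<Longrightarrow> zs i = 1 \<or> zs i = -1"
  and pq: "l < L \<Longrightarrow> 0 < q l \<and> q l < p l \<and> p l < 1"
  using model by (auto simp: in_model_class_def)

lemma \<omega>_pos: "l < L \<Longrightarrow> 0 < \<omega> l"
  using bal by (simp add: balanced_weights_def)

lemma \<omega>_le_w: "l < L \<Longrightarrow> \<omega> l \<le> w"
  unfolding w_def by (intro Max_ge) auto

lemma w_pos: "0 < w"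
  using \<omega>_pos[of 0] \<omega>_le_w[of 0] L1 by simp

lemma \<alpha>_bounds: "l < L \<Longrightarrow> 0 \<le> \<alpha> l \<and> \<alpha> l \<le> 1"
  using \<omega>_pos[of l] \<omega>_le_w[of l] w_pos by (simp add: \<alpha>_def)

lemma w_m: "w * m = pbar"
  using w_pos by (simp add: m_def pbar_def \<alpha>_def sum_distrib_left)

lemma bars: "0 < qbar" "qbar < pbar"
proof -
  have "0 \<in> {..<L}" using L1 by simp
  then have ne: "{..<L} \<noteq> {}" by blast
  show "0 < qbar" unfolding qbar_def using ne \<omega>_pos pq by (intro sum_pos) auto
  show "qbar < pbar" unfolding qbar_def pbar_def using ne \<omega>_pos pq by (intro sum_strict_mono) auto
qed

text \<open>The origin of (1 - 2 \<rho>)^4: averaging over independent flips shrinks the signal by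
  the square of 1 - 2 \<rho>, and the loss bound divides by the square of the signal.\<close>

lemma a_minus_b: "a - b = (pbar - qbar) * (1 - 2 * \<rho>)\<^sup>2"
  by (simp add: a_def b_def power2_eq_square algebra_simps)

lemma ab: "0 \<le> b" "b < a"
proof -
  show "0 \<le> b" using bars \<rho>0 \<rho>_lt by (simp add: b_def)
  have "0 < a - b" unfolding a_minus_b using bars \<rho>_lt by simp
  then show "b < a" by simp
qed

lemma ab_le: "a - b \<le> pbar"
proof -
  have "(1 - 2 * \<rho>)\<^sup>2 \<le> 1" using \<rho>0 \<rho>_lt by (simp add: abs_square_le_1)
  then have "a - b \<le> (pbar - qbar) * 1" unfolding a_minus_b using bars by (intro mult_left_mono) auto
  then show ?thesis using bars by simp
qed

definition \<Delta>1 where "\<Delta>1 = (pbar - 2 * \<rho> * (1 - \<rho>) * (pbar - qbar))\<^sup>2"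
definition \<Delta>2 where "\<Delta>2 = real n * (\<Sum>l<L. (\<omega> l)\<^sup>2 * p l)"
definition \<Delta>3 where "\<Delta>3 = W2 * ((real L)\<^sup>2 * \<rho>\<^sup>2 + (real n)\<^sup>2 * real L * \<rho> + real n * ln (real n))
   + \<rho>\<^sup>2 * (1 - \<rho>)\<^sup>2 * (pbar - qbar)\<^sup>2"

lemma \<Delta>1_a: "\<Delta>1 = a\<^sup>2" by (simp add: \<Delta>1_def a_def)

text \<open>The edge noise has squared size w^2 d = n w pbar; the first balance condition trades the
  maximal weight for the weights inside \<Delta>2.\<close>

lemma \<Delta>2_ge: "w\<^sup>2 * (real n * m) \<le> c0 * \<Delta>2"
proof -
  have "w * pbar \<le> c0 * (\<Sum>l<L. (\<omega> l)\<^sup>2 * p l)"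
    using bal by (simp add: balanced_weights_def w_def pbar_def)
  then have "real n * (w * pbar) \<le> real n * (c0 * (\<Sum>l<L. (\<omega> l)\<^sup>2 * p l))" by (intro mult_left_mono) auto
  moreover have "w\<^sup>2 * (real n * m) = real n * (w * pbar)" by (simp add: w_m[symmetric] power2_eq_square)
  ultimately have "w\<^sup>2 * (real n * m) \<le> real n * (c0 * (\<Sum>l<L. (\<omega> l)\<^sup>2 * p l))" by (simp only:)
  then show ?thesis unfolding \<Delta>2_def by (simp only: mult.left_commute)
qed

lemma \<Delta>2_nonneg: "0 \<le> \<Delta>2"
  unfolding \<Delta>2_def using pq by (intro mult_nonneg_nonneg sum_nonneg) (auto intro: less_imp_le less_trans)

lemma W2_ge: "l < L \<Longrightarrow> (\<omega> l * (p l - q l))\<^sup>2 \<le> W2"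
  unfolding W2_def power_mult_distrib by (intro Max_ge) auto

lemma W2_pos: "0 < W2"
proof -
  have "0 < (\<omega> 0 * (p 0 - q 0))\<^sup>2" using \<omega>_pos[of 0] pq[of 0] L1 by simp
  moreover have "(\<omega> 0 * (p 0 - q 0))\<^sup>2 \<le> W2" using L1 by (intro W2_ge) simp
  ultimately show ?thesis by linarith
qed

lemma \<Delta>3_ge: "W2 * (real n * (real n * (real L * \<rho>) + ln (real n))) \<le> \<Delta>3" "0 \<le> \<Delta>3"
proof -
  have "real n * (real n * (real L * \<rho>) + ln (real n)) \<le> (real L)\<^sup>2 * \<rho>\<^sup>2 + (real n)\<^sup>2 * real L * \<rho> + real n * ln (real n)"
    using \<rho>0 by (simp add: power2_eq_square algebra_simps)
  then have "W2 * (real n * (real n * (real L * \<rho>) + ln (real n))) \<le> W2 * ((real L)\<^sup>2 * \<rho>\<^sup>2 + (real n)\<^sup>2 * real L * \<rho> + real n * ln (real n))"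
    using W2_pos by (intro mult_left_mono) auto
  then show le: "W2 * (real n * (real n * (real L * \<rho>) + ln (real n))) \<le> \<Delta>3" unfolding \<Delta>3_def
    by (rule order_trans) simp
  have "0 \<le> W2 * (real n * (real n * (real L * \<rho>) + ln (real n)))"
    using W2_pos n1 \<rho>0 by simp
  then show "0 \<le> \<Delta>3" using le by linarith
qed

text \<open>Layer coefficients normalised by the largest one, to lie in [0,1] as
  \<open>label_concentration\<close> demands; 0 beyond \<open>L\<close> because that bound is asked
  for every index.\<close>

definition y where "y l = (if l < L then \<omega> l * (p l - q l) / sqrt W2 else 0)"

lemma y_bounds: "0 \<le> y l \<and> y l \<le> 1"
proof (cases "l < L")
  case True
  have "\<omega> l * (p l - q l) \<le> sqrt W2" by (rule real_le_rsqrt) (rule W2_ge[OF True])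
  then show ?thesis using True W2_pos \<omega>_pos[OF True] pq[OF True] by (simp add: y_def)
qed (simp add: y_def)

abbreviation dev where "dev \<equiv> label_dev L y \<rho>"

abbreviation \<pi> where "\<pi> \<xi> \<equiv> edge_prob p q zs \<xi>"

lemma weighted_edges: "weighted_edges n L \<alpha> p (\<pi> \<xi>)"
proof
  fix l i j assume l: "l < L"
  show "0 \<le> \<pi> \<xi> (l, i, j) \<and> \<pi> \<xi> (l, i, j) \<le> p l" using pq[OF l] by (simp add: edge_prob_def)
  show "p l \<le> 1" using pq[OF l] by simp
qed (use n1 \<alpha>_bounds in auto)

text \<open>Coding the agreement of labels by a product of signs makes the edge probability affine
  in the flip signs, and the true labels factor out of the deviation.\<close>

lemma edge_prob_sign:
  assumes "i < n" "j < n"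
  shows "\<pi> \<xi> (l, i, j) = (p l + q l) / 2 + (p l - q l) / 2 * (real_of_int (zs i * zs j) * (flip_sign \<xi> l i * flip_sign \<xi> l j))"
  using zs[OF assms(1)] zs[OF assms(2)]
  by (auto simp: edge_prob_def layer_label_def flip_sign_def field_simps)

lemma mean_deviation:
  assumes ij: "i < n" "j < n"
  shows "(\<Sum>l<L. \<omega> l * \<pi> \<xi> (l, i, j)) - (if zs i = zs j then a else b)
    = sqrt W2 * (real_of_int (zs i * zs j) * dev \<xi> i j)"
proof -
  let ?z = "real_of_int (zs i * zs j)"
  have alg: "u * (A + B / 2 * (z * F)) - u * (A + B / 2 * (z * G)) = z / 2 * (u * B) * (F - G)" for u A B z F G :: real
    by (simp add: field_simps)
  have "(if zs i = zs j then a else b) = (pbar + qbar) / 2 + (pbar - qbar) / 2 * (?z * (1 - 2 * \<rho>)\<^sup>2)"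
    using zs[OF ij(1)] zs[OF ij(2)] by (auto simp: a_def b_def power2_eq_square field_simps)
  also have "\<dots> = (\<Sum>l<L. \<omega> l * ((p l + q l) / 2 + (p l - q l) / 2 * (?z * (1 - 2 * \<rho>)\<^sup>2)))"
    by (simp add: pbar_def qbar_def sum.distrib[symmetric] sum_subtractf[symmetric] sum_divide_distrib sum_distrib_right)
      (rule sum.cong, simp_all add: field_simps)
  finally have "(\<Sum>l<L. \<omega> l * \<pi> \<xi> (l, i, j)) - (if zs i = zs j then a else b)
     = (\<Sum>l<L. \<omega> l * \<pi> \<xi> (l, i, j) - \<omega> l * ((p l + q l) / 2 + (p l - q l) / 2 * (?z * (1 - 2 * \<rho>)\<^sup>2)))"
    by (simp only: sum_subtractf)
  also have "\<dots> = (\<Sum>l<L. ?z * sqrt W2 / 2 * (y l * (flip_sign \<xi> l i * flip_sign \<xi> l j - (1 - 2 * \<rho>)\<^sup>2)))"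
  proof (rule sum.cong)
    fix l assume "l \<in> {..<L}"
    then have "sqrt W2 * y l = \<omega> l * (p l - q l)" using W2_pos by (simp add: y_def)
    then have "?z * sqrt W2 / 2 * (y l * (flip_sign \<xi> l i * flip_sign \<xi> l j - (1 - 2 * \<rho>)\<^sup>2))
       = ?z / 2 * (\<omega> l * (p l - q l)) * (flip_sign \<xi> l i * flip_sign \<xi> l j - (1 - 2 * \<rho>)\<^sup>2)"
      by (simp add: mult_ac)
    then show "\<omega> l * \<pi> \<xi> (l, i, j) - \<omega> l * ((p l + q l) / 2 + (p l - q l) / 2 * (?z * (1 - 2 * \<rho>)\<^sup>2))
      = ?z * sqrt W2 / 2 * (y l * (flip_sign \<xi> l i * flip_sign \<xi> l j - (1 - 2 * \<rho>)\<^sup>2))"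
      unfolding edge_prob_sign[OF ij] alg by (rule sym)
  qed simp
  also have "\<dots> = ?z * sqrt W2 / 2 * (\<Sum>l<L. y l * (flip_sign \<xi> l i * flip_sign \<xi> l j - (1 - 2 * \<rho>)\<^sup>2))"
    by (simp only: sum_distrib_left)
  finally show ?thesis by (simp add: label_dev_def)
qed

text \<open>Five pieces: the centred upper triangle and its transpose on untrimmed vertices, the
  mean lost on trimmed rows and columns (\<open>E\<close>), the label fluctuation
  (\<open>D\<close>), and the diagonal, which the block matrix has and the graph lacks.\<close>

lemma trimmed_adjacency_op_bound:
  fixes \<xi> f \<gamma> K1 K
  defines "I \<equiv> weighted_edges.trimmed n L \<alpha> p \<gamma> f"
    and "Xf \<equiv> weighted_edges.X L \<alpha> f" and "Mf \<equiv> weighted_edges.M L \<alpha> (\<pi> \<xi>)"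
  assumes m0: "0 < m" and K: "0 \<le> K" and K1: "0 \<le> K1"
    and Icard: "real n * m * real (card I) \<le> real n"
    and opb: "op_bound n (\<lambda>i j. if i \<notin> I \<and> j \<notin> I then Xf i j - Mf i j else 0) (K1 * sqrt (real n * m))"
    and lab: "(\<Sum>i<n. \<Sum>j\<in>{0..<n} - {i}. (dev \<xi> i j)\<^sup>2) \<le> 4 * K * real n * (real n * (real L * \<rho>) + ln (real n))"
  shows "op_bound n (\<lambda>i j. trim n \<gamma> pbar (Abar L \<omega> (sym_adj f)) i j - (if zs i = zs j then a else b))
    ((2 * K1 + 2) * w * sqrt (real n * m) + sqrt (4 * K * \<Delta>3) + a)"
proof -
  interpret we: weighted_edges n L \<alpha> p "\<pi> \<xi>" by (rule weighted_edges)
  have mm: "we.m = m" by (simp add: we.m_def m_def)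
  have Xf: "Xf = we.X f" by (simp add: Xf_def)
  have Mf: "Mf = we.M" by (simp add: Mf_def)
  have I: "I = we.trimmed \<gamma> f" by (simp add: I_def)
  have wM: "w * (Mf i j + Mf j i) = (\<Sum>l<L. \<omega> l * \<pi> \<xi> (l, i, j))" if "i \<noteq> j" for i j
  proof -
    have sym: "\<pi> \<xi> (l, j, i) = \<pi> \<xi> (l, i, j)" for l by (auto simp: edge_prob_def)
    show ?thesis using that w_pos
      by (cases "i < j") (auto simp: Mf we.M_def \<alpha>_def sum_distrib_left sym)
  qed
  have wX: "Abar L \<omega> (sym_adj f) i j = w * (Xf i j + Xf j i)" for i j
  proof -
    have ww: "w * (\<Sum>l<L. \<alpha> l * of_bool (f (l, i, j))) = (\<Sum>l<L. \<omega> l * of_bool (f (l, i, j)))" for i j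
      using w_pos by (simp add: sum_distrib_left \<alpha>_def del: sum_mult_of_bool_eq sum_of_bool_mult_eq)
    consider "i < j" | "j < i" | "i = j" by linarith
    then show ?thesis
    proof cases
      case 1 then show ?thesis using ww[of i j] by (simp add: Abar_def sym_adj_def Xf we.X_def of_bool_def)
    next
      case 2 then show ?thesis using ww[of j i] by (simp add: Abar_def sym_adj_def Xf we.X_def of_bool_def)
    next
      case 3 then show ?thesis by (simp add: Abar_def sym_adj_def Xf we.X_def)
    qed
  qed
  \<comment> \<open>Dividing the row sums and the threshold by \<open>w\<close> shows that the
    algorithm trims exactly the vertices of \<open>we.trimmed\<close>.\<close>
  have tr: "trim_set n \<gamma> pbar (Abar L \<omega> (sym_adj f)) = I"
  proof -
    have "(\<Sum>j<n. Abar L \<omega> (sym_adj f) i j) = w * we.degree_sum f i" for i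
      by (simp add: wX we.degree_sum_def Xf sum_distrib_left)
    moreover have "\<gamma> * real n * pbar = w * (\<gamma> * (real n * m))" by (simp add: w_m[symmetric] mult_ac)
    ultimately show ?thesis
      by (simp only: trim_set_def I we.trimmed_def mm mult_less_cancel_left_pos[OF w_pos])
  qed
  define B where "B i j = (if i \<notin> I \<and> j \<notin> I then Xf i j - Mf i j else 0)" for i j
  define E where "E i j = (if i \<in> I \<or> j \<in> I then - (w * (Mf i j + Mf j i)) else 0)" for i j
  define D where "D i j = (if i = j then 0 else sqrt W2 * (real_of_int (zs i * zs j) * dev \<xi> i j))" for i j
  define s where "s = sqrt (real n * m)"
  have "op_bound n (\<lambda>i j. w * B i j + w * B j i) (w * (K1 * s) + w * (K1 * s))"
    using opb w_pos unfolding B_def[symmetric] s_def[symmetric]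
    by (intro op_bound_add op_bound_scale[where B = B] op_bound_scale[where B = "\<lambda>i j. B j i"] op_bound_transpose[where B = B]) auto
  \<comment> \<open>At most 2 n |I| nonzero entries, each at most w m in absolute value; since n m
    |I| \<le> n, the sum of squares is at most 2 w^2 n m.\<close>
  moreover have "op_bound n E (2 * w * s)"
  proof (rule op_bound_frobenius)
    show "0 \<le> 2 * w * s" using w_pos m0 by (simp add: s_def)
    have Isub: "I \<subseteq> {..<n}" by (auto simp: I we.trimmed_def)
    have Mb: "Mf i j + Mf j i \<le> m" "0 \<le> Mf i j + Mf j i" for i j
    proof -
      show "0 \<le> Mf i j + Mf j i" using we.M_bounds(1)[of i j] we.M_bounds(1)[of j i] by (simp add: Mf)
      have "Mf i j = 0 \<or> Mf j i = 0" by (auto simp: Mf we.M_def)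
      then show "Mf i j + Mf j i \<le> m" using we.M_bounds(2)[of i j] we.M_bounds(2)[of j i] by (auto simp: Mf mm)
    qed
    have "(\<Sum>i<n. \<Sum>j<n. (E i j)\<^sup>2) \<le> (\<Sum>i<n. \<Sum>j<n. (w * m)\<^sup>2 * (of_bool (i \<in> I) + of_bool (j \<in> I)))"
    proof (intro sum_mono)
      fix i j
      have "(w * (Mf i j + Mf j i))\<^sup>2 \<le> (w * m)\<^sup>2" using Mb[of i j] w_pos by (intro power_mono mult_left_mono) auto
      then show "(E i j)\<^sup>2 \<le> (w * m)\<^sup>2 * (of_bool (i \<in> I) + of_bool (j \<in> I))"
        by (cases "i \<in> I"; cases "j \<in> I") (simp_all add: E_def, erule order_trans, simp)
    qed
    also have "\<dots> = (w * m)\<^sup>2 * (2 * real n * real (card I))"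
      using Isub by (simp add: sum.distrib Int_absorb1 flip: sum_distrib_left)
    also have "\<dots> = w\<^sup>2 * m * 2 * (real n * m * real (card I))" by (simp add: power2_eq_square mult_ac)
    also have "\<dots> \<le> w\<^sup>2 * m * 2 * real n" using Icard m0 by (intro mult_left_mono) auto
    also have "\<dots> \<le> (2 * w * s)\<^sup>2" using m0 by (simp add: power_mult_distrib s_def)
    finally show "(\<Sum>i<n. \<Sum>j<n. (E i j)\<^sup>2) \<le> (2 * w * s)\<^sup>2" .
  qed
  moreover have "op_bound n D (sqrt (4 * K * \<Delta>3))"
  proof (rule op_bound_frobenius)
    show "0 \<le> sqrt (4 * K * \<Delta>3)" using K \<Delta>3_ge(2) by simp
    have "(\<Sum>i<n. \<Sum>j<n. (D i j)\<^sup>2) = (\<Sum>i<n. \<Sum>j\<in>{0..<n} - {i}. W2 * (dev \<xi> i j)\<^sup>2)"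
    proof (rule sum.cong)
      fix i assume i: "i \<in> {..<n}"
      show "(\<Sum>j<n. (D i j)\<^sup>2) = (\<Sum>j\<in>{0..<n} - {i}. W2 * (dev \<xi> i j)\<^sup>2)"
      proof (rule sum.mono_neutral_cong_right)
        show "\<forall>j\<in>{..<n} - ({0..<n} - {i}). (D i j)\<^sup>2 = 0" by (auto simp: D_def)
        fix j assume j: "j \<in> {0..<n} - {i}"
        have "(real_of_int (zs i))\<^sup>2 = 1" "(real_of_int (zs j))\<^sup>2 = 1" using zs[of i] zs[of j] i j by auto
        then show "(D i j)\<^sup>2 = W2 * (dev \<xi> i j)\<^sup>2" using j W2_pos by (simp add: D_def power_mult_distrib)
      qed auto
    qed simp
    also have "\<dots> = W2 * (\<Sum>i<n. \<Sum>j\<in>{0..<n} - {i}. (dev \<xi> i j)\<^sup>2)" by (simp only: sum_distrib_left)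
    also have "\<dots> \<le> W2 * (4 * K * real n * (real n * (real L * \<rho>) + ln (real n)))"
      using lab W2_pos by (intro mult_left_mono) auto
    also have "\<dots> = 4 * K * (W2 * (real n * (real n * (real L * \<rho>) + ln (real n))))" by simp
    also have "\<dots> \<le> 4 * K * \<Delta>3" using K \<Delta>3_ge(1) by (intro mult_left_mono) auto
    also have "\<dots> = (sqrt (4 * K * \<Delta>3))\<^sup>2" using K \<Delta>3_ge(2) by simp
    finally show "(\<Sum>i<n. \<Sum>j<n. (D i j)\<^sup>2) \<le> (sqrt (4 * K * \<Delta>3))\<^sup>2" .
  qed
  moreover have "op_bound n (\<lambda>i j. if i = j then - a else 0) a" using ab by (intro op_bound_diag) auto
  ultimately have "op_bound n (\<lambda>i j. (((w * B i j + w * B j i) + E i j) + D i j) + (if i = j then - a else 0))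
      (((w * (K1 * s) + w * (K1 * s)) + 2 * w * s) + sqrt (4 * K * \<Delta>3) + a)"
    by (intro op_bound_add[OF op_bound_add[OF op_bound_add[where M = "\<lambda>i j. w * B i j + w * B j i"]]])
  then have "op_bound n (\<lambda>i j. trim n \<gamma> pbar (Abar L \<omega> (sym_adj f)) i j - (if zs i = zs j then a else b))
      (((w * (K1 * s) + w * (K1 * s)) + 2 * w * s) + sqrt (4 * K * \<Delta>3) + a)"
  proof (rule op_bound_cong)
    fix i j assume ij: "i < n" "j < n"
    have Ebar: "w * (Mf i j + Mf j i) - (if zs i = zs j then a else b) = D i j + (if i = j then - a else 0)"
    proof (cases "i = j")
      case True
      then have "Mf i j = 0" "Mf j i = 0" by (auto simp: Mf we.M_def)
      then show ?thesis using True by (simp add: D_def)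
    next
      case False
      then show ?thesis using wM[OF False] mean_deviation[OF ij] by (simp add: D_def)
    qed
    have "trim n \<gamma> pbar (Abar L \<omega> (sym_adj f)) i j = (if i \<in> I \<or> j \<in> I then 0 else w * (Xf i j + Xf j i))"
      unfolding trim_def tr wX ..
    also have "\<dots> = w * B i j + w * B j i + E i j + w * (Mf i j + Mf j i)"
      by (auto simp: B_def E_def algebra_simps)
    finally show "(((w * B i j + w * B j i) + E i j) + D i j) + (if i = j then - a else 0)
      = trim n \<gamma> pbar (Abar L \<omega> (sym_adj f)) i j - (if zs i = zs j then a else b)"
      using Ebar by linarith
  qed
  moreover have "((w * (K1 * s) + w * (K1 * s)) + 2 * w * s) + sqrt (4 * K * \<Delta>3) + a
      = (2 * K1 + 2) * w * sqrt (real n * m) + sqrt (4 * K * \<Delta>3) + a"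
    by (simp add: s_def algebra_simps)
  ultimately show ?thesis by simp
qed


lemma outputs_loss_bound:
  fixes \<xi> f \<gamma> K1 K \<epsilon>
  defines "I \<equiv> weighted_edges.trimmed n L \<alpha> p \<gamma> f"
  assumes m0: "0 < m" and K: "0 \<le> K" and K1: "0 \<le> K1" and \<epsilon>: "0 < \<epsilon>"
    and size: "real n / 6 \<le> card {i. i < n \<and> zs i = 1}" "real n / 6 \<le> card {i. i < n \<and> zs i = -1}"
    and Icard: "real n * m * real (card I) \<le> real n"
    and opb: "op_bound n (\<lambda>i j. if i \<notin> I \<and> j \<notin> I then weighted_edges.X L \<alpha> f i j - weighted_edges.M L \<alpha> (\<pi> \<xi>) i j else 0)
      (K1 * sqrt (real n * m))"
    and lab: "(\<Sum>i<n. \<Sum>j\<in>{0..<n} - {i}. (dev \<xi> i j)\<^sup>2) \<le> 4 * K * real n * (real n * (real L * \<rho>) + ln (real n))"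
    and zt: "zt \<in> alg1_outputs n L (sym_adj f) \<omega> p \<gamma> \<epsilon>"
  shows "loss n zt zs \<le> 13824 * (3 * ((2 * K1 + 2)\<^sup>2 * \<bar>c0\<bar> + 4 * K + 1)) * (2 + \<epsilon>) * (\<Delta>1 + \<Delta>2 + \<Delta>3) / (real n * (a - b))\<^sup>2"
proof -
  define \<delta> where "\<delta> = (2 * K1 + 2) * w * sqrt (real n * m) + sqrt (4 * K * \<Delta>3) + a"
  let ?M = "trim n \<gamma> pbar (Abar L \<omega> (sym_adj f))"
  let ?C = "3 * ((2 * K1 + 2)\<^sup>2 * \<bar>c0\<bar> + 4 * K + 1)"
  obtain u1 u2 g xa xb where out: "leading_eigvecs n ?M u1 u2"
    "\<forall>g' a' b'. kmeans_obj n u1 u2 g xa xb \<le> (1 + \<epsilon>) * kmeans_obj n u1 u2 g' a' b'" "zt = (\<lambda>i. if g i then 1 else -1)"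
    using zt unfolding alg1_outputs_def pbar_def by blast
  have op: "op_bound n (\<lambda>i j. ?M i j - (if zs i = zs j then a else b)) \<delta>"
    unfolding \<delta>_def by (rule trimmed_adjacency_op_bound[OF m0 K K1 Icard[unfolded I_def] opb[unfolded I_def] lab])
  have sa: "sym_adj f l i j = sym_adj f l j i" for l i j by (auto simp: sym_adj_def)
  have sym: "?M i j = ?M j i" for i j
    unfolding trim_def Abar_def sa[of _ i j] by auto
  have zz: "\<forall>i<n. zs i = 1 \<or> zs i = -1" using zs by blast
  have "loss n zt zs \<le> 13824 * (2 + \<epsilon>) * \<delta>\<^sup>2 / (real n * (a - b))\<^sup>2"
    unfolding out(3) using n1 by (intro loss_le_op_bound[OF _ zz size sym out(1) op ab \<epsilon> out(2)]) auto
  also have "\<dots> \<le> 13824 * (2 + \<epsilon>) * (?C * (\<Delta>1 + \<Delta>2 + \<Delta>3)) / (real n * (a - b))\<^sup>2"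
  proof (intro divide_right_mono mult_left_mono)
    have sq3: "(x + y + z)\<^sup>2 \<le> 3 * (x\<^sup>2 + y\<^sup>2 + z\<^sup>2)" for x y z :: real
      using zero_le_power2[of "x - y"] zero_le_power2[of "y - z"] zero_le_power2[of "x - z"]
      by (simp add: power2_eq_square algebra_simps)
    have "\<delta>\<^sup>2 \<le> 3 * (((2 * K1 + 2) * w * sqrt (real n * m))\<^sup>2 + (sqrt (4 * K * \<Delta>3))\<^sup>2 + a\<^sup>2)"
      unfolding \<delta>_def by (rule sq3)
    also have "((2 * K1 + 2) * w * sqrt (real n * m))\<^sup>2 = (2 * K1 + 2)\<^sup>2 * (w\<^sup>2 * (real n * m))"
      using m0 by (simp add: power_mult_distrib)
    also have "\<dots> \<le> (2 * K1 + 2)\<^sup>2 * (\<bar>c0\<bar> * \<Delta>2)"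
    proof (rule mult_left_mono)
      have "c0 * \<Delta>2 \<le> \<bar>c0\<bar> * \<Delta>2" using \<Delta>2_nonneg by (intro mult_right_mono) auto
      then show "w\<^sup>2 * (real n * m) \<le> \<bar>c0\<bar> * \<Delta>2" using \<Delta>2_ge by linarith
    qed simp
    also have "(sqrt (4 * K * \<Delta>3))\<^sup>2 = 4 * K * \<Delta>3" using K \<Delta>3_ge(2) by simp
    also have "a\<^sup>2 = \<Delta>1" by (simp add: \<Delta>1_a)
    finally have "\<delta>\<^sup>2 \<le> 3 * ((2 * K1 + 2)\<^sup>2 * (\<bar>c0\<bar> * \<Delta>2) + 4 * K * \<Delta>3 + \<Delta>1)" by simp
    also have "\<dots> \<le> ?C * (\<Delta>1 + \<Delta>2 + \<Delta>3)"
    proof -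
      define A where "A = (2 * K1 + 2)\<^sup>2 * \<bar>c0\<bar>"
      have A0: "0 \<le> A" by (simp add: A_def)
      have d1: "0 \<le> \<Delta>1" by (simp add: \<Delta>1_a)
      have "0 \<le> A * (\<Delta>1 + \<Delta>3)" "0 \<le> 4 * K * (\<Delta>1 + \<Delta>2)" using A0 K d1 \<Delta>2_nonneg \<Delta>3_ge(2) by auto
      then have "A * \<Delta>2 + 4 * K * \<Delta>3 + \<Delta>1 \<le> (A + 4 * K + 1) * (\<Delta>1 + \<Delta>2 + \<Delta>3)"
        using \<Delta>2_nonneg \<Delta>3_ge(2) by (simp add: algebra_simps)
      then have "3 * (A * \<Delta>2 + 4 * K * \<Delta>3 + \<Delta>1) \<le> 3 * ((A + 4 * K + 1) * (\<Delta>1 + \<Delta>2 + \<Delta>3))"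
        by (intro mult_left_mono) auto
      then show ?thesis unfolding A_def by (simp only: mult.assoc)
    qed
    finally show "\<delta>\<^sup>2 \<le> ?C * (\<Delta>1 + \<Delta>2 + \<Delta>3)" .
  qed (use \<epsilon> in auto)
  finally show ?thesis by (simp only: mult_ac)
qed

text \<open>For \<beta> > 3 one has \<beta> - 1 / \<beta> > 2, and the right side of the condition
  drops below (1 - 2 \<rho>)^2 + 2 \<rho> (1 - \<rho>) = 1 - 2 \<rho> (1 - \<rho>) \<le> 1, whereas
  pbar / (pbar - qbar) exceeds 1.\<close>

lemma cluster_sizes:
  assumes "\<beta> = 1 \<or> pbar / (pbar - qbar) \<le> c' * (2 * (1 - 2 * \<rho>)\<^sup>2 / (\<beta> - 1 / \<beta>)) + 2 * (\<rho> - \<rho>\<^sup>2)" "c' < 1"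
  shows "real n / 6 \<le> card {i. i < n \<and> zs i = 1}" "real n / 6 \<le> card {i. i < n \<and> zs i = -1}"
proof -
  have "\<beta> \<le> 3"
  proof (rule ccontr)
    assume "\<not> \<beta> \<le> 3"
    then have b3: "\<beta> > 3" by simp
    then have "1 / \<beta> < 1" by simp
    then have B: "\<beta> - 1 / \<beta> > 2" using b3 by linarith
    define g where "g = (1 - 2 * \<rho>)\<^sup>2"
    have g: "0 < g" using \<rho>_lt by (simp add: g_def)
    have "pbar / (pbar - qbar) \<le> c' * (2 * g / (\<beta> - 1 / \<beta>)) + 2 * (\<rho> - \<rho>\<^sup>2)"
      using assms(1) b3 by (simp add: g_def)
    also have "c' * (2 * g / (\<beta> - 1 / \<beta>)) < g"
    proof (cases "c' \<le> 0")
      case True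
      then have "c' * (2 * g / (\<beta> - 1 / \<beta>)) \<le> 0" using g B by (intro mult_nonpos_nonneg) auto
      then show ?thesis using g by linarith
    next
      case False
      have "2 * g / (\<beta> - 1 / \<beta>) \<le> g" using g B by (simp add: divide_le_eq mult_left_mono)
      then have "c' * (2 * g / (\<beta> - 1 / \<beta>)) \<le> c' * g" using False by (intro mult_left_mono) auto
      also have "\<dots> < 1 * g" using assms(2) g by (intro mult_strict_right_mono)
      finally show ?thesis by simp
    qed
    finally have "pbar / (pbar - qbar) < 1 - 2 * (\<rho> * (1 - \<rho>))" by (simp add: g_def power2_eq_square algebra_simps)
    moreover have "0 \<le> \<rho> * (1 - \<rho>)" using \<rho>0 \<rho>_lt by simp
    ultimately have "pbar / (pbar - qbar) < 1" by linarith
    then show False using bars by simp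
  qed
  then have "real n / 6 \<le> real n / (2 * \<beta>)" using \<beta>1 by (intro divide_left_mono) auto
  moreover have "real n / (2 * \<beta>) \<le> real (card {i. i < n \<and> zs i = 1})" "real n / (2 * \<beta>) \<le> real (card {i. i < n \<and> zs i = -1})"
    using model by (auto simp: in_model_class_def)
  ultimately show "real n / 6 \<le> card {i. i < n \<and> zs i = 1}" "real n / 6 \<le> card {i. i < n \<and> zs i = -1}" by linarith+
qed

section \<open>Failure probability of the loss bound\<close>

definition good_outputs :: "real \<Rightarrow> real \<Rightarrow> real \<Rightarrow> (nat \<Rightarrow> nat \<Rightarrow> nat \<Rightarrow> bool) set" where
  "good_outputs \<gamma> \<epsilon> C = {A. \<forall>zt\<in>alg1_outputs n L A \<omega> p \<gamma> \<epsilon>.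
     loss n zt zs \<le> C * (2 + \<epsilon>) * (\<Delta>1 + \<Delta>2 + \<Delta>3) / (real n * (a - b))\<^sup>2}"

lemma good_outputs_eq_UNIV:
  assumes \<epsilon>: "0 < \<epsilon>" and C: "(real n * (a - b))\<^sup>2 \<le> 2 * C * (\<Delta>1 + \<Delta>2 + \<Delta>3)" "0 \<le> C"
  shows "good_outputs \<gamma> \<epsilon> C = UNIV"
proof -
  have S: "0 \<le> \<Delta>1 + \<Delta>2 + \<Delta>3" using \<Delta>2_nonneg \<Delta>3_ge(2) by (simp add: \<Delta>1_a)
  have pos: "0 < (real n * (a - b))\<^sup>2" using n1 ab by simp
  have "2 * C * (\<Delta>1 + \<Delta>2 + \<Delta>3) \<le> C * (2 + \<epsilon>) * (\<Delta>1 + \<Delta>2 + \<Delta>3)"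
    using C(2) \<epsilon> S by (intro mult_right_mono) (auto simp: algebra_simps)
  then have "1 \<le> C * (2 + \<epsilon>) * (\<Delta>1 + \<Delta>2 + \<Delta>3) / (real n * (a - b))\<^sup>2"
    using C(1) pos by (simp add: le_divide_eq)
  then show ?thesis using loss_le_1[of n] n1 unfolding good_outputs_def by (auto intro: order_trans)
qed

text \<open>For n \<le> N0, use (a - b)^2 \<le> a^2 = \<Delta>1 and C \<ge> N0^2. For d < 24, a - b
  \<le> pbar = w m gives n^2 (a - b)^2 \<le> d w^2 d \<le> 24 |c0| \<Delta>2; the 12 is half of 24
  since 2 + \<epsilon> supplies a factor 2.\<close>

lemma good_outputs_eq_UNIV_sparse:
  assumes \<epsilon>: "0 < \<epsilon>" and few: "real n \<le> N0 \<or> real n * m < 24" and C: "N0\<^sup>2 + 12 * \<bar>c0\<bar> \<le> C"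
  shows "good_outputs \<gamma> \<epsilon> C = UNIV"
proof (rule good_outputs_eq_UNIV[OF \<epsilon>])
  have C0: "0 \<le> C" using C zero_le_power2[of N0] by linarith
  then show "0 \<le> C" .
  have d1: "0 \<le> \<Delta>1" by (simp add: \<Delta>1_a)
  from few show "(real n * (a - b))\<^sup>2 \<le> 2 * C * (\<Delta>1 + \<Delta>2 + \<Delta>3)"
  proof
    assume "real n \<le> N0"
    then have "(real n)\<^sup>2 \<le> N0\<^sup>2" by (intro power_mono) auto
    then have "(real n)\<^sup>2 \<le> 2 * C" using C C0 by linarith
    moreover have "(a - b)\<^sup>2 \<le> \<Delta>1" unfolding \<Delta>1_a using ab by (intro power_mono) auto
    ultimately have "(real n)\<^sup>2 * (a - b)\<^sup>2 \<le> 2 * C * \<Delta>1" using C0 by (intro mult_mono) auto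
    also have "\<dots> \<le> 2 * C * (\<Delta>1 + \<Delta>2 + \<Delta>3)" using C0 \<Delta>2_nonneg \<Delta>3_ge(2) by (intro mult_left_mono) auto
    finally show ?thesis by (simp add: power_mult_distrib)
  next
    assume sp: "real n * m < 24"
    have m0: "0 < m" using w_m bars w_pos by (metis less_trans zero_less_mult_pos)
    have "(a - b)\<^sup>2 \<le> (w * m)\<^sup>2" unfolding w_m using ab ab_le by (intro power_mono) auto
    then have "(real n)\<^sup>2 * (a - b)\<^sup>2 \<le> (real n)\<^sup>2 * (w * m)\<^sup>2" by (intro mult_left_mono) auto
    also have "\<dots> = (real n * m) * (w\<^sup>2 * (real n * m))" by (simp add: power2_eq_square)
    also have "\<dots> \<le> 24 * (\<bar>c0\<bar> * \<Delta>2)"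
    proof (rule mult_mono)
      have "c0 * \<Delta>2 \<le> \<bar>c0\<bar> * \<Delta>2" using \<Delta>2_nonneg by (intro mult_right_mono) auto
      then show "w\<^sup>2 * (real n * m) \<le> \<bar>c0\<bar> * \<Delta>2" using \<Delta>2_ge by linarith
    qed (use sp m0 in auto)
    also have "\<dots> = 2 * (12 * \<bar>c0\<bar>) * \<Delta>2" by simp
    also have "\<dots> \<le> 2 * C * (\<Delta>1 + \<Delta>2 + \<Delta>3)"
    proof (intro mult_mono)
      show "12 * \<bar>c0\<bar> \<le> C" using C zero_le_power2[of N0] by linarith
    qed (use \<Delta>2_nonneg \<Delta>3_ge(2) d1 C0 in auto)
    finally show ?thesis by (simp add: power_mult_distrib)
  qed
qed

text \<open>The concentration bounds are applied with exponent r + 3, which leaves n^(-1-r) for the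
  labels and its square for the discrepancy, so that the polynomial prefactors are absorbed. The
  failure terms come to 6 n^(-r), within the allowed 11.\<close>

lemma prob_good_outputs_dense:
  assumes \<epsilon>: "0 < \<epsilon>" and r: "1 \<le> r" and \<gamma>: "exp 1 \<le> \<gamma>" and dense: "24 \<le> real n * m"
    and n: "64 * r\<^sup>2 + 8 \<le> real n"
    and size: "real n / 6 \<le> card {i. i < n \<and> zs i = 1}" "real n / 6 \<le> card {i. i < n \<and> zs i = -1}"
    and C: "13824 * (3 * ((2 * (16 * \<gamma> + 264 + 3072 * (r + 3)) + 2)\<^sup>2 * \<bar>c0\<bar> + 4 * label_const (r + 3) + 1)) \<le> C"
  shows "measure_pmf.prob (imlsbm_pmf n L zs \<rho> p q) (good_outputs \<gamma> \<epsilon> C) \<ge> 1 - 11 * real n powr (- r)"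
proof -
  define K where "K = label_const (r + 3)"
  define K1 where "K1 = 16 * \<gamma> + 264 + 3072 * (r + 3)"
  have n8: "8 \<le> n" using n zero_le_power2[of r] by linarith
  have m0: "0 < m" using w_m bars w_pos by (metis less_trans zero_less_mult_pos)
  have K0: "0 \<le> K" using r by (simp add: K_def label_const_def)
  have K10: "0 \<le> K1" using r order_trans[OF exp_ge_zero \<gamma>] by (simp add: K1_def)
  have S: "0 \<le> \<Delta>1 + \<Delta>2 + \<Delta>3" using \<Delta>2_nonneg \<Delta>3_ge(2) by (simp add: \<Delta>1_a)
  define Y where "Y = {\<xi>. 4 * K * real n * (real n * (real L * \<rho>) + ln (real n)) < (\<Sum>i<n. \<Sum>j\<in>{0..<n} - {i}. (dev \<xi> i j)\<^sup>2)}"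
  define e where "e = exp (- (real n / 4)) + exp (- real n) + (2 * real n + 1) * (real n powr (2 - (r + 3)))\<^sup>2"
  have pY: "measure_pmf.prob (label_pmf n L \<rho>) Y \<le> 8 * real n powr (2 - (r + 3))"
    unfolding label_pmf_bern Y_def K_def
    using n8 r \<rho>0 \<rho>_lt y_bounds by (intro label_concentration) auto
  have good: "measure_pmf.prob (edge_pmf n L p q zs \<xi>) {f. sym_adj f \<notin> good_outputs \<gamma> \<epsilon> C} \<le> e" if \<xi>: "\<xi> \<notin> Y" for \<xi>
  proof -
    interpret we: weighted_edges n L \<alpha> p "\<pi> \<xi>" by (rule weighted_edges)
    have mm: "we.m = m" by (simp add: we.m_def m_def)
    have lab: "(\<Sum>i<n. \<Sum>j\<in>{0..<n} - {i}. (dev \<xi> i j)\<^sup>2) \<le> 4 * K * real n * (real n * (real L * \<rho>) + ln (real n))"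
      using \<xi> by (simp add: Y_def not_less)
    have "{f. sym_adj f \<notin> good_outputs \<gamma> \<epsilon> C} \<subseteq> {f. \<not> (real n * we.m * real (card (we.trimmed \<gamma> f)) \<le> real n \<and>
      op_bound n (\<lambda>i j. if i \<notin> we.trimmed \<gamma> f \<and> j \<notin> we.trimmed \<gamma> f then we.X f i j - we.M i j else 0)
        ((16 * \<gamma> + 264 + 3072 * (r + 3)) * sqrt (real n * we.m)))}"
    proof (rule Collect_mono, rule impI, rule notI)
      fix f
      assume nb: "sym_adj f \<notin> good_outputs \<gamma> \<epsilon> C"
        and ok: "real n * we.m * real (card (we.trimmed \<gamma> f)) \<le> real n \<and>
      op_bound n (\<lambda>i j. if i \<notin> we.trimmed \<gamma> f \<and> j \<notin> we.trimmed \<gamma> f then we.X f i j - we.M i j else 0)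
        ((16 * \<gamma> + 264 + 3072 * (r + 3)) * sqrt (real n * we.m))"
      have "loss n zt zs \<le> C * (2 + \<epsilon>) * (\<Delta>1 + \<Delta>2 + \<Delta>3) / (real n * (a - b))\<^sup>2"
        if zt: "zt \<in> alg1_outputs n L (sym_adj f) \<omega> p \<gamma> \<epsilon>" for zt
      proof -
        have "loss n zt zs \<le> 13824 * (3 * ((2 * K1 + 2)\<^sup>2 * \<bar>c0\<bar> + 4 * K + 1)) * (2 + \<epsilon>) * (\<Delta>1 + \<Delta>2 + \<Delta>3) / (real n * (a - b))\<^sup>2"
          using ok unfolding mm K1_def[symmetric]
          by (intro outputs_loss_bound[OF m0 K0 K10 \<epsilon> size _ _ lab zt]) auto
        also have "\<dots> \<le> C * (2 + \<epsilon>) * (\<Delta>1 + \<Delta>2 + \<Delta>3) / (real n * (a - b))\<^sup>2"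
          using C S \<epsilon> unfolding K1_def[symmetric] K_def[symmetric] by (intro divide_right_mono mult_right_mono) auto
        finally show ?thesis .
      qed
      then show False using nb by (simp add: good_outputs_def)
    qed
    then have "measure_pmf.prob (edge_pmf n L p q zs \<xi>) {f. sym_adj f \<notin> good_outputs \<gamma> \<epsilon> C}
      \<le> measure_pmf.prob we.P {f. \<not> (real n * we.m * real (card (we.trimmed \<gamma> f)) \<le> real n \<and>
      op_bound n (\<lambda>i j. if i \<notin> we.trimmed \<gamma> f \<and> j \<notin> we.trimmed \<gamma> f then we.X f i j - we.M i j else 0)
        ((16 * \<gamma> + 264 + 3072 * (r + 3)) * sqrt (real n * we.m)))}"
      unfolding edge_pmf_bern by (intro measure_pmf.finite_measure_mono) auto
    also have "\<dots> \<le> e"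
      unfolding e_def using dense r by (intro we.edge_concentration \<gamma>) (auto simp: mm)
    finally show ?thesis .
  qed
  have e0: "0 \<le> e" by (simp add: e_def)
  have "measure_pmf.prob (imlsbm_pmf n L zs \<rho> p q) (- good_outputs \<gamma> \<epsilon> C) \<le> e + measure_pmf.prob (label_pmf n L \<rho>) Y"
    unfolding imlsbm_pmf_def
  proof (rule prob_bind_le[OF _ e0])
    fix \<xi>
    have v: "sym_adj -` (- good_outputs \<gamma> \<epsilon> C) = {f. sym_adj f \<notin> good_outputs \<gamma> \<epsilon> C}" by auto
    show "measure_pmf.prob (map_pmf sym_adj (edge_pmf n L p q zs \<xi>)) (- good_outputs \<gamma> \<epsilon> C) \<le> e + indicator Y \<xi>"
      unfolding measure_map_pmf v
    proof (cases "\<xi> \<in> Y")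
      case True
      then show "measure_pmf.prob (edge_pmf n L p q zs \<xi>) {f. sym_adj f \<notin> good_outputs \<gamma> \<epsilon> C} \<le> e + indicator Y \<xi>"
        using e0 by (simp add: add_increasing measure_pmf.prob_le_1)
    next
      case False
      then show "measure_pmf.prob (edge_pmf n L p q zs \<xi>) {f. sym_adj f \<notin> good_outputs \<gamma> \<epsilon> C} \<le> e + indicator Y \<xi>"
        using good[OF False] by simp
    qed
  qed
  also have "\<dots> \<le> 11 * real n powr (- r)"
  proof -
    have np: "0 < real n" using n8 by simp
    have "ln (sqrt (real n)) \<le> sqrt (real n)" using n8 ln_le_minus_one[of "sqrt (real n)"] by simp
    then have lnle: "ln (real n) \<le> 2 * sqrt (real n)" using n8 by (simp add: ln_sqrt)
    \<comment> \<open>The term 64 r^2 in the lower bound on n acts here: r ln n \<le> 2 r sqrt n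
      \<le> n / 4, so the exponential tails are below n^(-r).\<close>
    have "8 * r \<le> sqrt (real n)" using n by (intro real_le_rsqrt) (simp add: power_mult_distrib)
    then have "8 * r * sqrt (real n) \<le> sqrt (real n) * sqrt (real n)" by (intro mult_right_mono) auto
    then have "r * (2 * sqrt (real n)) \<le> real n / 4" by simp
    moreover have "r * ln (real n) \<le> r * (2 * sqrt (real n))" using lnle r by (intro mult_left_mono) auto
    ultimately have rl: "r * ln (real n) \<le> real n / 4" by linarith
    have p: "real n powr (- r) = exp (- (r * ln (real n)))" using np by (simp add: powr_def)
    have "exp (- (real n / 4)) \<le> real n powr (- r)" "exp (- real n) \<le> real n powr (- r)"
      unfolding p using rl np by auto
    moreover have "(2 * real n + 1) * (real n powr (2 - (r + 3)))\<^sup>2 \<le> 3 * real n powr (- r)"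
    proof -
      have "(real n powr (2 - (r + 3)))\<^sup>2 = real n powr (- 2 - 2 * r)"
        unfolding power2_eq_square powr_add[symmetric] by simp
      then have "(2 * real n + 1) * (real n powr (2 - (r + 3)))\<^sup>2 \<le> (3 * real n powr 1) * real n powr (- 2 - 2 * r)"
        using n8 by (simp add: mult_right_mono)
      also have "\<dots> = 3 * real n powr (- 1 - 2 * r)" unfolding mult.assoc powr_add[symmetric] by simp
      also have "\<dots> \<le> 3 * real n powr (- r)" using n8 r by (intro mult_left_mono powr_mono) auto
      finally show ?thesis .
    qed
    \<comment> \<open>Here n \<ge> 8 absorbs the factor 8 of
      \<open>label_concentration\<close>.\<close>
    moreover have "8 * real n powr (2 - (r + 3)) \<le> real n powr (- r)"
    proof -
      have "8 * real n powr (2 - (r + 3)) \<le> real n powr 1 * real n powr (- 1 - r)"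
        using n8 by (simp add: mult_right_mono algebra_simps)
      also have "\<dots> = real n powr (- r)" unfolding powr_add[symmetric] by simp
      finally show ?thesis .
    qed
    ultimately have "e + measure_pmf.prob (label_pmf n L \<rho>) Y \<le> 6 * real n powr (- r)"
      using pY unfolding e_def by linarith
    also have "\<dots> \<le> 11 * real n powr (- r)" by simp
    finally show ?thesis .
  qed
  finally have "measure_pmf.prob (imlsbm_pmf n L zs \<rho> p q) (- good_outputs \<gamma> \<epsilon> C) \<le> 11 * real n powr (- r)" .
  moreover have "measure_pmf.prob (imlsbm_pmf n L zs \<rho> p q) (- good_outputs \<gamma> \<epsilon> C)
      = 1 - measure_pmf.prob (imlsbm_pmf n L zs \<rho> p q) (good_outputs \<gamma> \<epsilon> C)"
    using measure_pmf.prob_compl[of "good_outputs \<gamma> \<epsilon> C" "imlsbm_pmf n L zs \<rho> p q"] by (simp add: Compl_eq_Diff_UNIV)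
  ultimately show ?thesis by linarith
qed

end

theorem mainTheorem6:
  "\<forall>(c1::real) (\<gamma>::real). 1 \<le> c1 \<and> exp c1 < \<gamma> \<longrightarrow>
    (\<exists>c2::real. 1 < c2 \<and>
      (\<forall>(c::real) (C0::real) (c'::real) (c0::real) (r::real).
         0 \<le> c \<and> 0 < C0 \<and> 0 \<le> c' \<and> c' < 1 \<and> 0 < c0 \<and> 1 \<le> r \<longrightarrow>
         (\<exists>C::real. \<forall>(n::nat) (L::nat) (zs::nat \<Rightarrow> int) (\<rho>::real) (p::nat \<Rightarrow> real)
              (q::nat \<Rightarrow> real) (\<beta>::real) (\<omega>::nat \<Rightarrow> real) (\<epsilon>::real).
            let pbar = (\<Sum>l<L. \<omega> l * p l); qbar = (\<Sum>l<L. \<omega> l * q l);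
                \<Delta>1 = (pbar - 2 * \<rho> * (1 - \<rho>) * (pbar - qbar))\<^sup>2;
                \<Delta>2 = real n * (\<Sum>l<L. (\<omega> l)\<^sup>2 * p l);
                \<Delta>3 = Max ((\<lambda>l. (\<omega> l)\<^sup>2 * (p l - q l)\<^sup>2) ` {..<L})
                       * ((real L)\<^sup>2 * \<rho>\<^sup>2 + (real n)\<^sup>2 * real L * \<rho> + real n * ln (real n))
                     + \<rho>\<^sup>2 * (1 - \<rho>)\<^sup>2 * (pbar - qbar)\<^sup>2
            in
            in_model_class n L zs \<rho> p q \<beta> \<and> \<rho> < 1/2 \<and>
            balanced_weights L \<omega> p q c0 c1 \<and>
            real L \<le> C0 * real n powr c \<and>
            (\<beta> = 1 \<or> pbar / (pbar - qbar)
                 \<le> c' * (2 * (1 - 2 * \<rho>)\<^sup>2 / (\<beta> - 1 / \<beta>)) + 2 * (\<rho> - \<rho>\<^sup>2)) \<and>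
            0 < \<epsilon>
            \<longrightarrow>
            measure_pmf.prob (imlsbm_pmf n L zs \<rho> p q)
              {A. \<forall>zt \<in> alg1_outputs n L A \<omega> p \<gamma> \<epsilon>.
                    loss n zt zs \<le> C * (2 + \<epsilon>) * (\<Delta>1 + \<Delta>2 + \<Delta>3)
                       / ((real n)\<^sup>2 * (1 - 2 * \<rho>)^4 * (pbar - qbar)\<^sup>2)}
              \<ge> 1 - 11 * real n powr (- r) - 1 / c2 ^ n)))"
\<comment> \<open>Exponentially small failure terms are absorbed into n^(-r) for large n, so the
  fixed value 2 serves as c2.\<close>
proof (intro allI impI, rule exI[of _ 2], rule conjI, simp, intro allI impI, goal_cases)
  case (1 c1 \<gamma> c C0 c' c0 r)
  then have c': "c' < 1" and r: "1 \<le> r" and c1: "1 \<le> c1" "exp c1 < \<gamma>" by auto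
  have "exp 1 \<le> exp c1" using c1(1) by simp
  then have \<gamma>: "exp 1 \<le> \<gamma>" using c1(2) by linarith
  \<comment> \<open>The first summand serves the dense regime; the second makes the claimed bound at
    least 1 when n is small or d < 24.\<close>
  define C where "C = 13824 * (3 * ((2 * (16 * \<gamma> + 264 + 3072 * (r + 3)) + 2)\<^sup>2 * \<bar>c0\<bar> + 4 * label_const (r + 3) + 1))
    + ((64 * r\<^sup>2 + 8)\<^sup>2 + 12 * \<bar>c0\<bar>)"
  have lc: "0 \<le> label_const (r + 3)" using r by (simp add: label_const_def)
  show ?case
  proof (rule exI[of _ C], unfold Let_def, intro allI impI, elim conjE)
    fix n L :: nat and zs and \<rho> :: real and p q and \<beta> :: real and \<omega> and \<epsilon> :: real
    assume model: "in_model_class n L zs \<rho> p q \<beta>" "\<rho> < 1/2" "balanced_weights L \<omega> p q c0 c1" and \<epsilon>: "0 < \<epsilon>"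
      and cond: "\<beta> = 1 \<or> (\<Sum>l<L. \<omega> l * p l) / ((\<Sum>l<L. \<omega> l * p l) - (\<Sum>l<L. \<omega> l * q l))
               \<le> c' * (2 * (1 - 2 * \<rho>)\<^sup>2 / (\<beta> - 1 / \<beta>)) + 2 * (\<rho> - \<rho>\<^sup>2)"
    interpret imlsbm n L zs \<rho> p q \<beta> \<omega> c0 c1 using model by unfold_locales
    have den: "(real n * (a - b))\<^sup>2 = (real n)\<^sup>2 * (1 - 2 * \<rho>) ^ 4 * (pbar - qbar)\<^sup>2"
      unfolding a_minus_b power_mult_distrib by (simp flip: power_mult)
    have sz: "real n / 6 \<le> card {i. i < n \<and> zs i = 1}" "real n / 6 \<le> card {i. i < n \<and> zs i = -1}"
      using cluster_sizes[OF cond[folded pbar_def qbar_def] c'] by auto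
    have "1 - 11 * real n powr (- r) \<le> measure_pmf.prob (imlsbm_pmf n L zs \<rho> p q) (good_outputs \<gamma> \<epsilon> C)"
    proof (cases "real n \<le> 64 * r\<^sup>2 + 8 \<or> real n * m < 24")
      case True
      have "good_outputs \<gamma> \<epsilon> C = UNIV"
        by (rule good_outputs_eq_UNIV_sparse[OF \<epsilon> True]) (use lc in \<open>simp add: C_def\<close>)
      then show ?thesis by simp
    next
      case False
      then show ?thesis
        by (intro prob_good_outputs_dense \<epsilon> r \<gamma> sz) (auto simp: C_def)
    qed
    moreover have "0 \<le> 1 / (2::real) ^ n" by simp
    ultimately have "1 - 11 * real n powr (- r) - 1 / 2 ^ n \<le> measure_pmf.prob (imlsbm_pmf n L zs \<rho> p q) (good_outputs \<gamma> \<epsilon> C)"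
      by linarith
    then show "1 - 11 * real n powr (- r) - 1 / 2 ^ n \<le> measure_pmf.prob (imlsbm_pmf n L zs \<rho> p q)
            {A. \<forall>zt \<in> alg1_outputs n L A \<omega> p \<gamma> \<epsilon>.
                  loss n zt zs \<le> C * (2 + \<epsilon>) * (((\<Sum>l<L. \<omega> l * p l) - 2 * \<rho> * (1 - \<rho>) * ((\<Sum>l<L. \<omega> l * p l) - (\<Sum>l<L. \<omega> l * q l)))\<^sup>2
                    + real n * (\<Sum>l<L. (\<omega> l)\<^sup>2 * p l) + (Max ((\<lambda>l. (\<omega> l)\<^sup>2 * (p l - q l)\<^sup>2) ` {..<L})
                     * ((real L)\<^sup>2 * \<rho>\<^sup>2 + (real n)\<^sup>2 * real L * \<rho> + real n * ln (real n))
                   + \<rho>\<^sup>2 * (1 - \<rho>)\<^sup>2 * ((\<Sum>l<L. \<omega> l * p l) - (\<Sum>l<L. \<omega> l * q l))\<^sup>2))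
                     / ((real n)\<^sup>2 * (1 - 2 * \<rho>)^4 * ((\<Sum>l<L. \<omega> l * p l) - (\<Sum>l<L. \<omega> l * q l))\<^sup>2)}"
      unfolding good_outputs_def den \<Delta>1_def \<Delta>2_def \<Delta>3_def W2_def pbar_def qbar_def .
  qed
qed

end
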